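(* Let $N\in\{1,2,3,4,5,6,7,8,9,10,12,13,16,18,25\}$ (the levels for which $\Gamma_0(N)$ has genus zero), let $k$ be an even integer, and let $n_0$ be the maximal order of vanishing at $\infty$ of a nonzero form in $M_k^\sharp(N)$. Then, with $q=e^{2\pi i z}$, \[\sum_{m=-n_0}^\infty f_{k,m}^{(N)}(\tau)\,q^m = \frac{f_{k,-n_0}^{(N)}(\tau)\, g_{2-k,n_0+1}^{(N)}(z)}{f_{0,1}^{(N)}(z)-f_{0,1}^{(N)}(\tau)}.\]
   Context: For a positive integer $N$ and an even integer $k$, $M_k^\sharp(N)$ denotes the space of weakly holomorphic modular forms of weight $k$ for $\Gamma_0(N)$ with poles allowed only at the cusp $\infty$, and $S_k^\sharp(N)\subseteq M_k^\sharp(N)$ the subspace of forms vanishing at every cusp other than $\infty$. Write $q=e^{2\pi i z}$. If $n_0$ is the maximal order of vanishing at $\infty$ of a nonzero form in $M_k^\sharp(N)$, then for each integer $m\ge -n_0$, $f_{k,m}^{(N)}$ is the unique form in $M_k^\sharp(N)$ with Fourier expansion $q^{-m}+\sum_{n>n_0}a_k^{(N)}(m,n)q^n$. If $n_1$ is the maximal order of vanishing at $\infty$ of a nonzero form in $S_k^\sharp(N)$, then for each integer $m\ge -n_1$, $g_{k,m}^{(N)}$ is the unique form in $S_k^\sharp(N)$ with Fourier expansion $q^{-m}+\sum_{n>n_1}b_k^{(N)}(m,n)q^n$. In particular $f_{0,1}^{(N)}=q^{-1}+O(q)$ is a Hauptmodul for $\Gamma_0(N)$. *)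

theory Defs
  imports "HOL-Complex_Analysis.Complex_Analysis"
begin

definition upper_half_plane :: "complex set" where
  "upper_half_plane = {z. Im z > 0}"

definition SL2Z :: "(int ^ 2 ^ 2) set" where
  "SL2Z = {A. det A = 1}"

definition Gamma0 :: "nat \<Rightarrow> (int ^ 2 ^ 2) set" where
  "Gamma0 N = {A \<in> SL2Z. int N dvd A $ 2 $ 1}"

definition moebius_action :: "int ^ 2 ^ 2 \<Rightarrow> complex \<Rightarrow> complex" where
  "moebius_action A z = (of_int (A $ 1 $ 1) * z + of_int (A $ 1 $ 2)) /
                 (of_int (A $ 2 $ 1) * z + of_int (A $ 2 $ 2))"

definition slash :: "int \<Rightarrow> int ^ 2 ^ 2 \<Rightarrow> (complex \<Rightarrow> complex) \<Rightarrow> complex \<Rightarrow> complex" where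
  "slash k A F z = (of_int (A $ 2 $ 1) * z + of_int (A $ 2 $ 2)) powi (-k) * F (moebius_action A z)"

text \<open>The coefficient family \<open>a\<close> is the expansion of \<open>F\<close> in powers of \<open>exp (2 * pi * \<i> * z / h)\<close>,
  with only finitely many negative exponents; it is unique if it exists.\<close>

definition q_expansion :: "nat \<Rightarrow> (complex \<Rightarrow> complex) \<Rightarrow> (int \<Rightarrow> complex) \<Rightarrow> bool" where
  "q_expansion h F a \<longleftrightarrow>
     (\<exists>n0. \<forall>n<n0. a n = 0) \<and>
     (\<forall>z\<in>upper_half_plane.
        ((\<lambda>n. a n * exp (2 * of_real pi * \<i> * of_int n * z / of_nat h)) has_sum F z) UNIV)"

text \<open>The behaviour of \<open>F\<close> at the cusp \<open>A \<infinity>\<close> is that of \<open>slash k A F\<close> at \<open>\<infinity>\<close>. The width of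
  every cusp of \<open>Gamma0 N\<close> divides \<open>N\<close>, so \<open>exp (2 * pi * \<i> * z / N)\<close> serves as a parameter at all
  of them; it need not be the local one, but the signs of orders do not depend on this choice.\<close>

definition weakly_holomorphic_form :: "nat \<Rightarrow> int \<Rightarrow> (complex \<Rightarrow> complex) \<Rightarrow> bool" where
  "weakly_holomorphic_form N k F \<longleftrightarrow>
     F holomorphic_on upper_half_plane \<and>
     (\<forall>A\<in>Gamma0 N. \<forall>z\<in>upper_half_plane. slash k A F z = F z) \<and>
     (\<forall>A\<in>SL2Z. \<exists>a. q_expansion N (slash k A F) a)"

text \<open>For \<open>A \<in> SL2Z\<close>, the cusp \<open>A \<infinity>\<close> is \<open>Gamma0 N\<close>-equivalent to \<open>\<infinity>\<close> iff \<open>A \<in> Gamma0 N\<close>, because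
  the stabiliser of \<open>\<infinity>\<close> in \<open>SL2Z\<close> is contained in \<open>Gamma0 N\<close>. So \<open>A\<close> ranging over
  \<open>SL2Z - Gamma0 N\<close> covers exactly the cusps other than \<open>\<infinity>\<close>.\<close>

definition M_sharp :: "nat \<Rightarrow> int \<Rightarrow> (complex \<Rightarrow> complex) set" where
  "M_sharp N k = {F. weakly_holomorphic_form N k F \<and>
     (\<forall>A\<in>SL2Z - Gamma0 N. \<exists>a. q_expansion N (slash k A F) a \<and> (\<forall>n<0. a n = 0))}"

definition S_sharp :: "nat \<Rightarrow> int \<Rightarrow> (complex \<Rightarrow> complex) set" where
  "S_sharp N k = {F \<in> M_sharp N k.
     \<forall>A\<in>SL2Z - Gamma0 N. \<exists>a. q_expansion N (slash k A F) a \<and> (\<forall>n\<le>0. a n = 0)}"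

text \<open>\<open>order_at_infinity F n\<close> holds for no \<open>n\<close> if \<open>F\<close> vanishes on the upper half-plane, so
  \<open>max_order V n\<close> is about the nonzero forms in \<open>V\<close> only.\<close>

definition order_at_infinity :: "(complex \<Rightarrow> complex) \<Rightarrow> int \<Rightarrow> bool" where
  "order_at_infinity F n \<longleftrightarrow> (\<exists>a. q_expansion 1 F a \<and> a n \<noteq> 0 \<and> (\<forall>l<n. a l = 0))"

definition max_order :: "(complex \<Rightarrow> complex) set \<Rightarrow> int \<Rightarrow> bool" where
  "max_order V n \<longleftrightarrow>
     (\<exists>F\<in>V. order_at_infinity F n) \<and> (\<forall>F\<in>V. \<forall>l. order_at_infinity F l \<longrightarrow> l \<le> n)"

text \<open>With \<open>n\<close> the maximal order of vanishing in \<open>V\<close> and \<open>m \<ge> -n\<close>, \<open>F\<close> is the form in \<open>V\<close> with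
  expansion \<open>q\<^sup>-\<^sup>m + (\<Sum>l>n. a l * q\<^sup>l)\<close>: it is \<open>f\<^sub>k\<^sub>,\<^sub>m\<close> for \<open>V = M_sharp N k\<close> and \<open>g\<^sub>k\<^sub>,\<^sub>m\<close> for
  \<open>V = S_sharp N k\<close>. On the upper half-plane it is unique by maximality of \<open>n\<close>.\<close>

definition reduced_form :: "(complex \<Rightarrow> complex) set \<Rightarrow> int \<Rightarrow> (complex \<Rightarrow> complex) \<Rightarrow> bool" where
  "reduced_form V m F \<longleftrightarrow>
     F \<in> V \<and>
     (\<exists>n a. max_order V n \<and> m \<ge> -n \<and> q_expansion 1 F a \<and>
            (\<forall>l\<le>n. a l = (if l = -m then 1 else 0)))"

end

theory Submission
  imports Defs
begin

text \<open>
  Write \<open>J = f\<^sub>0\<^sub>,\<^sub>1\<close> and \<open>n1\<close> for the maximal order in weight \<open>2 - k\<close>. Since \<open>J f\<^sub>k\<^sub>,\<^sub>m\<close> is a combination of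
  \<open>f\<^sub>k\<^sub>,\<^sub>m\<^sub>+\<^sub>1\<close> and earlier basis elements, the values \<open>f\<^sub>k\<^sub>,\<^sub>m(\<tau>)\<close> satisfy a recursion, which says that the
  generating function times \<open>J(z) - J(\<tau>)\<close> is \<open>f\<^sub>k\<^sub>,\<^sub>-\<^sub>n\<^sub>0(\<tau>)\<close> times a series in \<open>q\<close> with coefficients
  \<open>- a\<^sub>k(m, n0 + 1)\<close>. By duality this series is \<open>g\<^sub>2\<^sub>-\<^sub>k\<^sub>,\<^sub>n\<^sub>0\<^sub>+\<^sub>1\<close>: the form \<open>f\<^sub>k\<^sub>,\<^sub>m g\<^sub>2\<^sub>-\<^sub>k\<^sub>,\<^sub>n\<^sub>0\<^sub>+\<^sub>1\<close> has weight two
  and vanishes at the other cusps, so its constant term is zero.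

  The constant term vanishes because the trace to level one has a primitive \<open>p\<close> on the half-plane;
  \<open>p(-1/z) - p(z)\<close> is constant, zero by evaluation at \<open>\<i>\<close>, and at a cube root of unity it equals the
  constant \<open>p(z + 1) - p(z)\<close>.

  Both the convergence for \<open>Im z\<close> large and the inequality \<open>n1 \<ge> - n0 - 1\<close> rest on the injectivity of
  \<open>J\<close> on the set of all points and cusps modulo \<open>Gamma0 N\<close>. Values attained at two inequivalent points
  form a bounded open set that is closed off a countable set; the complement of a countable
  set in the plane is connected, so there are none. If \<open>f = f\<^sub>k\<^sub>,\<^sub>-\<^sub>n\<^sub>0\<close> vanished at a point to at least the order of
  \<open>J - w\<close>, with \<open>w\<close> the value of \<open>J\<close> there, then \<open>f / (J - w)\<close> would have order \<open>n0 + 1\<close> at \<open>\<infinity>\<close>; hence \<open>J' / f\<close> is holomorphic, lies in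
  the space of weight \<open>2 - k\<close>, and has order \<open>- n0 - 1\<close>.
\<close>

no_notation fps_nth (infixl "$" 75)

section \<open>The upper half-plane and the local parameters at the cusps\<close>

abbreviation (input) "UHP \<equiv> upper_half_plane"

lemma open_H: "open UHP" and convex_H: "convex UHP" and connected_H: "connected UHP"
  and ii_in_H: "\<i> \<in> UHP"
proof -
  show "open UHP" unfolding upper_half_plane_def by (rule open_halfspace_Im_gt)
  show "convex UHP" unfolding upper_half_plane_def by (rule convex_halfspace_Im_gt)
  then show "connected UHP" by (rule convex_connected)
qed (simp add: upper_half_plane_def)

lemma in_H_iff: "z \<in> UHP \<longleftrightarrow> Im z > 0"
  by (simp add: upper_half_plane_def)

text \<open>The parameter with period \<open>h\<close>. For \<open>h = 0\<close> division by zero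
  makes it constant, hence the hypotheses \<open>h > 0\<close> below.\<close>

definition qpar :: "nat \<Rightarrow> complex \<Rightarrow> complex" where
  "qpar h z = exp (2 * of_real pi * \<i> * z / of_nat h)"

lemma qpar_nz [simp]: "qpar h z \<noteq> 0"
  by (simp add: qpar_def)

lemma norm_qpar: "norm (qpar h z) = exp (- (2 * pi * Im z / real h))"
  by (simp add: qpar_def)

lemma qpar_in_ball: "h > 0 \<Longrightarrow> z \<in> UHP \<Longrightarrow> qpar h z \<in> ball 0 1"
  by (simp add: norm_qpar in_H_iff)

lemma qpar_in_ball_iff: "h > 0 \<Longrightarrow> norm (qpar h z) < 1 \<longleftrightarrow> z \<in> UHP"
  by (simp add: norm_qpar in_H_iff zero_less_divide_iff zero_less_mult_iff)

lemma qpar_surj: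
  assumes "h > 0" "q \<in> ball 0 1" "q \<noteq> 0"
  obtains z where "z \<in> UHP" "qpar h z = q"
proof -
  define z where "z = of_nat h * Ln q / (2 * of_real pi * \<i>)"
  have "qpar h z = q" using assms by (simp add: qpar_def z_def)
  moreover from this have "z \<in> UHP" using qpar_in_ball_iff[of h z] assms by simp
  ultimately show ?thesis using that by blast
qed

lemma qpar_powi: "qpar h z powi n = exp (2 * of_real pi * \<i> * of_int n * z / of_nat h)"
  by (simp add: qpar_def exp_power_int mult_ac)

lemma qpar_power_h: "h > 0 \<Longrightarrow> qpar h z ^ h = qpar 1 z"
  by (simp add: qpar_def flip: exp_of_nat_mult)

lemma qpar_add: "h > 0 \<Longrightarrow> qpar h (z + of_nat h) = qpar h z"
  by (simp add: qpar_def ring_distribs add_divide_distrib exp_add mult.commute)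

lemma qpar_1_eq_iff: "qpar 1 z = qpar 1 w \<longleftrightarrow> (\<exists>n::int. z = w + of_int n)"
proof -
  have "qpar 1 z = qpar 1 w \<longleftrightarrow> (\<exists>n::int. 2 * of_real pi * \<i> * z = 2 * of_real pi * \<i> * w + of_real (of_int (2 * n) * pi) * \<i>)"
    by (simp add: qpar_def exp_eq)
  also have "\<dots> \<longleftrightarrow> (\<exists>n::int. z = w + of_int n)"
  proof (rule ex_cong1)
    fix n :: int
    have "2 * of_real pi * \<i> * z = 2 * of_real pi * \<i> * w + of_real (of_int (2 * n) * pi) * \<i> \<longleftrightarrow>
      (2 * of_real pi * \<i>) * z = (2 * of_real pi * \<i>) * (w + of_int n)"
      by (simp add: algebra_simps)
    also have "\<dots> \<longleftrightarrow> z = w + of_int n" by (subst mult_cancel_left) simp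
    finally show "2 * of_real pi * \<i> * z = 2 * of_real pi * \<i> * w + of_real (of_int (2 * n) * pi) * \<i> \<longleftrightarrow>
      z = w + of_int n" .
  qed
  finally show ?thesis .
qed

lemma qpar_has_deriv [derivative_intros]:
  "(qpar h has_field_derivative 2 * of_real pi * \<i> / of_nat h * qpar h z) (at z within A)"
  unfolding qpar_def by (cases "h = 0") (auto intro!: derivative_eq_intros)

lemma holomorphic_qpar [holomorphic_intros]:
  "f holomorphic_on A \<Longrightarrow> (\<lambda>z. qpar h (f z)) holomorphic_on A"
  unfolding qpar_def divide_inverse by (intro holomorphic_intros)

text \<open>The branch is the principal logarithm of \<open>q / q0\<close>, holomorphic as long as
  this ratio stays in the right half-plane. Such sections turn functions on the half-plane into
  functions of the parameter.\<close>

lemma qpar_local_section: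
  assumes "h > 0" "z0 \<in> UHP"
  obtains r l where "r > 0" "l holomorphic_on ball (qpar h z0) r" "l (qpar h z0) = z0"
    "\<And>q. q \<in> ball (qpar h z0) r \<Longrightarrow> l q \<in> UHP \<and> qpar h (l q) = q"
proof -
  define q0 where "q0 = qpar h z0"
  have q0: "q0 \<in> ball 0 1" "q0 \<noteq> 0" using qpar_in_ball[OF assms] by (auto simp: q0_def)
  \<comment> \<open>The first bound keeps \<open>q / q0\<close> within distance 1 of 1, off the cut;
    the second keeps \<open>q\<close> in the unit disc, so that \<open>l q\<close> lies in the
    half-plane.\<close>
  define r where "r = min (norm q0) (1 - norm q0)"
  have r: "r > 0" using q0 by (simp add: r_def)
  define l where "l = (\<lambda>q. z0 + of_nat h * Ln (q / q0) / (2 * of_real pi * \<i>))"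
  have *: "Re (q / q0) > 0" "q \<noteq> 0" "norm q < 1" if "q \<in> ball q0 r" for q
  proof -
    have d: "norm (q - q0) < norm q0" "norm (q - q0) < 1 - norm q0"
      using that by (auto simp: r_def dist_norm norm_minus_commute)
    have "norm (q / q0 - 1) < 1"
    proof -
      have "q / q0 - 1 = (q - q0) / q0" using q0 by (simp add: field_simps)
      then show ?thesis using d(1) q0 by (simp add: norm_divide)
    qed
    moreover have "\<bar>Re (q / q0 - 1)\<bar> \<le> norm (q / q0 - 1)" by (rule abs_Re_le_cmod)
    ultimately show "Re (q / q0) > 0" by simp
    then show "q \<noteq> 0" by auto
    show "norm q < 1" using d(2) norm_triangle_ineq[of "q - q0" q0] by simp
  qed
  have "l holomorphic_on ball q0 r"
    unfolding l_def
  proof (intro holomorphic_intros)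
    fix q assume "q \<in> ball q0 r"
    then have "Re (q / q0) > 0" using * by blast
    then show "q / q0 \<notin> \<real>\<^sub>\<le>\<^sub>0" by (auto simp: complex_nonpos_Reals_iff)
  qed (use q0 in auto)
  moreover have "l q \<in> UHP \<and> qpar h (l q) = q" if "q \<in> ball q0 r" for q
  proof -
    have "qpar h (l q) = q0 * exp (Ln (q / q0))"
      using assms by (simp add: qpar_def l_def q0_def ring_distribs add_divide_distrib exp_add)
    also have "\<dots> = q" using *[OF that] q0 by simp
    finally have "qpar h (l q) = q" .
    moreover from this have "l q \<in> UHP" using qpar_in_ball_iff[of h "l q"] assms *[OF that] by simp
    ultimately show ?thesis by blast
  qed
  moreover have "l q0 = z0" using q0 by (simp add: l_def)
  ultimately show ?thesis using that r unfolding q0_def by blast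
qed

subsection \<open>Local divisibility\<close>

text \<open>Comparison of orders of vanishing without defining orders: the quotient
  \<open>f / g\<close> extends analytically to \<open>z\<close>.\<close>

definition dvd_at :: "(complex \<Rightarrow> complex) \<Rightarrow> (complex \<Rightarrow> complex) \<Rightarrow> complex \<Rightarrow> bool" where
  "dvd_at g f z \<longleftrightarrow> (\<exists>q. q analytic_on {z} \<and> (\<forall>\<^sub>F w in nhds z. f w = q w * g w))"

lemma dvd_at_nonzero:
  assumes "f analytic_on {z}" "g analytic_on {z}" "g z \<noteq> 0"
  shows "dvd_at g f z"
proof -
  have "isCont g z" using assms(2) by (rule analytic_at_imp_isCont)
  then have "\<forall>\<^sub>F w in nhds z. g w \<noteq> 0"
    using assms(3) unfolding eventually_nhds_conv_at
    by (simp add: continuous_within tendsto_imp_eventually_ne)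
  then have "\<forall>\<^sub>F w in nhds z. f w = f w / g w * g w" by eventually_elim simp
  moreover have "(\<lambda>w. f w / g w) analytic_on {z}" by (intro analytic_intros assms) (use assms in auto)
  ultimately show ?thesis unfolding dvd_at_def by blast
qed

text \<open>The quotient is taken as a limit, so it is one global function that agrees with every
  local quotient. By the last conclusion its value at a point can be read off from any continuous
  local quotient; invariance and values at cusps are obtained in this way later.\<close>

lemma holomorphic_quotient:
  assumes "open S" and dv: "\<And>z. z \<in> S \<Longrightarrow> dvd_at g f z"
    and nz: "\<And>z. z \<in> S \<Longrightarrow> \<forall>\<^sub>F w in at z. g w \<noteq> 0"
  obtains h where "h holomorphic_on S" "\<And>z. z \<in> S \<Longrightarrow> f z = h z * g z"
    "\<And>z q. z \<in> S \<Longrightarrow> isCont q z \<Longrightarrow> \<forall>\<^sub>F w in at z. f w = q w * g w \<Longrightarrow> h z = q z"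
proof -
  define h where "h = (\<lambda>z. Lim (at z) (\<lambda>w. f w / g w))"
  have h: "h z = q z" if "z \<in> S" "isCont q z" "\<forall>\<^sub>F w in at z. f w = q w * g w" for z q
  proof -
    have "\<forall>\<^sub>F w in at z. q w = f w / g w"
      using nz[OF that(1)] that(3) by eventually_elim auto
    moreover have "(q \<longlongrightarrow> q z) (at z)" using that(2) by (simp add: continuous_within)
    ultimately have "((\<lambda>w. f w / g w) \<longlongrightarrow> q z) (at z)"
      by (rule Lim_transform_eventually[rotated])
    then show ?thesis unfolding h_def by (simp add: tendsto_Lim)
  qed
  have loc: "h analytic_on {z} \<and> f z = h z * g z" if zS: "z \<in> S" for z
  proof -
    obtain q where q: "q analytic_on {z}" "\<forall>\<^sub>F w in nhds z. f w = q w * g w"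
      using dv[OF zS] unfolding dvd_at_def by blast
    have "\<forall>\<^sub>F w in nhds z. q analytic_on {w}"
    proof -
      obtain e where "e > 0" "q holomorphic_on ball z e" using q(1) analytic_at_ball by blast
      then show ?thesis unfolding eventually_nhds
        by (intro exI[of _ "ball z e"]) (auto intro: holomorphic_on_imp_analytic_at)
    qed
    moreover have "\<forall>\<^sub>F w in nhds z. \<forall>\<^sub>F u in nhds w. f u = q u * g u"
      using q(2) by (simp add: eventually_eventually)
    moreover have "\<forall>\<^sub>F w in nhds z. w \<in> S" using zS assms(1) by (simp add: eventually_nhds_in_open)
    \<comment> \<open>One local quotient \<open>q\<close> serves at all points near
      \<open>z\<close>, so \<open>h\<close> is analytic there as \<open>q\<close> is.\<close>
    ultimately have *: "\<forall>\<^sub>F w in nhds z. h w = q w"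
    proof eventually_elim
      case (elim w)
      then show ?case
        by (intro h) (auto simp: eventually_nhds_conv_at intro: analytic_at_imp_isCont)
    qed
    then have "h analytic_on {z}" using q(1) by (subst analytic_at_cong[OF * refl])
    moreover have "h z = q z" "f z = q z * g z" using * q(2) eventually_nhds_x_imp_x by fastforce+
    ultimately show ?thesis by simp
  qed
  have "h holomorphic_on S"
    using loc by (meson analytic_imp_holomorphic analytic_on_analytic_at)
  then show ?thesis using that loc h by blast
qed

subsection \<open>The modular group and the slash action\<close>

definition aut :: "int ^ 2 ^ 2 \<Rightarrow> complex \<Rightarrow> complex" where
  "aut A z = of_int (A $ 2 $ 1) * z + of_int (A $ 2 $ 2)"

definition mat2 :: "int \<Rightarrow> int \<Rightarrow> int \<Rightarrow> int \<Rightarrow> int ^ 2 ^ 2" where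
  "mat2 a b c d = vector [vector [a, b], vector [c, d]]"

lemma mat2_simps [simp]:
  "mat2 a b c d $ 1 $ 1 = a" "mat2 a b c d $ 1 $ 2 = b"
  "mat2 a b c d $ 2 $ 1 = c" "mat2 a b c d $ 2 $ 2 = d"
  by (simp_all add: mat2_def)

lemma mat2_eq_iff: "(A :: int^2^2) = B \<longleftrightarrow> A$1$1 = B$1$1 \<and> A$1$2 = B$1$2 \<and> A$2$1 = B$2$1 \<and> A$2$2 = B$2$2"
  by (auto simp: vec_eq_iff forall_2)

lemma mat2_mult [simp]:
  "((A :: int^2^2) ** B) $ 1 $ 1 = A$1$1 * B$1$1 + A$1$2 * B$2$1"
  "(A ** B) $ 1 $ 2 = A$1$1 * B$1$2 + A$1$2 * B$2$2"
  "(A ** B) $ 2 $ 1 = A$2$1 * B$1$1 + A$2$2 * B$2$1"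
  "(A ** B) $ 2 $ 2 = A$2$1 * B$1$2 + A$2$2 * B$2$2"
  by (simp_all add: matrix_matrix_mult_def sum_2)

lemma SL2Z_iff: "A \<in> SL2Z \<longleftrightarrow> A$1$1 * A$2$2 - A$1$2 * A$2$1 = 1"
  by (simp add: SL2Z_def det_2)

lemma SL2Z_of_int:
  "A \<in> SL2Z \<Longrightarrow> of_int (A$1$1) * of_int (A$2$2) - of_int (A$1$2) * of_int (A$2$1) = (1 :: 'a :: comm_ring_1)"
  by (simp add: SL2Z_iff flip: of_int_mult of_int_diff)

text \<open>The adjugate: it is the inverse in \<open>SL2Z\<close>, and its entries are
  explicit.\<close>

definition inv2 :: "int ^ 2 ^ 2 \<Rightarrow> int ^ 2 ^ 2" where
  "inv2 A = mat2 (A$2$2) (- A$1$2) (- A$2$1) (A$1$1)"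

lemma inv2_simps [simp]:
  "inv2 A $ 1 $ 1 = A$2$2" "inv2 A $ 1 $ 2 = - A$1$2"
  "inv2 A $ 2 $ 1 = - A$2$1" "inv2 A $ 2 $ 2 = A$1$1"
  by (simp_all add: inv2_def)

lemma SL2Z_mult: "A \<in> SL2Z \<Longrightarrow> B \<in> SL2Z \<Longrightarrow> A ** B \<in> SL2Z"
  by (simp add: SL2Z_def det_mul)

lemma SL2Z_inv2: "A \<in> SL2Z \<Longrightarrow> inv2 A \<in> SL2Z"
  by (simp add: SL2Z_iff algebra_simps)

lemma SL2Z_one: "mat 1 \<in> SL2Z"
  by (simp add: SL2Z_def)

lemma inv2_left: "A \<in> SL2Z \<Longrightarrow> inv2 A ** A = mat 1"
  and inv2_right: "A \<in> SL2Z \<Longrightarrow> A ** inv2 A = mat 1"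
  by (simp_all add: SL2Z_iff mat2_eq_iff mat_def algebra_simps)

lemma Gamma0_SL2Z: "A \<in> Gamma0 N \<Longrightarrow> A \<in> SL2Z"
  by (simp add: Gamma0_def)

lemma Gamma0_mult: "A \<in> Gamma0 N \<Longrightarrow> B \<in> Gamma0 N \<Longrightarrow> A ** B \<in> Gamma0 N"
  by (simp add: Gamma0_def SL2Z_mult)

lemma Gamma0_inv2: "A \<in> Gamma0 N \<Longrightarrow> inv2 A \<in> Gamma0 N"
  by (simp add: Gamma0_def SL2Z_inv2)

lemma Gamma0_one: "mat 1 \<in> Gamma0 N"
  unfolding Gamma0_def by (simp add: SL2Z_one) (simp add: mat_def)

lemma inv2_cancel_right: "A \<in> SL2Z \<Longrightarrow> (B ** A) ** inv2 A = B"
  by (simp add: inv2_right flip: matrix_mul_assoc)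

lemma Gamma0_cancel_right: "A \<in> Gamma0 N \<Longrightarrow> B ** A \<in> Gamma0 N \<longleftrightarrow> B \<in> Gamma0 N"
  using Gamma0_mult[of "B ** A" N "inv2 A"] Gamma0_mult[of B N A] Gamma0_inv2[of A N]
  by (auto simp: inv2_cancel_right Gamma0_SL2Z)

abbreviation "tmat n \<equiv> mat2 1 n 0 1"

lemma tmat_SL2Z: "tmat n \<in> SL2Z" and tmat_Gamma0: "tmat n \<in> Gamma0 N"
  by (simp_all add: SL2Z_iff Gamma0_def)

lemma moebius_tmat [simp]: "moebius_action (tmat n) z = z + of_int n"
  by (simp add: moebius_action_def)

lemma moebius_one [simp]: "moebius_action (mat 1) z = z"
  by (simp add: moebius_action_def mat_def)

lemma aut_nz:
  assumes "A \<in> SL2Z" "z \<in> UHP"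
  shows "aut A z \<noteq> 0"
proof
  assume "aut A z = 0"
  then have "Im (aut A z) = 0" "Re (aut A z) = 0" by simp_all
  then have "A$2$1 = 0" "A$2$2 = 0" using assms(2) by (auto simp: aut_def in_H_iff)
  then show False using assms(1) by (simp add: SL2Z_iff)
qed

lemma moebius_eq: "moebius_action A z = (of_int (A $ 1 $ 1) * z + of_int (A $ 1 $ 2)) / aut A z"
  by (simp add: moebius_action_def aut_def)

lemma Im_moebius:
  assumes "A \<in> SL2Z"
  shows "Im (moebius_action A z) = Im z / (norm (aut A z))\<^sup>2"
proof -
  have e: "real_of_int (A$1$1) * real_of_int (A$2$2) - real_of_int (A$1$2) * real_of_int (A$2$1) = 1"
    by (rule SL2Z_of_int[OF assms])
  have "Im (moebius_action A z) = (real_of_int (A$1$1) * real_of_int (A$2$2) - real_of_int (A$1$2) * real_of_int (A$2$1)) * Im z / (norm (aut A z))\<^sup>2"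
    unfolding moebius_eq Im_divide cmod_power2 by (simp add: aut_def algebra_simps)
  then show ?thesis using e by simp
qed

lemma moebius_in_H: "A \<in> SL2Z \<Longrightarrow> z \<in> UHP \<Longrightarrow> moebius_action A z \<in> UHP"
  using aut_nz[of A z] by (simp add: in_H_iff Im_moebius)

text \<open>The cocycle relation, obtained by clearing the denominator \<open>aut B z\<close>; it
  makes the slash operators a right action.\<close>

lemma aut_mult:
  assumes "B \<in> SL2Z" "z \<in> UHP"
  shows "aut (A ** B) z = aut A (moebius_action B z) * aut B z"
  using aut_nz[OF assms] unfolding aut_def[of A] moebius_eq[of B]
  by (simp add: field_simps) (simp add: aut_def algebra_simps)

lemma moebius_mult:
  assumes "A \<in> SL2Z" "B \<in> SL2Z" "z \<in> UHP"
  shows "moebius_action (A ** B) z = moebius_action A (moebius_action B z)"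
proof -
  have nz: "aut B z \<noteq> 0" "aut A (moebius_action B z) \<noteq> 0"
    by (rule aut_nz moebius_in_H assms)+
  have "moebius_action (A ** B) z = (of_int ((A ** B) $ 1 $ 1) * z + of_int ((A ** B) $ 1 $ 2)) / (aut A (moebius_action B z) * aut B z)"
    unfolding moebius_eq[of "A ** B"] aut_mult[OF assms(2,3)] ..
  also have "of_int ((A ** B) $ 1 $ 1) * z + of_int ((A ** B) $ 1 $ 2) =
     (of_int (A$1$1) * moebius_action B z + of_int (A$1$2)) * aut B z"
    unfolding moebius_eq[of B] using nz(1) by (simp add: field_simps) (simp add: aut_def algebra_simps)
  finally show ?thesis unfolding moebius_eq[of A] using nz by simp
qed

lemma moebius_inv2_left: "A \<in> SL2Z \<Longrightarrow> z \<in> UHP \<Longrightarrow> moebius_action (inv2 A) (moebius_action A z) = z"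
  by (metis SL2Z_inv2 inv2_left moebius_mult moebius_one)

lemma moebius_inv2_right: "A \<in> SL2Z \<Longrightarrow> z \<in> UHP \<Longrightarrow> moebius_action A (moebius_action (inv2 A) z) = z"
  by (metis SL2Z_inv2 inv2_right moebius_mult moebius_one)

lemma slash_eq: "slash k A F z = aut A z powi (-k) * F (moebius_action A z)"
  by (simp add: slash_def aut_def)

lemma slash_mult:
  assumes "A \<in> SL2Z" "B \<in> SL2Z" "z \<in> UHP"
  shows "slash k (A ** B) F z = slash k B (slash k A F) z"
  using assms by (simp add: slash_eq aut_mult moebius_mult power_int_mult_distrib)

lemma slash_cong: "A \<in> SL2Z \<Longrightarrow> (\<And>z. z \<in> UHP \<Longrightarrow> F z = G z) \<Longrightarrow> z \<in> UHP \<Longrightarrow> slash k A F z = slash k A G z"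
  by (simp add: slash_eq moebius_in_H)

lemma slash_one [simp]: "slash k (mat 1) F z = F z"
  unfolding slash_eq moebius_one by (simp add: aut_def mat_def)

lemma slash_times:
  assumes "A \<in> SL2Z" "z \<in> UHP"
  shows "slash (k + l) A (\<lambda>z. F z * G z) z = slash k A F z * slash l A G z"
  using aut_nz[OF assms] by (simp add: slash_eq power_int_diff power_int_minus field_simps)

lemma slash_0: "slash 0 A F z = F (moebius_action A z)"
  by (simp add: slash_eq)

lemma slash_add: "slash k A (\<lambda>z. F z + G z) z = slash k A F z + slash k A G z"
  by (simp add: slash_eq algebra_simps)

lemma slash_cmult: "slash k A (\<lambda>z. c * F z) z = c * slash k A F z"
  by (simp add: slash_eq algebra_simps)

lemma moebius_has_deriv:
  assumes "A \<in> SL2Z" "z \<in> UHP"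
  shows "(moebius_action A has_field_derivative aut A z powi (-2)) (at z)"
proof -
  let ?a = "of_int (A$1$1) :: complex" and ?b = "of_int (A$1$2) :: complex"
  let ?c = "of_int (A$2$1) :: complex" and ?d = "of_int (A$2$2) :: complex"
  have e: "?a * ?d - ?b * ?c = 1"
    by (rule SL2Z_of_int[OF assms(1)])
  have nz: "?c * z + ?d \<noteq> 0" using aut_nz[OF assms] by (simp add: aut_def)
  have "((\<lambda>z. (?a * z + ?b) / (?c * z + ?d)) has_field_derivative
      (?a * (?c * z + ?d) - (?a * z + ?b) * ?c) / ((?c * z + ?d) * (?c * z + ?d))) (at z)"
    using nz by (auto intro!: derivative_eq_intros)
  also have "?a * (?c * z + ?d) - (?a * z + ?b) * ?c = 1" using e by (simp add: algebra_simps)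
  also have "1 / ((?c * z + ?d) * (?c * z + ?d)) = aut A z powi (-2)"
    by (simp add: aut_def power_int_minus power2_eq_square divide_inverse)
  finally show ?thesis unfolding moebius_action_def .
qed

lemma holomorphic_moebius: "A \<in> SL2Z \<Longrightarrow> moebius_action A holomorphic_on UHP"
  by (meson DERIV_subset field_differentiable_def holomorphic_onI moebius_has_deriv
        field_differentiable_at_within)

lemma holomorphic_aut: "aut A holomorphic_on UHP"
  unfolding aut_def by (intro holomorphic_intros)

lemma holomorphic_comp_moebius:
  "A \<in> SL2Z \<Longrightarrow> F holomorphic_on UHP \<Longrightarrow> (\<lambda>z. F (moebius_action A z)) holomorphic_on UHP"
  using holomorphic_on_compose_gen[OF holomorphic_moebius, of A F UHP] moebius_in_H
  by (auto simp: o_def)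

lemma holomorphic_slash:
  "A \<in> SL2Z \<Longrightarrow> F holomorphic_on UHP \<Longrightarrow> slash k A F holomorphic_on UHP"
  unfolding slash_eq by (intro holomorphic_intros holomorphic_comp_moebius holomorphic_aut) (auto simp: aut_nz)

text \<open>The derivative of the Moebius map is \<open>aut A z powi (-2)\<close>, so
  differentiation takes weight 0 to weight 2.\<close>

lemma slash_deriv:
  assumes "A \<in> SL2Z" "F holomorphic_on UHP" "z \<in> UHP"
  shows "slash 2 A (deriv F) z = deriv (\<lambda>z. F (moebius_action A z)) z"
proof -
  have "(F has_field_derivative deriv F (moebius_action A z)) (at (moebius_action A z))"
    using assms open_H by (intro holomorphic_derivI[of F UHP]) (auto intro: moebius_in_H)
  then have "((\<lambda>z. F (moebius_action A z)) has_field_derivative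
      deriv F (moebius_action A z) * aut A z powi (-2)) (at z)"
    by (rule DERIV_chain2[OF _ moebius_has_deriv]) (use assms in auto)
  then show ?thesis by (simp add: slash_eq DERIV_imp_deriv mult.commute)
qed

subsection \<open>Laurent expansions in the parameter of a cusp\<close>

abbreviation "tcoeff P n \<equiv> fps_nth (fps_expansion P 0) n"

text \<open>A form of expansion in which products, quotients and uniqueness become statements about
  holomorphic functions on the disc. The exponent \<open>m\<close> only bounds the order from below:
  \<open>P 0\<close> may vanish.\<close>

definition qlaurent :: "nat \<Rightarrow> int \<Rightarrow> (complex \<Rightarrow> complex) \<Rightarrow> (complex \<Rightarrow> complex) \<Rightarrow> bool" where
  "qlaurent h m F P \<longleftrightarrow> P holomorphic_on ball 0 1 \<and> (\<forall>z\<in>UHP. F z = qpar h z powi m * P (qpar h z))"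

lemma holomorphic_ball_has_fps_expansion:
  "P holomorphic_on ball 0 1 \<Longrightarrow> P has_fps_expansion fps_expansion P 0"
  by (rule has_fps_expansion_fps_expansion[of "ball 0 1"]) auto

lemma holomorphic_ball_has_sum:
  assumes "P holomorphic_on ball 0 r" "q \<in> ball 0 r"
  shows "((\<lambda>n. tcoeff P n * q ^ n) has_sum P q) UNIV"
proof (rule norm_summable_imp_has_sum)
  show s: "(\<lambda>n. tcoeff P n * q ^ n) sums P q"
    using holomorphic_power_series[OF assms] by (simp add: fps_expansion_def)
  \<comment> \<open>\<open>has_sum\<close> is unconditional; absolute convergence at
    \<open>q\<close> follows from convergence at the larger radius \<open>r'\<close>.\<close>
  obtain r' where r': "norm q < r'" "r' < r" using assms(2) dense by auto
  have "summable (\<lambda>n. tcoeff P n * of_real r' ^ n)"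
    using holomorphic_power_series[OF assms(1), of "of_real r'"] r' norm_ge_zero[of q]
    by (auto simp: fps_expansion_def sums_iff)
  then show "summable (\<lambda>n. norm (tcoeff P n * q ^ n))"
    by (rule powser_insidea) (use r' norm_ge_zero[of q] in auto)
qed

text \<open>Every nonzero point of the unit disc is the parameter of some point of the half-plane,
  so the power series with the shifted coefficients converges on the whole disc and has radius at
  least 1.\<close>

lemma q_expansion_imp_qlaurent:
  assumes h: "h > 0" and q: "q_expansion h F a" and m: "\<And>n. n < m \<Longrightarrow> a n = 0"
  obtains P where "qlaurent h m F P" "\<And>n. tcoeff P n = a (m + int n)"
proof -
  define b where "b = Abs_fps (\<lambda>n. a (m + int n))"
  have hs: "((\<lambda>n. fps_nth b n * qpar h z ^ n) has_sum qpar h z powi (-m) * F z) UNIV" if "z \<in> UHP" for z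
  proof -
    have "((\<lambda>n. a n * qpar h z powi n) has_sum F z) UNIV"
      using q that unfolding q_expansion_def qpar_powi by blast
    then have "((\<lambda>n. a n * qpar h z powi n) has_sum F z) {m..}"
      by (subst (asm) has_sum_cong_neutral[where T = "{m..}" and g = "\<lambda>n. a n * qpar h z powi n"]) (use m in auto)
    then have "((\<lambda>n. a (m + int n) * qpar h z powi (m + int n)) has_sum F z) UNIV"
      by (subst has_sum_reindex_bij_witness[where T = "{m..}" and j = "\<lambda>n. m + int n" and i = "\<lambda>n. nat (n - m)"
         and h = "\<lambda>n. a n * qpar h z powi n"]) auto
    from has_sum_cmult_right[OF this, of "qpar h z powi (-m)"] show ?thesis
      by (simp add: b_def power_int_add power_int_minus field_simps)
  qed
  have sums: "(\<lambda>n. fps_nth b n * q ^ n) sums (eval_fps b q) \<and> ereal (norm q) \<le> fps_conv_radius b" if "norm q < 1" for q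
  proof (cases "q = 0")
    case True
    then show ?thesis using powser_sums_zero[of "fps_nth b"]
      by (auto simp: eval_fps_def sums_iff fps_conv_radius_def conv_radius_nonneg simp flip: zero_ereal_def)
  next
    case False
    with h that obtain z where "z \<in> UHP" "qpar h z = q" by (metis qpar_surj mem_ball_0)
    with hs[of z] have "summable (\<lambda>n. fps_nth b n * q ^ n)" using has_sum_imp_sums sums_summable by blast
    then show ?thesis
      by (auto simp: eval_fps_def fps_conv_radius_def intro!: conv_radius_geI summable_sums)
  qed
  have cr: "fps_conv_radius b \<ge> 1"
  proof (rule ccontr)
    assume "\<not> fps_conv_radius b \<ge> 1"
    then obtain r where r: "ereal r < 1" "fps_conv_radius b < ereal r"
      using ereal_dense2[of "fps_conv_radius b" 1] by (auto simp: not_le)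
    have "fps_conv_radius b \<ge> 0" by (simp add: fps_conv_radius_def conv_radius_nonneg)
    then have "0 \<le> ereal r" using r by (metis less_imp_le order_trans)
    then have "0 \<le> r" by simp
    then show False using sums[of "of_real r"] r by auto
  qed
  have ho: "eval_fps b holomorphic_on ball 0 1"
  proof (rule holomorphic_on_eval_fps)
    show "ball (0::complex) 1 \<subseteq> eball 0 (fps_conv_radius b)"
    proof
      fix x :: complex assume "x \<in> ball 0 1"
      then have "ereal (norm x) < 1" by simp
      also note cr
      finally show "x \<in> eball 0 (fps_conv_radius b)" by (simp add: in_eball_iff)
    qed
  qed
  have "qlaurent h m F (eval_fps b)"
    unfolding qlaurent_def
  proof (intro conjI ho ballI)
    fix z assume z: "z \<in> UHP"
    have "norm (qpar h z) < 1" using qpar_in_ball[OF h z] by simp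
    then have "eval_fps b (qpar h z) = qpar h z powi (-m) * F z"
      using sums has_sum_imp_sums[OF hs[OF z]] sums_unique2 by blast
    then show "F z = qpar h z powi m * eval_fps b (qpar h z)"
      by (simp add: power_int_minus field_simps)
  qed
  moreover have "fps_expansion (eval_fps b) 0 = b"
    by (rule fps_expansion_eqI, rule eval_fps_has_fps_expansion)
      (use cr in \<open>auto intro: less_le_trans[of 0 1]\<close>)
  ultimately show ?thesis using that by (auto simp: b_def)
qed

lemma qlaurent_imp_q_expansion:
  assumes h: "h > 0" and q: "qlaurent h m F P"
  shows "q_expansion h F (\<lambda>n. if n < m then 0 else tcoeff P (nat (n - m)))"
  unfolding q_expansion_def
proof (intro conjI ballI)
  fix z assume z: "z \<in> UHP"
  let ?a = "\<lambda>n. if n < m then 0 else tcoeff P (nat (n - m))"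
  have "((\<lambda>n. tcoeff P n * qpar h z ^ n) has_sum P (qpar h z)) UNIV"
    using q h z by (intro holomorphic_ball_has_sum[of _ 1]) (auto simp: qlaurent_def dest: qpar_in_ball)
  from has_sum_cmult_right[OF this, of "qpar h z powi m"]
  have "((\<lambda>n. ?a (m + int n) * qpar h z powi (m + int n)) has_sum F z) UNIV"
    using q z by (simp add: qlaurent_def power_int_add mult_ac)
  then have "((\<lambda>n. ?a n * qpar h z powi n) has_sum F z) {m..}"
    by (subst (asm) has_sum_reindex_bij_witness[where T = "{m..}" and j = "\<lambda>n. m + int n" and i = "\<lambda>n. nat (n - m)"
         and h = "\<lambda>n. ?a n * qpar h z powi n"]) auto
  then have "((\<lambda>n. ?a n * qpar h z powi n) has_sum F z) UNIV"
    by (subst has_sum_cong_neutral[where T = "{m..}" and g = "\<lambda>n. ?a n * qpar h z powi n"]) auto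
  then show "((\<lambda>n. ?a n * exp (2 * complex_of_real pi * \<i> * of_int n * z / of_nat h)) has_sum F z) UNIV"
    by (simp add: qpar_powi)
qed (intro exI[of _ m], auto)

text \<open>The parameter covers the punctured disc, which settles all points but 0; there
  continuity decides.\<close>

lemma qlaurent_unique:
  assumes h: "h > 0" and q: "qlaurent h m F P" "qlaurent h m F Q" and "x \<in> ball 0 1"
  shows "P x = Q x"
proof -
  have *: "P x = Q x" if "x \<in> ball 0 1 - {0}" for x
  proof -
    from that h obtain z where "z \<in> UHP" "qpar h z = x" using qpar_surj[of h x] by auto
    then have "F z = x powi m * P x" "F z = x powi m * Q x" using q unfolding qlaurent_def by blast+
    then show ?thesis using that by auto
  qed
  show ?thesis
  proof (cases "x = 0")
    case True
    have c: "isCont P 0" "isCont Q 0"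
      using q unfolding qlaurent_def
      by (meson centre_in_ball continuous_on_eq_continuous_at holomorphic_on_imp_continuous_on open_ball zero_less_one)+
    have "\<forall>\<^sub>F w in at (0::complex). P w = Q w"
      unfolding eventually_at by (rule exI[of _ 1]) (use * in auto)
    with c have "P 0 = Q 0" unfolding continuous_within by (metis tendsto_unique trivial_limit_at tendsto_cong)
    with True show ?thesis by simp
  qed (use * assms in auto)
qed

lemma qlaurent_shift:
  assumes "qlaurent h m F P"
  shows "qlaurent h (m - int j) F (\<lambda>q. q ^ j * P q)"
  using assms unfolding qlaurent_def
  by (auto simp: power_int_diff intro!: holomorphic_intros)

lemma qlaurent_shift':
  assumes "qlaurent h m F P" "m' \<le> m"
  shows "qlaurent h m' F (\<lambda>q. q ^ nat (m - m') * P q)"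
  using qlaurent_shift[OF assms(1), of "nat (m - m')"] assms(2) by simp

lemma order_at_infinity_iff:
  "order_at_infinity F n \<longleftrightarrow> (\<exists>P. qlaurent 1 n F P \<and> P 0 \<noteq> 0)"
proof
  assume "order_at_infinity F n"
  then obtain a where a: "q_expansion 1 F a" "a n \<noteq> 0" "\<And>l. l < n \<Longrightarrow> a l = 0"
    by (auto simp: order_at_infinity_def)
  obtain P where "qlaurent 1 n F P" "\<And>j. tcoeff P j = a (n + int j)"
    by (rule q_expansion_imp_qlaurent[OF _ a(1,3)]) auto
  moreover from this(2)[of 0] have "P 0 = a n" by (simp add: fps_expansion_def)
  ultimately show "\<exists>P. qlaurent 1 n F P \<and> P 0 \<noteq> 0" using a by auto
next
  assume "\<exists>P. qlaurent 1 n F P \<and> P 0 \<noteq> 0"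
  then obtain P where P: "qlaurent 1 n F P" "P 0 \<noteq> 0" by blast
  show "order_at_infinity F n" unfolding order_at_infinity_def
    by (rule exI, intro conjI, rule qlaurent_imp_q_expansion[OF _ P(1)]) (use P in \<open>auto simp: fps_expansion_def\<close>)
qed

lemma max_order_unique: "max_order V n \<Longrightarrow> max_order V n' \<Longrightarrow> n = n'"
  unfolding max_order_def by (meson order_antisym)

lemma qlaurent_cong: "qlaurent h m F P \<Longrightarrow> (\<And>z. z \<in> UHP \<Longrightarrow> F z = G z) \<Longrightarrow> qlaurent h m G P"
  by (simp add: qlaurent_def)

lemma qlaurent_mult:
  "qlaurent h m F P \<Longrightarrow> qlaurent h n G Q \<Longrightarrow> qlaurent h (m + n) (\<lambda>z. F z * G z) (\<lambda>q. P q * Q q)"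
  unfolding qlaurent_def by (auto simp: power_int_add intro!: holomorphic_intros)

lemma qlaurent_add:
  "qlaurent h m F P \<Longrightarrow> qlaurent h m G Q \<Longrightarrow> qlaurent h m (\<lambda>z. F z + G z) (\<lambda>q. P q + Q q)"
  unfolding qlaurent_def by (auto simp: algebra_simps intro!: holomorphic_intros)

lemma qlaurent_cmult:
  "qlaurent h m F P \<Longrightarrow> qlaurent h m (\<lambda>z. c * F z) (\<lambda>q. c * P q)"
  unfolding qlaurent_def by (auto simp: algebra_simps intro!: holomorphic_intros)

text \<open>The definition of the spaces uses the parameter of period \<open>N\<close> even at
  \<open>\<infinity>\<close>, whereas orders at \<open>\<infinity>\<close> refer to the one of
  period 1, its \<open>N\<close>-th power.\<close>

lemma qlaurent_change_width:
  assumes "N > 0" "qlaurent 1 m F P"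
  shows "qlaurent N (m * int N) F (\<lambda>q. P (q ^ N))"
  unfolding qlaurent_def
proof (intro conjI ballI)
  have "(P \<circ> (\<lambda>q. q ^ N)) holomorphic_on ball 0 1"
  proof (rule holomorphic_on_compose_gen[where t = "ball 0 1"])
    show "(\<lambda>q::complex. q ^ N) ` ball 0 1 \<subseteq> ball 0 1"
      using assms(1) by (auto simp: norm_power power_less_one_iff)
  qed (use assms in \<open>auto simp: qlaurent_def intro!: holomorphic_intros\<close>)
  then show "(\<lambda>q. P (q ^ N)) holomorphic_on ball 0 1" by (simp add: o_def)
next
  fix z assume "z \<in> UHP"
  moreover have "qpar N z powi (m * int N) = qpar 1 z powi m"
    using assms(1) by (simp add: mult.commute[of m] power_int_mult qpar_power_h)
  ultimately show "F z = qpar N z powi (m * int N) * P (qpar N z ^ N)"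
    using assms by (simp add: qlaurent_def qpar_power_h)
qed

lemma q_expansion_iff:
  assumes "h > 0"
  shows "(\<exists>a. q_expansion h F a) \<longleftrightarrow> (\<exists>m P. qlaurent h m F P)"
  using qlaurent_imp_q_expansion[OF assms] q_expansion_imp_qlaurent[OF assms]
  by (metis q_expansion_def)

lemma q_expansion_nonneg_iff:
  assumes "h > 0"
  shows "(\<exists>a. q_expansion h F a \<and> (\<forall>n<0. a n = 0)) \<longleftrightarrow> (\<exists>P. qlaurent h 0 F P)"
proof
  assume "\<exists>a. q_expansion h F a \<and> (\<forall>n<0. a n = 0)"
  then show "\<exists>P. qlaurent h 0 F P" using q_expansion_imp_qlaurent[OF assms] by metis
next
  assume "\<exists>P. qlaurent h 0 F P"
  then show "\<exists>a. q_expansion h F a \<and> (\<forall>n<0. a n = 0)"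
    using qlaurent_imp_q_expansion[OF assms, of 0 F] by fastforce
qed

lemma q_expansion_pos_iff:
  assumes "h > 0"
  shows "(\<exists>a. q_expansion h F a \<and> (\<forall>n\<le>0. a n = 0)) \<longleftrightarrow> (\<exists>P. qlaurent h 0 F P \<and> P 0 = 0)"
proof
  assume "\<exists>a. q_expansion h F a \<and> (\<forall>n\<le>0. a n = 0)"
  then obtain a where a: "q_expansion h F a" "\<And>n. n \<le> 0 \<Longrightarrow> a n = 0" by blast
  obtain P where "qlaurent h 0 F P" "\<And>n. tcoeff P n = a (0 + int n)"
    by (rule q_expansion_imp_qlaurent[OF assms a(1), of 0]) (use a in auto)
  moreover from this(2)[of 0] a(2)[of 0] have "P 0 = 0" by (simp add: fps_expansion_def)
  ultimately show "\<exists>P. qlaurent h 0 F P \<and> P 0 = 0" by blast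
next
  assume "\<exists>P. qlaurent h 0 F P \<and> P 0 = 0"
  then obtain P where P: "qlaurent h 0 F P" "P 0 = 0" by blast
  show "\<exists>a. q_expansion h F a \<and> (\<forall>n\<le>0. a n = 0)"
    by (rule exI, rule conjI, rule qlaurent_imp_q_expansion[OF assms P(1)])
      (use P(2) in \<open>auto simp: fps_expansion_def\<close>)
qed

subsection \<open>The spaces of forms\<close>

text \<open>For \<open>A\<close> in \<open>Gamma0 N\<close> the slash operator fixes
  \<open>F\<close>, so the expansion at \<open>\<infinity>\<close> stands for all of these.\<close>

lemma M_sharp_iff:
  assumes "N > 0"
  shows "F \<in> M_sharp N k \<longleftrightarrow> F holomorphic_on UHP \<and> (\<forall>A\<in>Gamma0 N. \<forall>z\<in>UHP. slash k A F z = F z) \<and>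
    (\<exists>m P. qlaurent N m F P) \<and> (\<forall>A\<in>SL2Z - Gamma0 N. \<exists>P. qlaurent N 0 (slash k A F) P)"
    (is "?l \<longleftrightarrow> ?r")
proof
  assume ?l
  then have "F holomorphic_on UHP" "\<forall>A\<in>Gamma0 N. \<forall>z\<in>UHP. slash k A F z = F z"
    "\<forall>A\<in>SL2Z. \<exists>m P. qlaurent N m (slash k A F) P" "\<forall>A\<in>SL2Z - Gamma0 N. \<exists>P. qlaurent N 0 (slash k A F) P"
    unfolding M_sharp_def weakly_holomorphic_form_def
    by (auto simp: q_expansion_iff[OF assms] q_expansion_nonneg_iff[OF assms])
  moreover from this(3) have "\<exists>m P. qlaurent N m F P"
    using SL2Z_one qlaurent_cong[where F = "slash k (mat 1) F"] by (metis slash_one)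
  ultimately show ?r by blast
next
  assume r: ?r
  have "\<exists>m P. qlaurent N m (slash k A F) P" if "A \<in> SL2Z" for A
  proof (cases "A \<in> Gamma0 N")
    case True
    with r show ?thesis using qlaurent_cong[where F = F and G = "slash k A F"] by metis
  qed (use r that in blast)
  with r show ?l unfolding M_sharp_def weakly_holomorphic_form_def
    by (auto simp: q_expansion_iff[OF assms] q_expansion_nonneg_iff[OF assms])
qed

lemma S_sharp_iff:
  assumes "N > 0"
  shows "F \<in> S_sharp N k \<longleftrightarrow>
    F \<in> M_sharp N k \<and> (\<forall>A\<in>SL2Z - Gamma0 N. \<exists>P. qlaurent N 0 (slash k A F) P \<and> P 0 = 0)"
  unfolding S_sharp_def using q_expansion_pos_iff[OF assms] by auto

lemma M_sharpI:
  assumes "N > 0" "F holomorphic_on UHP" "\<And>A z. A \<in> Gamma0 N \<Longrightarrow> z \<in> UHP \<Longrightarrow> slash k A F z = F z"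
    "qlaurent 1 m F P" "\<And>A. A \<in> SL2Z \<Longrightarrow> A \<notin> Gamma0 N \<Longrightarrow> \<exists>P. qlaurent N 0 (slash k A F) P"
  shows "F \<in> M_sharp N k"
  using assms qlaurent_change_width[OF assms(1,4)] by (subst M_sharp_iff) auto

context
  fixes N :: nat
  assumes N: "N > 0"
begin

lemma M_sharp_add: "F \<in> M_sharp N k \<Longrightarrow> G \<in> M_sharp N k \<Longrightarrow> (\<lambda>z. F z + G z) \<in> M_sharp N k"
proof (subst (asm) (1 2) M_sharp_iff[OF N], subst M_sharp_iff[OF N], elim conjE exE, intro conjI ballI)
  fix m n P Q assume a: "qlaurent N m F P" "qlaurent N n G Q"
  show "\<exists>m P. qlaurent N m (\<lambda>z. F z + G z) P"
    using qlaurent_add[OF qlaurent_shift'[OF a(1), of "min m n"] qlaurent_shift'[OF a(2), of "min m n"]] by auto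
next
  fix A assume A: "A \<in> SL2Z - Gamma0 N"
    "\<forall>A\<in>SL2Z - Gamma0 N. \<exists>P. qlaurent N 0 (slash k A F) P" "\<forall>A\<in>SL2Z - Gamma0 N. \<exists>P. qlaurent N 0 (slash k A G) P"
  then obtain P Q where "qlaurent N 0 (slash k A F) P" "qlaurent N 0 (slash k A G) Q" by blast
  then show "\<exists>P. qlaurent N 0 (slash k A (\<lambda>z. F z + G z)) P"
    using qlaurent_add[of N 0 "slash k A F" P "slash k A G" Q] by (auto simp: slash_add[abs_def])
qed (auto simp: slash_add intro!: holomorphic_intros)

lemma M_sharp_cmult: "F \<in> M_sharp N k \<Longrightarrow> (\<lambda>z. c * F z) \<in> M_sharp N k"
proof (subst (asm) M_sharp_iff[OF N], subst M_sharp_iff[OF N], elim conjE exE, intro conjI ballI)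
  fix m P assume a: "qlaurent N m F P"
  then show "\<exists>m P. qlaurent N m (\<lambda>z. c * F z) P" using qlaurent_cmult by blast
next
  fix A assume A: "A \<in> SL2Z - Gamma0 N" "\<forall>A\<in>SL2Z - Gamma0 N. \<exists>P. qlaurent N 0 (slash k A F) P"
  then show "\<exists>P. qlaurent N 0 (slash k A (\<lambda>z. c * F z)) P"
    unfolding slash_cmult[abs_def] using qlaurent_cmult by blast
qed (auto simp: slash_cmult intro!: holomorphic_intros)

lemma M_sharp_mult: "F \<in> M_sharp N k \<Longrightarrow> G \<in> M_sharp N l \<Longrightarrow> (\<lambda>z. F z * G z) \<in> M_sharp N (k + l)"
proof (subst (asm) (1 2) M_sharp_iff[OF N], subst M_sharp_iff[OF N], elim conjE exE, intro conjI ballI)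
  fix m n P Q assume a: "qlaurent N m F P" "qlaurent N n G Q"
  then show "\<exists>m P. qlaurent N m (\<lambda>z. F z * G z) P" using qlaurent_mult by blast
next
  fix A assume A: "A \<in> SL2Z - Gamma0 N"
    "\<forall>A\<in>SL2Z - Gamma0 N. \<exists>P. qlaurent N 0 (slash k A F) P" "\<forall>A\<in>SL2Z - Gamma0 N. \<exists>P. qlaurent N 0 (slash l A G) P"
  then obtain P Q where "qlaurent N 0 (slash k A F) P" "qlaurent N 0 (slash l A G) Q" by blast
  from qlaurent_mult[OF this] A(1) show "\<exists>P. qlaurent N 0 (slash (k + l) A (\<lambda>z. F z * G z)) P"
    by (intro exI[of _ "\<lambda>q. P q * Q q"]) (auto intro: qlaurent_cong simp: slash_times)
qed (auto simp: slash_times Gamma0_SL2Z intro!: holomorphic_intros)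

lemma S_sharp_mult:
  assumes F: "F \<in> M_sharp N k" and G: "G \<in> S_sharp N l"
  shows "(\<lambda>z. F z * G z) \<in> S_sharp N (k + l)"
  unfolding S_sharp_iff[OF N]
proof (intro conjI ballI)
  show "(\<lambda>z. F z * G z) \<in> M_sharp N (k + l)" using assms by (intro M_sharp_mult) (auto simp: S_sharp_def)
  fix A assume A: "A \<in> SL2Z - Gamma0 N"
  obtain P where P: "qlaurent N 0 (slash k A F) P" using F A unfolding M_sharp_iff[OF N] by blast
  obtain Q where Q: "qlaurent N 0 (slash l A G) Q" "Q 0 = 0" using G A unfolding S_sharp_iff[OF N] by blast
  from qlaurent_mult[OF P Q(1)] A Q(2) show "\<exists>P. qlaurent N 0 (slash (k + l) A (\<lambda>z. F z * G z)) P \<and> P 0 = 0"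
    by (intro exI[of _ "\<lambda>q. P q * Q q"]) (auto intro: qlaurent_cong simp: slash_times)
qed

lemma M_sharp_sum:
  assumes "finite I" "I \<noteq> {}" "\<And>i. i \<in> I \<Longrightarrow> F i \<in> M_sharp N k"
  shows "(\<lambda>z. \<Sum>i\<in>I. F i z) \<in> M_sharp N k"
  using assms
proof (induction I rule: finite_ne_induct)
  case (insert i I)
  then have "(\<lambda>z. F i z + (\<Sum>i\<in>I. F i z)) \<in> M_sharp N k" by (intro M_sharp_add) auto
  then show ?case using insert by simp
qed auto

end

text \<open>If some coefficient is nonzero, the first of them gives the order of \<open>F\<close>,
  which the hypothesis puts above \<open>n\<close>. Identities between forms are proved in this way,
  by comparing finitely many coefficients.\<close>

lemma max_order_imp_zero:
  assumes "max_order V n" "F \<in> V" "qlaurent 1 m F P" "\<And>l. m + int l \<le> n \<Longrightarrow> tcoeff P l = 0" "z \<in> UHP"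
  shows "F z = 0"
proof (rule ccontr)
  assume nz: "F z \<noteq> 0"
  have "\<exists>j. tcoeff P j \<noteq> 0"
  proof (rule ccontr)
    assume "\<nexists>j. tcoeff P j \<noteq> 0"
    then have "((\<lambda>n::nat. 0) has_sum P (qpar 1 z)) UNIV"
      using holomorphic_ball_has_sum[of P 1 "qpar 1 z"] assms qpar_in_ball[of 1 z] by (auto simp: qlaurent_def)
    then have "P (qpar 1 z) = 0" by (metis has_sum_0 has_sum_unique)
    with nz assms show False by (auto simp: qlaurent_def)
  qed
  then obtain j where j: "tcoeff P j \<noteq> 0" "\<And>i. i < j \<Longrightarrow> tcoeff P i = 0"
    using exists_least_iff[of "\<lambda>j. tcoeff P j \<noteq> 0"] by blast
  have "order_at_infinity F (m + int j)"
    unfolding order_at_infinity_def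
    by (rule exI, intro conjI, rule qlaurent_imp_q_expansion[OF _ assms(3)]) (use j in auto)
  then have "m + int j \<le> n" using assms(1,2) unfolding max_order_def by blast
  then show False using assms(4) j(1) by blast
qed

subsection \<open>The constant term of a form of weight two\<close>

lemma qpar_powi_has_deriv:
  "h > 0 \<Longrightarrow> ((\<lambda>z. qpar h z powi n) has_field_derivative (2 * of_real pi * \<i> * of_int n / of_nat h * qpar h z powi n)) (at z)"
  unfolding qpar_powi by (auto intro!: derivative_eq_intros)

text \<open>A nonzero power of the parameter has a periodic primitive, so only the constant term
  contributes to the increment, through a linear function. The induction removes the polar terms one
  at a time.\<close>

lemma primitive_of_qlaurent:
  assumes h: "h > 0" and "qlaurent h (- int j) F P"
  shows "\<exists>p. (\<forall>z\<in>UHP. (p has_field_derivative F z) (at z)) \<and>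
     (\<forall>z\<in>UHP. p (z + of_nat h) - p z = of_nat h * tcoeff P j)"
  using assms(2)
proof (induction j arbitrary: F P)
  have split: "\<exists>R. R holomorphic_on ball 0 1 \<and> (\<forall>q\<in>ball 0 1. P q = P 0 + q * R q)"
    if "P holomorphic_on ball 0 1" for P :: "complex \<Rightarrow> complex"
  proof (intro exI conjI ballI)
    show "(\<lambda>z. if z = 0 then deriv P 0 else (P z - P 0) / (z - 0)) holomorphic_on ball 0 1"
      by (rule pole_lemma) (use that in auto)
  qed auto
  {
    case 0
    then have P: "P holomorphic_on ball 0 1" "\<And>z. z \<in> UHP \<Longrightarrow> F z = P (qpar h z)"
      by (auto simp: qlaurent_def)
    from split[OF P(1)] obtain R where R: "R holomorphic_on ball 0 1" "\<And>q. q \<in> ball 0 1 \<Longrightarrow> P q = P 0 + q * R q"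
      by blast
    obtain S where S: "\<And>q. q \<in> ball 0 1 \<Longrightarrow> (S has_field_derivative R q) (at q within ball 0 1)"
      using holomorphic_convex_primitive'[OF convex_ball open_ball R(1)] by blast
    \<comment> \<open>Since dq = (2 pi i / h) q dz, the part \<open>q * R q\<close> integrates to a
      multiple of \<open>S\<close>; the constant term \<open>P 0\<close> gives the linear
      part.\<close>
    define p where "p = (\<lambda>z. P 0 * z + of_nat h / (2 * of_real pi * \<i>) * S (qpar h z))"
    have "(p has_field_derivative F z) (at z)" if z: "z \<in> UHP" for z
    proof -
      note b = qpar_in_ball[OF h z]
      have "(S has_field_derivative R (qpar h z)) (at (qpar h z))"
        using S[OF b] b by (simp add: at_within_open[of _ "ball 0 1"])
      from DERIV_chain2[OF this qpar_has_deriv, of UNIV]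
      have "((\<lambda>z. S (qpar h z)) has_field_derivative R (qpar h z) * (2 * of_real pi * \<i> / of_nat h * qpar h z)) (at z)" .
      then have "(p has_field_derivative P 0 + of_nat h / (2 * of_real pi * \<i>) * (R (qpar h z) * (2 * of_real pi * \<i> / of_nat h * qpar h z))) (at z)"
        unfolding p_def by (auto intro!: derivative_eq_intros)
      also have "P 0 + of_nat h / (2 * of_real pi * \<i>) * (R (qpar h z) * (2 * of_real pi * \<i> / of_nat h * qpar h z)) = F z"
        using h R(2)[OF b] P(2)[OF z] by (simp add: field_simps)
      finally show ?thesis .
    qed
    moreover have "p (z + of_nat h) - p z = of_nat h * tcoeff P 0" for z
      using h by (simp add: p_def qpar_add algebra_simps fps_expansion_def)
    ultimately show ?case by blast
  next
    case (Suc j)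
    then have P: "P holomorphic_on ball 0 1" "\<And>z. z \<in> UHP \<Longrightarrow> F z = qpar h z powi (- int (Suc j)) * P (qpar h z)"
      by (auto simp: qlaurent_def)
    from split[OF P(1)] obtain R where R: "R holomorphic_on ball 0 1" "\<And>q. q \<in> ball 0 1 \<Longrightarrow> P q = P 0 + q * R q"
      by blast
    have "qlaurent h (- int j) (\<lambda>z. qpar h z powi (- int j) * R (qpar h z)) R"
      using R by (simp add: qlaurent_def)
    from Suc.IH[OF this] obtain p where
      p: "\<And>z. z \<in> UHP \<Longrightarrow> (p has_field_derivative qpar h z powi (- int j) * R (qpar h z)) (at z)"
         "\<And>z. z \<in> UHP \<Longrightarrow> p (z + of_nat h) - p z = of_nat h * tcoeff R j"
      by blast
    \<comment> \<open>The exponent is nonzero, so the leading polar term integrates to a multiple of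
      itself.\<close>
    define c where "c = P 0 * of_nat h / (2 * of_real pi * \<i> * of_int (- int (Suc j)))"
    define p' where "p' = (\<lambda>z. c * qpar h z powi (- int (Suc j)) + p z)"
    have "(p' has_field_derivative F z) (at z)" if z: "z \<in> UHP" for z
    proof -
      have "(p' has_field_derivative (c * (2 * of_real pi * \<i> * of_int (- int (Suc j)) / of_nat h * qpar h z powi (- int (Suc j)))
          + qpar h z powi (- int j) * R (qpar h z))) (at z)"
        unfolding p'_def by (intro DERIV_add DERIV_cmult qpar_powi_has_deriv h p z)
      also have "c * (2 * of_real pi * \<i> * of_int (- int (Suc j)) / of_nat h * qpar h z powi (- int (Suc j)))
        = P 0 * qpar h z powi (- int (Suc j))"
      proof -
        have "2 * of_real pi * \<i> * of_int (- int (Suc j)) \<noteq> (0 :: complex)" by (simp del: of_nat_Suc)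
        then show ?thesis using h unfolding c_def by (simp del: of_nat_Suc of_int_minus)
      qed
      also have "P 0 * qpar h z powi (- int (Suc j)) + qpar h z powi (- int j) * R (qpar h z) = F z"
      proof -
        have "qpar h z powi (- int j) = qpar h z powi (- int (Suc j)) * qpar h z"
          by (subst power_int_add_1[symmetric]) auto
        then show ?thesis using R(2)[OF qpar_in_ball[OF h z]] P(2)[OF z] by (simp add: algebra_simps)
      qed
      finally show ?thesis .
    qed
    moreover have "p' (z + of_nat h) - p' z = of_nat h * tcoeff P (Suc j)" if z: "z \<in> UHP" for z
    proof -
      \<comment> \<open>Splitting off \<open>P 0\<close> moves the coefficients down by one, so the
        constant term of \<open>F\<close> becomes coefficient \<open>j\<close> of
        \<open>R\<close>.\<close>
      have "(\<lambda>q. P 0 + q * R q) has_fps_expansion fps_const (P 0) + fps_X * fps_expansion R 0"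
        by (intro fps_expansion_intros holomorphic_ball_has_fps_expansion R)
      moreover have "\<forall>\<^sub>F q in nhds 0. P 0 + q * R q = P q"
        unfolding eventually_nhds by (intro exI[of _ "ball 0 1"] conjI ballI R(2)[symmetric]) auto
      ultimately have "P has_fps_expansion fps_const (P 0) + fps_X * fps_expansion R 0"
        by (simp add: has_fps_expansion_cong)
      then have "fps_expansion P 0 = fps_const (P 0) + fps_X * fps_expansion R 0"
        by (rule fps_expansion_eqI)
      then have "tcoeff P (Suc j) = tcoeff R j" by simp
      then show ?thesis using p(2)[OF z] h by (simp add: p'_def qpar_add)
    qed
    ultimately show ?case by blast
  }
qed

lemma has_same_deriv_imp_diff_const:
  assumes "\<And>z. z \<in> UHP \<Longrightarrow> (f has_field_derivative d z) (at z)" "\<And>z. z \<in> UHP \<Longrightarrow> (g has_field_derivative d z) (at z)"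
  obtains c where "\<And>z. z \<in> UHP \<Longrightarrow> f z - g z = c"
proof -
  have "((\<lambda>z. f z - g z) has_field_derivative 0) (at z within UHP)" if "z \<in> UHP" for z
    using DERIV_diff[OF assms(1,2)[OF that]] by (simp add: has_field_derivative_at_within)
  then show ?thesis using has_field_derivative_zero_constant[OF convex_H, of "\<lambda>z. f z - g z"] that by blast
qed

lemma primitive_period:
  assumes "h > 0" "qlaurent h (- int j) F P" "\<And>z. z \<in> UHP \<Longrightarrow> (p has_field_derivative F z) (at z)" "z \<in> UHP"
  shows "p (z + of_nat h) - p z = of_nat h * tcoeff P j"
proof -
  obtain p0 where p0: "\<And>z. z \<in> UHP \<Longrightarrow> (p0 has_field_derivative F z) (at z)"
    "p0 (z + of_nat h) - p0 z = of_nat h * tcoeff P j"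
    using primitive_of_qlaurent[OF assms(1,2)] assms(4) by blast
  obtain c where "\<And>z. z \<in> UHP \<Longrightarrow> p z - p0 z = c"
    using has_same_deriv_imp_diff_const[OF assms(3) p0(1)] by blast
  from this[of z] this[of "z + of_nat h"] p0(2) assms(4) show ?thesis
    by (simp add: in_H_iff algebra_simps)
qed

lemma level_one_primitive_periodic:
  assumes inv: "\<And>A z. A \<in> SL2Z \<Longrightarrow> z \<in> UHP \<Longrightarrow> slash 2 A H z = H z"
    and p: "\<And>z. z \<in> UHP \<Longrightarrow> (p has_field_derivative H z) (at z)" and z: "z \<in> UHP"
  shows "p (z + 1) = p z"
proof -
  \<comment> \<open>By invariance in weight two, \<open>p\<close> and its composition with
    \<open>A\<close> have the same derivative.\<close>
  have "\<exists>c. \<forall>z\<in>UHP. p (moebius_action A z) - p z = c" if A: "A \<in> SL2Z" for A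
  proof -
    have "((\<lambda>z. p (moebius_action A z)) has_field_derivative H z) (at z)" if z: "z \<in> UHP" for z
    proof -
      have "((\<lambda>z. p (moebius_action A z)) has_field_derivative H (moebius_action A z) * aut A z powi (-2)) (at z)"
        by (rule DERIV_chain2[OF p moebius_has_deriv]) (use A z in \<open>auto intro: moebius_in_H\<close>)
      also have "H (moebius_action A z) * aut A z powi (-2) = H z"
        using inv[OF A z] by (simp add: slash_eq mult.commute)
      finally show ?thesis .
    qed
    from has_same_deriv_imp_diff_const[OF this p] show ?thesis by blast
  qed
  note const = this
  have S: "mat2 0 (-1) 1 0 \<in> SL2Z" by (simp add: SL2Z_iff)
  have Sz: "moebius_action (mat2 0 (-1) 1 0) z = -1 / z" for z by (simp add: moebius_action_def)
  obtain c where c: "\<And>z. z \<in> UHP \<Longrightarrow> p (z + 1) - p z = c" using const[OF tmat_SL2Z[of 1]] by auto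
  obtain d where d: "\<And>z. z \<in> UHP \<Longrightarrow> p (-1 / z) - p z = d" using const[OF S] unfolding Sz by auto
  \<comment> \<open>The inversion fixes \<open>\<i>\<close>, so its constant vanishes.\<close>
  have "d = 0" using d[OF ii_in_H] by simp
  \<comment> \<open>A primitive cube root of unity, where inversion and translation by one take the
    same value.\<close>
  define \<rho> where "\<rho> = Complex (-1/2) (sqrt 3 / 2)"
  have \<rho>: "\<rho> \<in> UHP" by (simp add: \<rho>_def in_H_iff)
  have "-1 / \<rho> = \<rho> + 1"
  proof -
    have "\<rho> * (\<rho> + 1) = -1" by (simp add: \<rho>_def complex_eq_iff field_simps)
    moreover have "\<rho> \<noteq> 0" by (simp add: \<rho>_def complex_eq_iff)
    ultimately show ?thesis by (simp add: field_simps)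
  qed
  then have "c = 0" using c[OF \<rho>] d[OF \<rho>] \<open>d = 0\<close> by simp
  then show ?thesis using c[OF z] by simp
qed

section \<open>Bottom rows modulo N and the trace to level one\<close>

definition bottom_row :: "nat \<Rightarrow> int ^ 2 ^ 2 \<Rightarrow> int \<times> int" where
  "bottom_row N A = (A$2$1 mod int N, A$2$2 mod int N)"

text \<open>An index set for the cosets of \<open>Gamma0 N\<close>, with repetitions, that is
  visibly finite and on which right multiplication acts.\<close>

definition bottom_rows :: "nat \<Rightarrow> (int \<times> int) set" where
  "bottom_rows N = bottom_row N ` SL2Z"

definition rep :: "nat \<Rightarrow> int \<times> int \<Rightarrow> int ^ 2 ^ 2" where
  "rep N r = (SOME A. A \<in> SL2Z \<and> bottom_row N A = r)"

lemma rep: "r \<in> bottom_rows N \<Longrightarrow> rep N r \<in> SL2Z" "r \<in> bottom_rows N \<Longrightarrow> bottom_row N (rep N r) = r"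
proof -
  assume "r \<in> bottom_rows N"
  then have "\<exists>A. A \<in> SL2Z \<and> bottom_row N A = r" by (auto simp: bottom_rows_def)
  from someI_ex[OF this] show "rep N r \<in> SL2Z" "bottom_row N (rep N r) = r" by (auto simp: rep_def)
qed

lemma finite_bottom_rows: assumes "N > 0" shows "finite (bottom_rows N)"
proof (rule finite_subset)
  show "bottom_rows N \<subseteq> {0..<int N} \<times> {0..<int N}" using assms by (auto simp: bottom_rows_def bottom_row_def)
qed auto

lemma bottom_row_eq_imp:
  assumes "A \<in> SL2Z" "B \<in> SL2Z" "bottom_row N A = bottom_row N B"
  shows "A ** inv2 B \<in> Gamma0 N"
proof -
  have "int N dvd A$2$1 - B$2$1" "int N dvd A$2$2 - B$2$2"
    using assms(3) by (auto simp: bottom_row_def mod_eq_dvd_iff)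
  \<comment> \<open>This is the lower left entry of \<open>A ** inv2 B\<close>, the determinant
    formed by two congruent bottom rows.\<close>
  then have "int N dvd (A$2$1 - B$2$1) * B$2$2 - (A$2$2 - B$2$2) * B$2$1" by simp
  then have "int N dvd A$2$1 * B$2$2 - A$2$2 * B$2$1" by (simp add: algebra_simps)
  then show ?thesis using assms by (simp add: Gamma0_def SL2Z_mult SL2Z_inv2)
qed

lemma slash_eq_of_bottom_row_eq:
  assumes "\<And>A z. A \<in> Gamma0 N \<Longrightarrow> z \<in> UHP \<Longrightarrow> slash k A F z = F z"
    and "A \<in> SL2Z" "B \<in> SL2Z" "bottom_row N A = bottom_row N B" "z \<in> UHP"
  shows "slash k A F z = slash k B F z"
proof -
  have "A = (A ** inv2 B) ** B" using assms by (simp add: inv2_left flip: matrix_mul_assoc)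
  then have "slash k A F z = slash k B (slash k (A ** inv2 B) F) z"
    by (metis slash_mult SL2Z_mult SL2Z_inv2 assms(2,3,5))
  also have "\<dots> = slash k B F z"
    by (rule slash_cong) (use assms bottom_row_eq_imp in auto)
  finally show ?thesis .
qed

lemma bottom_row_mult_cong:
  "bottom_row N A = bottom_row N B \<Longrightarrow> bottom_row N (A ** C) = bottom_row N (B ** C)"
  unfolding bottom_row_def by (auto intro!: mod_add_cong mod_mult_cong)

text \<open>The row of a product depends on the row of the left factor alone, so passing to the
  representative is harmless and \<open>inv2 C\<close> undoes the multiplication by
  \<open>C\<close>.\<close>

lemma bij_bottom_rows:
  assumes C: "C \<in> SL2Z"
  shows "bij_betw (\<lambda>r. bottom_row N (rep N r ** C)) (bottom_rows N) (bottom_rows N)"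
proof (rule bij_betwI[where g = "\<lambda>r. bottom_row N (rep N r ** inv2 C)"])
  have *: "(\<lambda>r. bottom_row N (rep N r ** C)) \<in> bottom_rows N \<rightarrow> bottom_rows N" if "C \<in> SL2Z" for C
    using that rep by (auto simp: bottom_rows_def intro!: imageI SL2Z_mult)
  show "(\<lambda>r. bottom_row N (rep N r ** C)) \<in> bottom_rows N \<rightarrow> bottom_rows N" by (rule *[OF C])
  show "(\<lambda>r. bottom_row N (rep N r ** inv2 C)) \<in> bottom_rows N \<rightarrow> bottom_rows N" by (rule *[OF SL2Z_inv2[OF C]])
  have **: "bottom_row N (rep N (bottom_row N (rep N r ** C)) ** inv2 C) = r" if "r \<in> bottom_rows N" "C \<in> SL2Z" for r C
  proof -
    have "bottom_row N (rep N (bottom_row N (rep N r ** C))) = bottom_row N (rep N r ** C)"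
      using *[OF that(2)] that(1) by (intro rep) auto
    from bottom_row_mult_cong[OF this, of "inv2 C"] show ?thesis
      using that by (simp add: inv2_cancel_right rep)
  qed
  show "bottom_row N (rep N (bottom_row N (rep N r ** C)) ** inv2 C) = r" if "r \<in> bottom_rows N" for r
    using **[OF that C] .
  have "inv2 (inv2 C) = C" by (simp add: mat2_eq_iff)
  then show "bottom_row N (rep N (bottom_row N (rep N r ** inv2 C)) ** C) = r" if "r \<in> bottom_rows N" for r
    using **[OF that SL2Z_inv2[OF C]] by simp
qed

text \<open>The sum over the bottom rows modulo \<open>N\<close> is a multiple of the trace to level one: each coset of
  \<open>Gamma0 N\<close> occurs once for every unit modulo \<open>N\<close>.\<close>

lemma trace_invariant:
  assumes inv: "\<And>A z. A \<in> Gamma0 N \<Longrightarrow> z \<in> UHP \<Longrightarrow> slash k A F z = F z"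
    and C: "C \<in> SL2Z" and z: "z \<in> UHP"
  shows "slash k C (\<lambda>z. \<Sum>r\<in>bottom_rows N. slash k (rep N r) F z) z = (\<Sum>r\<in>bottom_rows N. slash k (rep N r) F z)"
proof -
  have "slash k C (\<lambda>z. \<Sum>r\<in>bottom_rows N. slash k (rep N r) F z) z = (\<Sum>r\<in>bottom_rows N. slash k C (slash k (rep N r) F) z)"
    by (simp add: slash_eq sum_distrib_left)
  also have "\<dots> = (\<Sum>r\<in>bottom_rows N. slash k (rep N (bottom_row N (rep N r ** C))) F z)"
  proof (rule sum.cong[OF refl])
    fix r assume r: "r \<in> bottom_rows N"
    have in_rows: "bottom_row N (rep N r ** C) \<in> bottom_rows N"
      using r C by (auto simp: bottom_rows_def intro!: imageI SL2Z_mult rep[unfolded bottom_rows_def])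
    have "slash k C (slash k (rep N r) F) z = slash k (rep N r ** C) F z"
      using r C z by (simp add: slash_mult rep)
    also have "\<dots> = slash k (rep N (bottom_row N (rep N r ** C))) F z"
      by (rule slash_eq_of_bottom_row_eq[OF inv]) (use r C z in_rows in \<open>auto intro: SL2Z_mult rep simp: rep(2)\<close>)
    finally show "slash k C (slash k (rep N r) F) z = slash k (rep N (bottom_row N (rep N r ** C))) F z" .
  qed
  also have "\<dots> = (\<Sum>r\<in>bottom_rows N. slash k (rep N r) F z)"
    by (rule sum.reindex_bij_betw[OF bij_bottom_rows[OF C]])
  finally show ?thesis .
qed

text \<open>Under translation by \<open>N\<close> the primitive of the trace does not change, while
  each summand changes by \<open>N\<close> times its own constant term: that of \<open>F\<close> for
  representatives in \<open>Gamma0 N\<close>, and zero at the other cusps.\<close>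

lemma weight_two_constant_term:
  assumes N: "N > 0" and F: "F \<in> S_sharp N 2" and q: "qlaurent 1 (- int j) F P"
  shows "tcoeff P j = 0"
proof -
  have FM: "F \<in> M_sharp N 2" using F by (simp add: S_sharp_def)
  have holo: "F holomorphic_on UHP" and inv: "\<And>A z. A \<in> Gamma0 N \<Longrightarrow> z \<in> UHP \<Longrightarrow> slash 2 A F z = F z"
    using FM by (auto simp: M_sharp_iff[OF N])
  have "\<exists>p. \<forall>z\<in>UHP. (p has_field_derivative slash 2 (rep N r) F z) (at z)" if "r \<in> bottom_rows N" for r
    using holomorphic_convex_primitive'[OF convex_H open_H holomorphic_slash[OF rep(1)[OF that] holo, of 2]]
    by (metis at_within_open open_H)
  then obtain p where p: "\<And>r z. r \<in> bottom_rows N \<Longrightarrow> z \<in> UHP \<Longrightarrow> (p r has_field_derivative slash 2 (rep N r) F z) (at z)"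
    by metis
  define t where "t = (\<lambda>z. \<Sum>r\<in>bottom_rows N. p r z)"
  have t: "t (z + 1) = t z" if "z \<in> UHP" for z
  proof (rule level_one_primitive_periodic[OF trace_invariant[OF inv] _ that])
    show "(t has_field_derivative (\<Sum>r\<in>bottom_rows N. slash 2 (rep N r) F z)) (at z)" if "z \<in> UHP" for z
      unfolding t_def using p that by (intro DERIV_sum) auto
  qed
  have zN: "z + of_nat n \<in> UHP" if "z \<in> UHP" for z n using that by (simp add: in_H_iff)
  have "t (\<i> + of_nat n) = t \<i>" for n
  proof (induction n)
    case (Suc n)
    then show ?case using t[OF zN[OF ii_in_H, of n]] by (simp add: add_ac)
  qed auto
  \<comment> \<open>\<open>N\<close> is a common period: at the other cusps only expansions in the
    parameter of period \<open>N\<close> are at hand.\<close>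
  then have "0 = t (\<i> + of_nat N) - t \<i>" by simp
  also have "\<dots> = (\<Sum>r\<in>bottom_rows N. p r (\<i> + of_nat N) - p r \<i>)" by (simp add: t_def sum_subtractf)
  also have "\<dots> = (\<Sum>r\<in>bottom_rows N. if rep N r \<in> Gamma0 N then of_nat N * tcoeff P j else 0)"
  proof (rule sum.cong[OF refl])
    fix r assume r: "r \<in> bottom_rows N"
    show "p r (\<i> + of_nat N) - p r \<i> = (if rep N r \<in> Gamma0 N then of_nat N * tcoeff P j else 0)"
    proof (cases "rep N r \<in> Gamma0 N")
      case True
      have d: "(p r has_field_derivative F z) (at z)" if "z \<in> UHP" for z
        using p[OF r that] inv[OF True that] by simp
      \<comment> \<open>Here \<open>F\<close> is expanded in the parameter of period one, so the
        increments of \<open>N\<close> unit steps are added up.\<close>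
      have "p r (\<i> + of_nat n) - p r \<i> = of_nat n * tcoeff P j" for n
      proof (induction n)
        case (Suc n)
        then show ?case using primitive_period[OF _ q d zN[OF ii_in_H, of n]] by (simp add: algebra_simps)
      qed auto
      then show ?thesis using True by simp
    next
      case False
      then obtain Q where Q: "qlaurent N 0 (slash 2 (rep N r) F) Q" "Q 0 = 0"
        using F rep(1)[OF r] by (auto simp: S_sharp_iff[OF N])
      then have "qlaurent N (- int 0) (slash 2 (rep N r) F) Q" by simp
      from primitive_period[OF N this p[OF r] ii_in_H] Q(2) False show ?thesis
        by (simp add: fps_expansion_def)
    qed
  qed
  also have "\<dots> = of_nat (card {r \<in> bottom_rows N. rep N r \<in> Gamma0 N}) * (of_nat N * tcoeff P j)"
    using finite_bottom_rows[OF N] by (simp add: sum.If_cases Int_def)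
  finally have "card {r \<in> bottom_rows N. rep N r \<in> Gamma0 N} = 0 \<or> tcoeff P j = 0" using N by simp
  moreover have "card {r \<in> bottom_rows N. rep N r \<in> Gamma0 N} \<noteq> 0"
  proof -
    \<comment> \<open>The row of the identity is represented by an element of
      \<open>Gamma0 N\<close>, so the count is positive.\<close>
    let ?r = "bottom_row N (mat 1)"
    have r: "?r \<in> bottom_rows N" by (simp add: bottom_rows_def SL2Z_one)
    have "rep N ?r ** inv2 (mat 1) \<in> Gamma0 N"
      by (rule bottom_row_eq_imp) (use r rep SL2Z_one in auto)
    then have "rep N ?r \<in> Gamma0 N"
      by (simp add: Gamma0_cancel_right Gamma0_inv2 Gamma0_one)
    with r have "?r \<in> {r \<in> bottom_rows N. rep N r \<in> Gamma0 N}" by blast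
    moreover have "finite {r \<in> bottom_rows N. rep N r \<in> Gamma0 N}" using finite_bottom_rows[OF N] by simp
    ultimately show ?thesis by (metis card_eq_0_iff empty_iff)
  qed
  ultimately show ?thesis by simp
qed

subsection \<open>Reduction theory\<close>

text \<open>The lower left entry is a nonzero integer, so the imaginary part of
  \<open>aut A z\<close> is at least \<open>Im z\<close> in absolute value.\<close>

lemma Im_moebius_le:
  assumes "A \<in> SL2Z" "z \<in> UHP" "A$2$1 \<noteq> 0"
  shows "Im (moebius_action A z) \<le> 1 / Im z"
proof -
  have "1 \<le> \<bar>real_of_int (A$2$1)\<bar>" using assms(3) by linarith
  then have "Im z \<le> \<bar>real_of_int (A$2$1)\<bar> * Im z" using assms(2) by (simp add: in_H_iff)
  also have "\<dots> = \<bar>Im (aut A z)\<bar>" using assms(2) by (simp add: aut_def abs_mult in_H_iff)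
  also have "\<dots> \<le> norm (aut A z)" by (rule abs_Im_le_cmod)
  finally have "Im z ^ 2 \<le> norm (aut A z) ^ 2" using assms(2) by (intro power_mono) (auto simp: in_H_iff)
  then have "Im z / norm (aut A z) ^ 2 \<le> Im z / Im z ^ 2"
    using assms(2) aut_nz[OF assms(1,2)] by (intro divide_left_mono) (auto simp: in_H_iff)
  then show ?thesis using assms by (simp add: Im_moebius power2_eq_square in_H_iff)
qed

lemma Im_moebius_parabolic:
  assumes "A \<in> SL2Z" "A$2$1 = 0"
  shows "Im (moebius_action A z) = Im z" "\<exists>n. moebius_action A z = z + of_int n"
proof -
  have *: "A$1$1 * A$2$2 = 1" using assms by (simp add: SL2Z_iff)
  then have "(A$1$1 = 1 \<and> A$2$2 = 1) \<or> (A$1$1 = -1 \<and> A$2$2 = -1)" by (simp add: zmult_eq_1_iff)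
  then have "moebius_action A z = z + of_int (A$1$2 * A$2$2)"
    using assms by (auto simp: moebius_action_def)
  then show "Im (moebius_action A z) = Im z" "\<exists>n. moebius_action A z = z + of_int n"
    by (auto simp del: of_int_mult)
qed

lemma Im_moebius_le_max:
  assumes "A \<in> SL2Z" "z \<in> UHP"
  shows "Im (moebius_action A z) \<le> max (Im z) (1 / Im z)"
  using Im_moebius_le[OF assms] Im_moebius_parabolic(1)[OF assms(1), of z] by linarith

text \<open>It suffices to come within a factor \<open>9 / 10\<close> of the supremum of the imaginary parts in the
  orbit; the supremum need not be shown to be attained.\<close>

lemma reduction:
  assumes z: "z \<in> UHP"
  obtains A where "A \<in> SL2Z" "Im (moebius_action A z) \<ge> 1 / 2" "\<bar>Re (moebius_action A z)\<bar> \<le> 1 / 2"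
proof -
  let ?I = "(\<lambda>A. Im (moebius_action A z)) ` SL2Z"
  have bdd: "bdd_above ?I" using Im_moebius_le_max z by (intro bdd_aboveI2[of _ _ "max (Im z) (1 / Im z)"]) auto
  define s where "s = Sup ?I"
  have le_s: "Im (moebius_action A z) \<le> s" if "A \<in> SL2Z" for A
    unfolding s_def using that bdd by (intro cSup_upper) auto
  have "s > 0" using le_s[OF SL2Z_one] z by (simp add: in_H_iff)
  \<comment> \<open>Any factor from 1/2 on and below 1 would do: with factor \<open>t\<close> the
    inversion forces norm squared at least \<open>t\<close>, and \<open>t - 1/4\<close> has to be at
    least 1/4.\<close>
  then have "9 / 10 * s < s" by simp
  then obtain A where A: "A \<in> SL2Z" "9 / 10 * s < Im (moebius_action A z)"
    using less_cSup_iff[of ?I "9 / 10 * s"] bdd SL2Z_one unfolding s_def by blast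
  define B where "B = tmat (- round (Re (moebius_action A z))) ** A"
  define y where "y = moebius_action B z"
  have B: "B \<in> SL2Z" unfolding B_def by (intro SL2Z_mult tmat_SL2Z A)
  have y: "y = moebius_action A z - of_int (round (Re (moebius_action A z)))"
    unfolding y_def B_def using A z by (simp add: moebius_mult tmat_SL2Z)
  have yH: "y \<in> UHP" unfolding y_def using B z by (rule moebius_in_H)
  have Im_y: "9 / 10 * s < Im y" using A by (simp add: y)
  have Re_y: "\<bar>Re y\<bar> \<le> 1 / 2" using of_int_round_abs_le[of "Re (moebius_action A z)"] by (simp add: y abs_minus_commute)
  have S: "mat2 0 (-1) 1 0 \<in> SL2Z" by (simp add: SL2Z_iff)
  \<comment> \<open>The point \<open>- 1 / y\<close> lies in the orbit as well, hence not higher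
    than \<open>s\<close>.\<close>
  have "Im (moebius_action (mat2 0 (-1) 1 0 ** B) z) \<le> s" by (intro le_s SL2Z_mult S B)
  then have "Im y / (norm y)\<^sup>2 \<le> s"
    using S B z by (simp add: moebius_mult Im_moebius flip: y_def) (simp add: aut_def)
  then have "Im y \<le> s * (norm y)\<^sup>2" using yH by (simp add: divide_le_eq in_H_iff split: if_splits)
  also have "s * (norm y)\<^sup>2 \<le> 10 / 9 * Im y * (norm y)\<^sup>2" using Im_y by (intro mult_right_mono) auto
  finally have "Im y * 1 \<le> Im y * (10 / 9 * (norm y)\<^sup>2)" by simp
  then have "1 \<le> 10 / 9 * (norm y)\<^sup>2" using yH by (subst (asm) mult_le_cancel_left_pos) (auto simp: in_H_iff)
  then have "9 / 10 \<le> (Re y)\<^sup>2 + (Im y)\<^sup>2" by (simp add: cmod_power2)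
  moreover have "(Re y)\<^sup>2 \<le> (1 / 2)\<^sup>2" using Re_y by (subst abs_le_square_iff[symmetric]) simp
  ultimately have "(1 / 2)\<^sup>2 \<le> (Im y)\<^sup>2" by (simp add: power2_eq_square)
  then have "1 / 2 \<le> Im y" by (rule power2_le_imp_le) (use yH in \<open>simp add: in_H_iff\<close>)
  then show ?thesis using that[OF B] Re_y unfolding y_def by blast
qed

text \<open>Proper discontinuity: the height of the image bounds \<open>aut A z\<close>, which
  bounds the bottom row; the numerator is the image times \<open>aut A z\<close>, which bounds the
  top row.\<close>

lemma finite_moebius:
  assumes "\<delta> > 0"
  shows "finite {A \<in> SL2Z. \<exists>z. \<delta> \<le> Im z \<and> norm z \<le> M \<and> \<delta> \<le> Im (moebius_action A z) \<and> norm (moebius_action A z) \<le> M}"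
    (is "finite ?S")
proof -
  \<comment> \<open>The imaginary part of the linear form bounds the coefficient of
    \<open>z\<close>; the form itself then bounds the other one.\<close>
  have lin: "\<bar>p\<bar> \<le> \<lceil>R / \<delta>\<rceil> \<and> \<bar>q\<bar> \<le> \<lceil>R + R / \<delta> * M\<rceil>"
    if "norm (of_int p * z + of_int q) \<le> R" "\<delta> \<le> Im z" "norm z \<le> M" for p q :: int and z R
  proof -
    have "\<bar>Im (of_int p * z + of_int q)\<bar> \<le> R" using that(1) abs_Im_le_cmod order_trans by blast
    then have "\<bar>real_of_int p\<bar> * Im z \<le> R" using that(2) assms by (simp add: abs_mult)
    moreover have "\<bar>real_of_int p\<bar> * \<delta> \<le> \<bar>real_of_int p\<bar> * Im z" using that(2) by (intro mult_left_mono) auto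
    ultimately have p: "\<bar>real_of_int p\<bar> \<le> R / \<delta>" using assms by (simp add: field_simps)
    have "norm (of_int q :: complex) \<le> norm (of_int p * z + of_int q) + norm (of_int p * z)"
      using norm_triangle_ineq4[of "of_int p * z + of_int q" "of_int p * z"] by simp
    also have "norm (of_int p * z) \<le> R / \<delta> * M"
      unfolding norm_mult using p that(3) by (intro mult_mono) (auto intro: order_trans[OF abs_ge_zero])
    finally have "\<bar>real_of_int q\<bar> \<le> R + R / \<delta> * M" using that(1) by simp
    with p show ?thesis by linarith
  qed
  \<comment> \<open>This bound on \<open>norm (aut A z)\<close> comes from
    \<open>\<delta> \<le> Im z / (norm (aut A z))\<^sup>2\<close> and
    \<open>Im z \<le> M\<close>.\<close>
  define R where "R = sqrt (M / \<delta>)"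
  define b1 b2 b3 b4 where "b1 = \<lceil>R / \<delta>\<rceil>" "b2 = \<lceil>R + R / \<delta> * M\<rceil>" "b3 = \<lceil>(M * R) / \<delta>\<rceil>" "b4 = \<lceil>(M * R) + (M * R) / \<delta> * M\<rceil>"
  note b_defs = this
  have "?S \<subseteq> (\<lambda>(a, b, c, d). mat2 a b c d) ` ({-b3..b3} \<times> {-b4..b4} \<times> {-b1..b1} \<times> {-b2..b2})"
  proof
    fix A assume "A \<in> ?S"
    then obtain z where A: "A \<in> SL2Z" and z: "\<delta> \<le> Im z" "norm z \<le> M"
      and Az: "\<delta> \<le> Im (moebius_action A z)" "norm (moebius_action A z) \<le> M" by blast
    have zH: "z \<in> UHP" using z assms by (simp add: in_H_iff)
    note nz = aut_nz[OF A zH]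
    have M0: "M \<ge> 0" using z(2) norm_ge_zero order_trans by blast
    have "\<delta> * (norm (aut A z))\<^sup>2 \<le> Im z"
      using Az(1) nz by (simp add: Im_moebius[OF A] field_simps)
    also have "Im z \<le> M" using z(2) abs_Im_le_cmod[of z] by linarith
    finally have "(norm (aut A z))\<^sup>2 \<le> M / \<delta>" using assms by (simp add: field_simps)
    then have R: "norm (aut A z) \<le> R" unfolding R_def by (rule real_le_rsqrt)
    have "of_int (A$1$1) * z + of_int (A$1$2) = moebius_action A z * aut A z"
      using nz by (simp add: moebius_eq)
    then have "norm (of_int (A$1$1) * z + of_int (A$1$2)) \<le> M * R"
      using R Az(2) M0 by (simp add: norm_mult mult_mono)
    from lin[OF this z] lin[OF R[unfolded aut_def] z]
    show "A \<in> (\<lambda>(a, b, c, d). mat2 a b c d) ` ({-b3..b3} \<times> {-b4..b4} \<times> {-b1..b1} \<times> {-b2..b2})"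
      by (intro image_eqI[of _ _ "(A$1$1, A$1$2, A$2$1, A$2$2)"])
        (auto simp: mat2_eq_iff b_defs abs_le_iff)
  qed
  then show ?thesis by (rule finite_subset) auto
qed

text \<open>Near the limits only finitely many matrices are possible, so one of them recurs
  infinitely often, and continuity carries its relation over to the limits.\<close>

lemma frequently_same_moebius:
  assumes lim: "Z \<longlonglongrightarrow> z" "Z' \<longlonglongrightarrow> z'" and H: "z \<in> UHP" "z' \<in> UHP"
    and A: "\<And>n. A n \<in> G" "G \<subseteq> SL2Z" "\<And>n. Z' n = moebius_action (A n) (Z n)"
  obtains B where "B \<in> G" "z' = moebius_action B z" "\<exists>\<^sub>F n in sequentially. A n = B"
proof -
  define \<delta> where "\<delta> = min (Im z) (Im z') / 2"
  have \<delta>: "\<delta> > 0" "\<delta> < Im z" "\<delta> < Im z'" using H by (auto simp: \<delta>_def in_H_iff)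
  define M where "M = max (norm z) (norm z') + 1"
  have M: "norm z < M" "norm z' < M" by (auto simp: M_def)
  let ?S = "{A \<in> SL2Z. \<exists>z. \<delta> \<le> Im z \<and> norm z \<le> M \<and> \<delta> \<le> Im (moebius_action A z) \<and> norm (moebius_action A z) \<le> M}"
  have "\<forall>\<^sub>F n in sequentially. \<delta> < Im (Z n)" "\<forall>\<^sub>F n in sequentially. \<delta> < Im (Z' n)"
    "\<forall>\<^sub>F n in sequentially. norm (Z n) < M" "\<forall>\<^sub>F n in sequentially. norm (Z' n) < M"
    using order_tendstoD(1)[OF tendsto_Im[OF lim(1)] \<delta>(2)] order_tendstoD(1)[OF tendsto_Im[OF lim(2)] \<delta>(3)]
      order_tendstoD(2)[OF tendsto_norm[OF lim(1)] M(1)] order_tendstoD(2)[OF tendsto_norm[OF lim(2)] M(2)]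
    by auto
  then have "\<forall>\<^sub>F n in sequentially. \<exists>B\<in>?S. A n = B"
    by eventually_elim (use A in \<open>fastforce intro: less_imp_le\<close>)
  then have "\<exists>\<^sub>F n in sequentially. \<exists>B\<in>?S. A n = B"
    by (rule eventually_frequently[rotated]) simp
  from frequently_bex_finite[OF finite_moebius[OF \<delta>(1)] this]
  obtain B where B: "B \<in> SL2Z" and fr: "\<exists>\<^sub>F n in sequentially. A n = B" by blast
  from frequently_ex[OF fr] A(1) have BG: "B \<in> G" by auto
  have "z' = moebius_action B z"
  proof (rule ccontr)
    assume "z' \<noteq> moebius_action B z"
    moreover have "isCont (moebius_action B) z" using moebius_has_deriv[OF B H(1)] by (rule DERIV_isCont)
    then have "(\<lambda>n. Z' n - moebius_action B (Z n)) \<longlonglongrightarrow> z' - moebius_action B z"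
      by (intro tendsto_intros lim isCont_tendsto_compose[of z "moebius_action B"]) auto
    ultimately have "\<forall>\<^sub>F n in sequentially. Z' n - moebius_action B (Z n) \<noteq> 0"
      by (intro tendsto_imp_eventually_ne) auto
    then have "\<forall>\<^sub>F n in sequentially. A n \<noteq> B" by eventually_elim (use A(3) in auto)
    with fr show False by (simp add: frequently_def)
  qed
  then show ?thesis using that BG fr by blast
qed

subsection \<open>Injectivity of the Hauptmodul\<close>

text \<open>A simple pole at \<open>\<infinity>\<close> and no pole at the other cusps are what
  injectivity rests on; the normalisation \<open>P 0 = 1\<close> is added in the recursion of the
  basis.\<close>

locale hauptmodul =
  fixes N :: nat and J P :: "complex \<Rightarrow> complex"
  assumes N: "N > 0" and J: "J \<in> M_sharp N 0" and qJ: "qlaurent 1 (-1) J P" and P0: "P 0 \<noteq> 0"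
begin

definition eqv :: "complex \<Rightarrow> complex \<Rightarrow> bool" where
  "eqv z w \<longleftrightarrow> (\<exists>A\<in>Gamma0 N. w = moebius_action A z)"

lemma eqv_sym: "z \<in> UHP \<Longrightarrow> eqv z w \<Longrightarrow> eqv w z"
  unfolding eqv_def by (metis Gamma0_inv2 Gamma0_SL2Z moebius_inv2_left)

lemma eqv_trans: "z \<in> UHP \<Longrightarrow> eqv z w \<Longrightarrow> eqv w u \<Longrightarrow> eqv z u"
  unfolding eqv_def by (metis Gamma0_mult Gamma0_SL2Z moebius_mult)

lemma eqv_add_int: "eqv z (z + of_int n)"
  unfolding eqv_def by (intro bexI[OF _ tmat_Gamma0[of n]]) simp

lemma holo_J: "J holomorphic_on UHP"
  using J by (simp add: M_sharp_iff[OF N])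

lemma J_moebius: "A \<in> Gamma0 N \<Longrightarrow> z \<in> UHP \<Longrightarrow> J (moebius_action A z) = J z"
  using J by (simp add: M_sharp_iff[OF N] slash_0)

lemma J_eqv: "z \<in> UHP \<Longrightarrow> eqv z w \<Longrightarrow> J w = J z"
  by (auto simp: eqv_def J_moebius)

lemma J_q: "z \<in> UHP \<Longrightarrow> J z = P (qpar 1 z) / qpar 1 z"
  using qJ by (simp add: qlaurent_def power_int_minus field_simps)

lemma holo_P: "P holomorphic_on ball 0 1"
  using qJ by (simp add: qlaurent_def)

text \<open>\<open>J\<close> in the parameter at the cusp of \<open>A\<close>, filled in at 0, where
  it takes the value of \<open>J\<close> at that cusp. On the unit disc the choice is unique by
  \<open>qlaurent_unique\<close>.\<close>

definition J_cusp :: "int ^ 2 ^ 2 \<Rightarrow> complex \<Rightarrow> complex" where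
  "J_cusp A = (SOME Q. qlaurent N 0 (slash 0 A J) Q)"

lemma J_cusp: assumes "A \<in> SL2Z" "A \<notin> Gamma0 N" shows "qlaurent N 0 (slash 0 A J) (J_cusp A)"
proof -
  have "\<exists>Q. qlaurent N 0 (slash 0 A J) Q" using J assms unfolding M_sharp_iff[OF N] by blast
  then show ?thesis unfolding J_cusp_def by (rule someI_ex)
qed

lemma J_moebius_cusp: "A \<in> SL2Z \<Longrightarrow> A \<notin> Gamma0 N \<Longrightarrow> z \<in> UHP \<Longrightarrow> J (moebius_action A z) = J_cusp A (qpar N z)"
  using J_cusp[of A] by (simp add: qlaurent_def slash_0)

lemma holo_J_cusp: "A \<in> SL2Z \<Longrightarrow> A \<notin> Gamma0 N \<Longrightarrow> J_cusp A holomorphic_on ball 0 1"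
  using J_cusp[of A] by (simp add: qlaurent_def)

lemma J_nonconst: "\<not> J constant_on UHP"
proof
  assume "J constant_on UHP"
  then obtain c where c: "\<And>z. z \<in> UHP \<Longrightarrow> J z = c" by (auto simp: constant_on_def)
  have "qlaurent 1 (-1) J (\<lambda>q. c * q)"
    using c by (auto simp: qlaurent_def power_int_minus intro!: holomorphic_intros)
  from qlaurent_unique[OF _ qJ this, of 0] show False using P0 by simp
qed

lemma open_image_J: "open U \<Longrightarrow> U \<subseteq> UHP \<Longrightarrow> open (J ` U)"
  by (rule open_mapping_thm[OF holo_J open_H connected_H _ _ J_nonconst])

lemma J_cusp_nonconst:
  assumes "A \<in> SL2Z" "A \<notin> Gamma0 N"
  shows "\<not> J_cusp A constant_on ball 0 1"
proof
  assume "J_cusp A constant_on ball 0 1"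
  then obtain c where c: "\<And>q. q \<in> ball 0 1 \<Longrightarrow> J_cusp A q = c" unfolding constant_on_def by blast
  have "J z = c" if z: "z \<in> UHP" for z
  proof -
    have "moebius_action (inv2 A) z \<in> UHP" using assms z by (intro moebius_in_H SL2Z_inv2)
    then show ?thesis
      using J_moebius_cusp[OF assms, of "moebius_action (inv2 A) z"] c qpar_in_ball[OF N] assms z
      by (simp add: moebius_inv2_right)
  qed
  then show False using J_nonconst by (auto simp: constant_on_def)
qed

text \<open>The half-strip above height 1/2 meets every orbit of \<open>SL2Z\<close>; the inverse of
  the reducing matrix is exchanged for one of finitely many representatives at the cost of an
  element of \<open>Gamma0 N\<close>.\<close>

lemma rep_cover:
  assumes z: "z \<in> UHP"
  obtains r y where "r \<in> bottom_rows N" "1 / 2 \<le> Im y" "\<bar>Re y\<bar> \<le> 1 / 2" "eqv (moebius_action (rep N r) y) z"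
proof -
  obtain A where A: "A \<in> SL2Z" "Im (moebius_action A z) \<ge> 1 / 2" "\<bar>Re (moebius_action A z)\<bar> \<le> 1 / 2"
    using reduction[OF z] .
  define y where "y = moebius_action A z"
  have y: "y \<in> UHP" unfolding y_def using A z by (intro moebius_in_H)
  define r where "r = bottom_row N (inv2 A)"
  have r: "r \<in> bottom_rows N" using A by (auto simp: r_def bottom_rows_def intro: SL2Z_inv2)
  have G: "inv2 A ** inv2 (rep N r) \<in> Gamma0 N"
    by (rule bottom_row_eq_imp) (use A r rep SL2Z_inv2 in \<open>auto simp: r_def\<close>)
  have "z = moebius_action (inv2 A) y" using A z by (simp add: y_def moebius_inv2_left)
  also have "inv2 A = (inv2 A ** inv2 (rep N r)) ** rep N r"
    using rep(1)[OF r] by (simp add: inv2_left flip: matrix_mul_assoc)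
  also have "moebius_action \<dots> y = moebius_action (inv2 A ** inv2 (rep N r)) (moebius_action (rep N r) y)"
    using G rep(1)[OF r] y by (intro moebius_mult) (auto dest: Gamma0_SL2Z)
  finally have "eqv (moebius_action (rep N r) y) z" using G unfolding eqv_def by blast
  then show ?thesis using that r A by (simp add: y_def)
qed

definition cusp_values :: "complex set" where
  "cusp_values = (\<lambda>r. J_cusp (rep N r) 0) ` {r \<in> bottom_rows N. rep N r \<notin> Gamma0 N}"

lemma norm_qpar_less: "r > 0 \<Longrightarrow> h > 0 \<Longrightarrow> norm (qpar h z) < r \<longleftrightarrow> Im z > - real h * ln r / (2 * pi)"
proof -
  assume r: "r > 0" and h: "h > 0"
  have "norm (qpar h z) < r \<longleftrightarrow> - (2 * pi * Im z / real h) < ln r"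
    unfolding norm_qpar using r by (metis exp_less_cancel_iff exp_ln)
  also have "\<dots> \<longleftrightarrow> Im z > - real h * ln r / (2 * pi)" using h by (simp add: field_simps) linarith
  finally show ?thesis .
qed

text \<open>Near \<open>\<infinity>\<close> the values of \<open>J\<close> are large, and near
  another cusp they approach a value other than \<open>w\<close>. A single \<open>e\<close> bounds
  the distance and, by its reciprocal, the height, so that finitely many conditions on small
  \<open>e\<close> can be combined.\<close>

lemma away_from_cusps:
  assumes w: "w \<notin> cusp_values"
  obtains e where "e > 0"
    "\<And>r y. r \<in> bottom_rows N \<Longrightarrow> y \<in> UHP \<Longrightarrow> Im y > 1 / e \<Longrightarrow> dist (J (moebius_action (rep N r) y)) w \<ge> e"
proof -
  have ev: "\<forall>\<^sub>F e in at_right 0. \<forall>y\<in>UHP. Im y > 1 / e \<longrightarrow> dist (J (moebius_action A y)) w \<ge> e"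
    if A: "A \<in> SL2Z" and h: "h > 0" and g: "\<And>y. y \<in> UHP \<Longrightarrow> J (moebius_action A y) = g (qpar h y)"
      and lim: "\<exists>d>0. \<forall>\<^sub>F q in at 0. dist (g q) w \<ge> d" for A g h
  proof -
    obtain d \<delta> where d: "d > 0" "\<delta> > 0" "\<And>q. q \<noteq> 0 \<Longrightarrow> norm q < \<delta> \<Longrightarrow> dist (g q) w \<ge> d"
      using lim unfolding eventually_at by (auto simp: dist_norm)
    define M where "M = max 1 (- real h * ln \<delta> / (2 * pi))"
    show ?thesis unfolding eventually_at_right_field
    proof (intro exI[of _ "min d (1 / M)"] conjI allI impI ballI)
      show "0 < min d (1 / M)" using d by (simp add: M_def)
      fix e y assume e: "0 < e" "e < min d (1 / M)" and y: "y \<in> UHP" "1 / e < Im y"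
      have "M > 0" by (simp add: M_def)
      then have "M < 1 / e" using e by (simp add: field_simps)
      then have "Im y > - real h * ln \<delta> / (2 * pi)" using y by (simp add: M_def)
      then have "norm (qpar h y) < \<delta>" using norm_qpar_less[OF d(2) h] by blast
      then show "e \<le> dist (J (moebius_action A y)) w" using d(3)[of "qpar h y"] g[OF y(1)] e by simp
    qed
  qed
  have "\<forall>\<^sub>F e in at_right 0. \<forall>y\<in>UHP. Im y > 1 / e \<longrightarrow> dist (J (moebius_action (rep N r) y)) w \<ge> e"
    if r: "r \<in> bottom_rows N" for r
  proof (cases "rep N r \<in> Gamma0 N")
    case True
    have "filterlim (\<lambda>q. P q / q) at_infinity (at 0)"
    proof (rule filterlim_divide_at_infinity)
      show "(P \<longlongrightarrow> P 0) (at 0)"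
        using holo_P by (metis centre_in_ball continuous_on_interior continuous_within holomorphic_on_imp_continuous_on interior_ball zero_less_one)
      show "filterlim (\<lambda>q::complex. q) (at 0) (at 0)" by (rule filterlim_ident)
    qed (rule P0)
    then have "\<forall>\<^sub>F q in at 0. norm (P q / q) \<ge> norm w + 1"
      unfolding filterlim_at_infinity[OF order_refl] using norm_ge_zero[of w] by (metis add_nonneg_pos zero_less_one)
    then have "\<forall>\<^sub>F q in at 0. dist (P q / q) w \<ge> 1"
    proof eventually_elim
      case (elim q)
      then show ?case using norm_triangle_ineq2[of "P q / q" w] by (simp add: dist_norm)
    qed
    then show ?thesis
      by (intro ev[where h = 1 and g = "\<lambda>q. P q / q"]) (use r rep True J_moebius J_q in \<open>auto intro: zero_less_one\<close>)
  next
    case False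
    have "isCont (J_cusp (rep N r)) 0"
      using holo_J_cusp[OF rep(1)[OF r] False]
      by (meson centre_in_ball continuous_on_eq_continuous_at holomorphic_on_imp_continuous_on open_ball zero_less_one)
    then have "((\<lambda>q. dist (J_cusp (rep N r) q) w) \<longlongrightarrow> dist (J_cusp (rep N r) 0) w) (at 0)"
      by (intro tendsto_intros) (simp add: continuous_within)
    moreover have "J_cusp (rep N r) 0 \<noteq> w" using w r False by (auto simp: cusp_values_def)
    then have d: "dist (J_cusp (rep N r) 0) w > 0" by simp
    ultimately have "\<forall>\<^sub>F q in at 0. dist (J_cusp (rep N r) q) w > dist (J_cusp (rep N r) 0) w / 2"
      by (intro order_tendstoD(1)) auto
    then have "\<forall>\<^sub>F q in at 0. dist (J_cusp (rep N r) q) w \<ge> dist (J_cusp (rep N r) 0) w / 2"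
      by eventually_elim simp
    with d show ?thesis
      by (intro ev[where h = N and g = "J_cusp (rep N r)"]) (use r rep False J_moebius_cusp N in \<open>auto intro!: exI[of _ "dist (J_cusp (rep N r) 0) w / 2"]\<close>)
  qed
  then have "\<forall>\<^sub>F e in at_right 0. \<forall>r\<in>bottom_rows N. \<forall>y\<in>UHP. Im y > 1 / e \<longrightarrow> dist (J (moebius_action (rep N r) y)) w \<ge> e"
    by (intro eventually_ball_finite finite_bottom_rows N) auto
  moreover have "\<forall>\<^sub>F e in at_right 0. (0::real) < e" by (rule eventually_at_right_less)
  ultimately have "\<forall>\<^sub>F e in at_right 0. e > 0 \<and> (\<forall>r\<in>bottom_rows N. \<forall>y\<in>UHP. Im y > 1 / e \<longrightarrow> dist (J (moebius_action (rep N r) y)) w \<ge> e)"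
    by eventually_elim blast
  then obtain e where "e > 0" "\<forall>r\<in>bottom_rows N. \<forall>y\<in>UHP. Im y > 1 / e \<longrightarrow> dist (J (moebius_action (rep N r) y)) w \<ge> e"
    using eventually_happens[of _ "at_right (0::real)"] trivial_limit_at_right_real by blast
  then show ?thesis using that by blast
qed

section \<open>Values attained at inequivalent points\<close>

definition doubles :: "complex set" where
  "doubles = {w. \<exists>z\<in>UHP. \<exists>z'\<in>UHP. \<not> eqv z z' \<and> J z = w \<and> J z' = w}"

text \<open>At these values a sequence of double values could lose a point in the limit, by escape
  to a cusp or by merging at a critical point.\<close>

definition exceptional :: "complex set" where
  "exceptional = cusp_values \<union> J ` {z \<in> UHP. deriv J z = 0}"

text \<open>The zeros of \<open>deriv J\<close> are countable unless \<open>deriv J\<close> is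
  constant; then \<open>J\<close> would be linear and, having period one, constant. The half-plane
  enters as a countable union of closed half-planes.\<close>

lemma countable_exceptional: "countable exceptional"
proof -
  have "countable {z \<in> UHP. deriv J z = 0}"
  proof (rule holomorphic_countable_zeros)
    show "deriv J holomorphic_on UHP" by (rule holomorphic_deriv[OF holo_J open_H])
    have "UHP = (\<Union>n. {z. Im z \<ge> 1 / real (Suc n)})"
    proof (intro equalityI subsetI)
      fix z assume "z \<in> UHP"
      then obtain n where "1 / real (Suc n) < Im z" using nat_approx_posE[of "Im z"] by (auto simp: in_H_iff)
      then show "z \<in> (\<Union>n. {z. Im z \<ge> 1 / real (Suc n)})" by (auto intro: less_imp_le)
    next
      fix z assume "z \<in> (\<Union>n. {z. Im z \<ge> 1 / real (Suc n)})"
      then obtain n where "1 / real (Suc n) \<le> Im z" by blast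
      moreover have "0 < 1 / real (Suc n)" by simp
      ultimately show "z \<in> UHP" unfolding in_H_iff by linarith
    qed
    moreover have "fsigma (\<Union>n. {z. Im z \<ge> 1 / real (Suc n)})"
      by (rule fsigma.intros) (rule closed_halfspace_Im_ge)
    ultimately show "fsigma UHP" by simp
    show "\<not> deriv J constant_on UHP"
    proof
      assume "deriv J constant_on UHP"
      then obtain c where c: "\<And>z. z \<in> UHP \<Longrightarrow> deriv J z = c" unfolding constant_on_def by blast
      have "\<exists>k. \<forall>z\<in>UHP. J z - c * z = k"
      proof -
        have "(J has_field_derivative c) (at z)" if "z \<in> UHP" for z
          using holomorphic_derivI[OF holo_J open_H that] c[OF that] by simp
        moreover have "((\<lambda>z. c * z) has_field_derivative c) (at z)" for z
          by (auto intro!: derivative_eq_intros)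
        ultimately show ?thesis using has_same_deriv_imp_diff_const[of J "\<lambda>_. c" "\<lambda>z. c * z"] by metis
      qed
      then obtain k where k: "\<And>z. z \<in> UHP \<Longrightarrow> J z - c * z = k" by blast
      have "J (\<i> + 1) = J \<i>" using J_eqv[OF ii_in_H eqv_add_int[of \<i> 1]] by simp
      moreover have "\<i> + 1 \<in> UHP" by (simp add: in_H_iff)
      ultimately have "c = 0" using k[OF ii_in_H] k[of "\<i> + 1"] by (simp add: algebra_simps)
      with k J_nonconst show False by (auto simp: constant_on_def)
    qed
  qed (rule open_H connected_H)+
  then show ?thesis unfolding exceptional_def cusp_values_def
    using finite_bottom_rows[OF N] by (auto intro: countable_finite)
qed

text \<open>Inequivalent points have neighbourhoods without equivalent pairs, since otherwise
  convergent sequences would make the centres equivalent. The images of the two neighbourhoods are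
  open, and where they meet they consist of double values.\<close>

lemma open_doubles: "open doubles"
proof (subst open_subopen, intro ballI)
  fix w assume "w \<in> doubles"
  then obtain z z' where z: "z \<in> UHP" "z' \<in> UHP" "\<not> eqv z z'" "J z = w" "J z' = w"
    unfolding doubles_def by blast
  have "\<exists>n. \<forall>u\<in>ball z (1 / Suc n) \<inter> UHP. \<forall>u'\<in>ball z' (1 / Suc n) \<inter> UHP. \<not> eqv u u'"
  proof (rule ccontr)
    assume no: "\<not> ?thesis"
    have "\<forall>n. \<exists>x. fst x \<in> ball z (1 / Suc n) \<and> snd x \<in> ball z' (1 / Suc n) \<and> eqv (fst x) (snd x)"
    proof (intro allI)
      fix n
      from no obtain u u' where "u \<in> ball z (1 / Suc n)" "u' \<in> ball z' (1 / Suc n)" "eqv u u'"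
        by (metis (no_types) IntE)
      then show "\<exists>x. fst x \<in> ball z (1 / Suc n) \<and> snd x \<in> ball z' (1 / Suc n) \<and> eqv (fst x) (snd x)"
        by (intro exI[of _ "(u, u')"]) simp
    qed
    then obtain x where x: "\<And>n. fst (x n) \<in> ball z (1 / Suc n)" "\<And>n. snd (x n) \<in> ball z' (1 / Suc n)"
      "\<And>n. eqv (fst (x n)) (snd (x n))" by metis
    define u u' where "u = (\<lambda>n. fst (x n))" and "u' = (\<lambda>n. snd (x n))"
    from x(3) obtain A where "\<And>n. A n \<in> Gamma0 N" "\<And>n. u' n = moebius_action (A n) (u n)"
      unfolding eqv_def u_def u'_def by metis
    with x(1,2) have u: "\<And>n. u n \<in> ball z (1 / Suc n)" "\<And>n. u' n \<in> ball z' (1 / Suc n)"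
      "\<And>n. A n \<in> Gamma0 N" "\<And>n. u' n = moebius_action (A n) (u n)" by (auto simp: u_def u'_def)
    have lim: "v \<longlonglongrightarrow> x" if "\<And>n. v n \<in> ball x (1 / Suc n)" for v :: "nat \<Rightarrow> complex" and x
    proof (rule metric_LIMSEQ_I)
      fix r :: real assume "r > 0"
      then obtain n0 where n0: "1 / Suc n0 < r" using nat_approx_posE by blast
      have "dist (v n) x < r" if "n \<ge> n0" for n
      proof -
        have "dist (v n) x < 1 / Suc n" using \<open>\<And>n. v n \<in> ball x (1 / Suc n)\<close>[of n] by (simp add: dist_commute)
        also have "\<dots> \<le> 1 / Suc n0" using that by (simp add: field_simps)
        finally show ?thesis using n0 by simp
      qed
      then show "\<exists>no. \<forall>n\<ge>no. dist (v n) x < r" by blast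
    qed
    have "Gamma0 N \<subseteq> SL2Z" using Gamma0_SL2Z by blast
    from frequently_same_moebius[OF lim[of u z, OF u(1)] lim[of u' z', OF u(2)] z(1,2) u(3) this u(4)]
    obtain B where "B \<in> Gamma0 N" "z' = moebius_action B z" by blast
    then show False using z(3) unfolding eqv_def by blast
  qed
  then obtain n where n: "\<And>u u'. u \<in> ball z (1 / Suc n) \<inter> UHP \<Longrightarrow> u' \<in> ball z' (1 / Suc n) \<inter> UHP \<Longrightarrow> \<not> eqv u u'"
    by blast
  let ?T = "J ` (ball z (1 / Suc n) \<inter> UHP) \<inter> J ` (ball z' (1 / Suc n) \<inter> UHP)"
  have "open ?T" by (intro open_Int open_image_J open_H open_ball) auto
  moreover have "w \<in> ?T"
  proof (rule IntI)
    show "w \<in> J ` (ball z (1 / Suc n) \<inter> UHP)" using z by (intro image_eqI[of _ _ z]) auto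
    show "w \<in> J ` (ball z' (1 / Suc n) \<inter> UHP)" using z by (intro image_eqI[of _ _ z']) auto
  qed
  moreover have "?T \<subseteq> doubles"
  proof
    fix v assume "v \<in> ?T"
    then obtain u u' where u: "u \<in> ball z (1 / Suc n) \<inter> UHP" "u' \<in> ball z' (1 / Suc n) \<inter> UHP" "J u = v" "J u' = v"
      by (elim IntE imageE) (metis IntI)
    then have "u \<in> UHP \<and> u' \<in> UHP \<and> \<not> eqv u u'" using n by simp
    with u(3,4) show "v \<in> doubles" unfolding doubles_def by auto
  qed
  ultimately show "\<exists>T. open T \<and> w \<in> T \<and> T \<subseteq> doubles" by blast
qed

end

context hauptmodul
begin

text \<open>Away from the exceptional values, \<open>J\<close> is proper (no fibre runs into a cusp) and locally injective,
  so a limit of double values is a double value.\<close>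

lemma doubles_closed_off_exceptional:
  assumes w: "w \<notin> exceptional" "w \<notin> doubles"
  obtains e where "e > 0" "ball w e \<inter> doubles = {}"
proof (rule ccontr)
  assume no: "\<not> thesis"
  obtain \<epsilon> where \<epsilon>: "\<epsilon> > 0"
    "\<And>r y. r \<in> bottom_rows N \<Longrightarrow> y \<in> UHP \<Longrightarrow> Im y > 1 / \<epsilon> \<Longrightarrow> dist (J (moebius_action (rep N r) y)) w \<ge> \<epsilon>"
    using away_from_cusps[of w] w by (auto simp: exceptional_def)
  \<comment> \<open>Above height \<open>1 / \<epsilon>\<close> the values of \<open>J\<close> stay
    away from \<open>w\<close>, so the images of this rectangle under the representatives catch
    every orbit with a value near \<open>w\<close>.\<close>
  define L where "L = {y. \<bar>Re y\<bar> \<le> 1 / 2 \<and> 1 / 2 \<le> Im y \<and> Im y \<le> 1 / \<epsilon>}"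
  have LH: "L \<subseteq> UHP" by (auto simp: L_def in_H_iff)
  have "L = cbox (Complex (-1/2) (1/2)) (Complex (1/2) (1/\<epsilon>))"
    by (auto simp: L_def in_cbox_complex_iff abs_le_iff)
  then have "compact L" by simp
  define K where "K = (\<Union>r\<in>bottom_rows N. moebius_action (rep N r) ` L)"
  have "compact K" unfolding K_def
  proof (intro compact_UN compact_continuous_image finite_bottom_rows N \<open>compact L\<close>)
    fix r assume "r \<in> bottom_rows N"
    then show "continuous_on L (moebius_action (rep N r))"
      by (intro holomorphic_on_imp_continuous_on holomorphic_on_subset[OF holomorphic_moebius LH] rep)
  qed
  have KH: "K \<subseteq> UHP" unfolding K_def using LH by (auto intro!: moebius_in_H rep)
  have in_K: "\<exists>u\<in>K. eqv u z" if z: "z \<in> UHP" "dist (J z) w < \<epsilon>" for z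
  proof -
    obtain r y where y: "r \<in> bottom_rows N" "1 / 2 \<le> Im y" "\<bar>Re y\<bar> \<le> 1 / 2" "eqv (moebius_action (rep N r) y) z"
      using rep_cover[OF z(1)] .
    have yH: "y \<in> UHP" using y(2) by (simp add: in_H_iff)
    have "J z = J (moebius_action (rep N r) y)"
      using J_eqv[OF moebius_in_H[OF rep(1)[OF y(1)] yH] y(4)] .
    then have "Im y \<le> 1 / \<epsilon>" using \<epsilon>(2)[OF y(1) yH] z(2) by fastforce
    then have "moebius_action (rep N r) y \<in> K" using y by (auto simp: K_def L_def)
    then show ?thesis using y(4) by blast
  qed
  have "\<exists>x. x \<in> K \<times> K \<and> \<not> eqv (fst x) (snd x) \<and> J (fst x) = J (snd x) \<and> dist (J (fst x)) w < 1 / Suc n" for n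
  proof -
    have "min \<epsilon> (1 / Suc n) > 0" using \<epsilon>(1) by simp
    with no that have "ball w (min \<epsilon> (1 / Suc n)) \<inter> doubles \<noteq> {}" by blast
    then obtain v where v: "v \<in> ball w (min \<epsilon> (1 / Suc n))" "v \<in> doubles" by blast
    then obtain z z' where z: "z \<in> UHP" "z' \<in> UHP" "\<not> eqv z z'" "J z = v" "J z' = v"
      unfolding doubles_def by blast
    have zw: "dist w (J z) < min \<epsilon> (1 / Suc n)" using v(1) z by (simp only: mem_ball)
    have dz: "dist (J z) w < \<epsilon>" "dist (J z') w < \<epsilon>" "dist (J z) w < 1 / Suc n"
      using z zw by (simp_all add: dist_commute)
    obtain u u' where u: "u \<in> K" "eqv u z" "u' \<in> K" "eqv u' z'"
      using in_K[OF z(1) dz(1)] in_K[OF z(2) dz(2)] by blast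
    then have uH: "u \<in> UHP" "u' \<in> UHP" using KH by auto
    have "\<not> eqv u u'"
      using z(1-3) u uH eqv_sym eqv_trans by meson
    moreover have "J u = J z" "J u' = J z'" using J_eqv uH u by metis+
    ultimately show ?thesis using u z dz(3) by (intro exI[of _ "(u, u')"]) auto
  qed
  then obtain x where x: "\<And>n. x n \<in> K \<times> K" "\<And>n. \<not> eqv (fst (x n)) (snd (x n))"
    "\<And>n. J (fst (x n)) = J (snd (x n))" "\<And>n. dist (J (fst (x n))) w < 1 / Suc n" by metis
  have "seq_compact (K \<times> K)" using \<open>compact K\<close> by (intro compact_imp_seq_compact compact_Times)
  then obtain l s where l: "l \<in> K \<times> K" "strict_mono s" "(x \<circ> s) \<longlonglongrightarrow> l"
    using x(1) by (metis seq_compactE)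
  define z z' where "z = fst l" and "z' = snd l"
  define u u' where "u = (\<lambda>n. fst (x (s n)))" and "u' = (\<lambda>n. snd (x (s n)))"
  have u: "u \<longlonglongrightarrow> z" "u' \<longlonglongrightarrow> z'"
    using tendsto_fst[OF l(3)] tendsto_snd[OF l(3)] by (simp_all add: o_def u_def u'_def z_def z'_def)
  have z: "z \<in> UHP" "z' \<in> UHP" using l(1) KH by (auto simp: z_def z'_def)
  have uH: "u n \<in> UHP" "u' n \<in> UHP" for n
    using x(1)[of "s n"] KH by (auto simp: u_def u'_def mem_Times_iff)
  have cont: "isCont J v" if "v \<in> UHP" for v
    using holo_J that open_H by (meson continuous_on_eq_continuous_at holomorphic_on_imp_continuous_on)
  have Ju: "(\<lambda>n. J (u n)) \<longlonglongrightarrow> J z" "(\<lambda>n. J (u' n)) \<longlonglongrightarrow> J z'"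
    using isCont_tendsto_compose[OF cont u(1)] isCont_tendsto_compose[OF cont u(2)] z by auto
  have "(\<lambda>n. J (u n)) \<longlonglongrightarrow> w"
  proof (rule metric_tendsto_imp_tendsto)
    show "(\<lambda>n. 1 / real (Suc n)) \<longlonglongrightarrow> 0" by (rule LIMSEQ_Suc[OF lim_1_over_n])
    show "\<forall>\<^sub>F n in sequentially. dist (J (u n)) w \<le> dist (1 / real (Suc n)) 0"
    proof (intro always_eventually allI)
      fix n
      have "dist (J (u n)) w < 1 / Suc (s n)" using x(4) by (simp add: u_def)
      also have "\<dots> \<le> 1 / Suc n" using seq_suble[OF l(2), of n] by (simp add: field_simps)
      finally show "dist (J (u n)) w \<le> dist (1 / real (Suc n)) 0" by simp
    qed
  qed
  then have Jz: "J z = w" using Ju LIMSEQ_unique by blast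
  have "(\<lambda>n. J (u n)) = (\<lambda>n. J (u' n))" using x(3) by (simp add: u_def u'_def)
  then have "J z' = w" using Ju Jz LIMSEQ_unique by metis
  \<comment> \<open>The limits share the value \<open>w\<close>, which is not double.\<close>
  then have "eqv z z'" using w(2) z Jz unfolding doubles_def by blast
  then obtain A where A: "A \<in> Gamma0 N" "z = moebius_action A z'"
    using eqv_sym[OF z(1)] unfolding eqv_def by blast
  have AS: "A \<in> SL2Z" using A(1) by (rule Gamma0_SL2Z)
  have v: "(\<lambda>n. moebius_action A (u' n)) \<longlonglongrightarrow> z"
    unfolding A(2) by (intro isCont_tendsto_compose[OF _ u(2)] DERIV_isCont[OF moebius_has_deriv] AS z)
  \<comment> \<open>As \<open>w\<close> is not a critical value, \<open>J\<close> is injective near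
    \<open>z\<close>; the two points of a late pair, one of them moved by \<open>A\<close>, then
    coincide.\<close>
  have "deriv J z \<noteq> 0" using w(1) Jz z by (auto simp: exceptional_def)
  then obtain d where d: "d > 0" "inj_on J (ball z d)"
    using has_complex_derivative_locally_injective[OF holo_J z(1) open_H] by metis
  have "\<forall>\<^sub>F n in sequentially. u n \<in> ball z d" "\<forall>\<^sub>F n in sequentially. moebius_action A (u' n) \<in> ball z d"
    using u(1) v d(1) by (auto simp: tendsto_iff dist_commute)
  then have "\<forall>\<^sub>F n in sequentially. u n = moebius_action A (u' n)"
  proof eventually_elim
    case (elim n)
    have "J (moebius_action A (u' n)) = J (u n)"
      using J_moebius[OF A(1) uH(2)] x(3) by (simp add: u_def u'_def)
    then show ?case using d(2) elim by (metis inj_onD)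
  qed
  then obtain n where "u n = moebius_action A (u' n)" using eventually_happens by force
  then have "eqv (u' n) (u n)" using A(1) unfolding eqv_def by blast
  then have "eqv (u n) (u' n)" using eqv_sym uH by blast
  then show False using x(2) by (simp add: u_def u'_def)
qed

lemma compact_annulus: "compact {q :: complex. a \<le> norm q \<and> norm q \<le> b}"
proof -
  have "{q :: complex. a \<le> norm q \<and> norm q \<le> b} = cball 0 b - ball 0 a" by auto
  then show ?thesis by (simp add: compact_diff)
qed

text \<open>A large value of \<open>J\<close> is attained only near \<open>\<infinity>\<close>, where \<open>q \<mapsto> q / P q\<close> is injective.\<close>

lemma doubles_bounded: obtains M where "\<And>w. w \<in> doubles \<Longrightarrow> norm w \<le> M"
proof -
  \<comment> \<open>The norm of the parameter of period \<open>h\<close> at height 1/2, the lower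
    edge of the half-strip in \<open>rep_cover\<close>.\<close>
  define \<rho> where "\<rho> = (\<lambda>h::nat. exp (- (pi / real h)))"
  have \<rho>: "\<rho> h < 1" if "h > 0" for h using that by (simp add: \<rho>_def)
  have norm_q: "norm (qpar h y) \<le> \<rho> h" if "Im y \<ge> 1 / 2" "h > 0" for h y
    using that by (simp add: norm_qpar \<rho>_def divide_right_mono)
  have bd_A: "\<exists>M. \<forall>y. Im y \<ge> 1 / 2 \<longrightarrow> norm (J (moebius_action (rep N r) y)) \<le> M"
    if r: "r \<in> bottom_rows N" "rep N r \<notin> Gamma0 N" for r
  proof -
    have "continuous_on (cball 0 (\<rho> N)) (J_cusp (rep N r))"
      using holo_J_cusp[OF rep(1)[OF r(1)] r(2)] \<rho>[OF N]
      by (intro holomorphic_on_imp_continuous_on) (auto elim!: holomorphic_on_subset)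
    then have "bounded (J_cusp (rep N r) ` cball 0 (\<rho> N))" by (intro compact_imp_bounded compact_continuous_image) auto
    then obtain M where M: "\<And>q. q \<in> cball 0 (\<rho> N) \<Longrightarrow> norm (J_cusp (rep N r) q) \<le> M"
      unfolding bounded_iff by blast
    have "norm (J (moebius_action (rep N r) y)) \<le> M" if "Im y \<ge> 1 / 2" for y
    proof -
      have "y \<in> UHP" using that by (simp add: in_H_iff)
      then show ?thesis using J_moebius_cusp[OF rep(1)[OF r(1)] r(2)] M[of "qpar N y"] norm_q[OF that N] by simp
    qed
    then show ?thesis by blast
  qed
  then have "\<forall>r\<in>{r \<in> bottom_rows N. rep N r \<notin> Gamma0 N}. \<exists>M. \<forall>y. Im y \<ge> 1 / 2 \<longrightarrow> norm (J (moebius_action (rep N r) y)) \<le> M"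
    by blast
  then obtain Mr where Mr: "\<And>r y. r \<in> bottom_rows N \<Longrightarrow> rep N r \<notin> Gamma0 N \<Longrightarrow> Im y \<ge> 1 / 2 \<Longrightarrow>
      norm (J (moebius_action (rep N r) y)) \<le> Mr r" by (metis (mono_tags, lifting) mem_Collect_eq)
  define M1 where "M1 = (\<Sum>r\<in>{r \<in> bottom_rows N. rep N r \<notin> Gamma0 N}. \<bar>Mr r\<bar>)"
  have M1: "norm (J (moebius_action (rep N r) y)) \<le> M1"
    if "r \<in> bottom_rows N" "rep N r \<notin> Gamma0 N" "Im y \<ge> 1 / 2" for r y
  proof -
    have "norm (J (moebius_action (rep N r) y)) \<le> \<bar>Mr r\<bar>" using Mr[OF that] by simp
    also have "\<dots> \<le> M1" unfolding M1_def
      by (rule member_le_sum) (use that finite_bottom_rows[OF N] in auto)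
    finally show ?thesis .
  qed
  have "\<exists>e>0. \<forall>q\<in>ball 0 e. P q \<noteq> 0"
  proof -
    have "isCont P 0" using holo_P
      by (meson centre_in_ball continuous_on_eq_continuous_at holomorphic_on_imp_continuous_on open_ball zero_less_one)
    then have "\<forall>\<^sub>F q in nhds 0. P q \<noteq> 0"
      using P0 unfolding eventually_nhds_conv_at by (simp add: continuous_within tendsto_imp_eventually_ne)
    then show ?thesis unfolding eventually_nhds_metric by (auto simp: dist_commute)
  qed
  then obtain e where e: "e > 0" "\<And>q. q \<in> ball 0 e \<Longrightarrow> P q \<noteq> 0" by blast
  define S where "S = ball (0::complex) (min e 1)"
  have S: "open S" "0 \<in> S" using e by (auto simp: S_def)
  have hol: "(\<lambda>q. q / P q) holomorphic_on S"
    unfolding S_def by (intro holomorphic_intros holomorphic_on_subset[OF holo_P]) (use e in auto)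
  \<comment> \<open>At 0 the derivative is \<open>1 / P 0\<close>, so the reciprocal of
    \<open>J\<close>, as a function of the parameter, is injective near 0.\<close>
  have "deriv (\<lambda>q. q / P q) 0 \<noteq> 0"
  proof -
    have "(P has_field_derivative deriv P 0) (at 0)"
      by (rule holomorphic_derivI[OF holo_P]) auto
    then have "((\<lambda>q. q / P q) has_field_derivative 1 / P 0) (at 0)"
      using P0 by (auto intro!: derivative_eq_intros simp: power2_eq_square field_simps)
    then show ?thesis using P0 by (simp add: DERIV_imp_deriv)
  qed
  then obtain \<delta> where \<delta>: "\<delta> > 0" "ball 0 \<delta> \<subseteq> S" "inj_on (\<lambda>q. q / P q) (ball 0 \<delta>)"
    using has_complex_derivative_locally_injective[OF hol S(2,1)] by metis
  have "continuous_on {q. \<delta> \<le> norm q \<and> norm q \<le> \<rho> 1} (\<lambda>q. P q / q)"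
    using \<rho>[of 1] \<delta> by (intro continuous_intros holomorphic_on_imp_continuous_on holomorphic_on_subset[OF holo_P]) auto
  then have "bounded ((\<lambda>q. P q / q) ` {q. \<delta> \<le> norm q \<and> norm q \<le> \<rho> 1})"
    by (intro compact_imp_bounded compact_continuous_image compact_annulus)
  then obtain M2 where M2: "\<And>q. \<delta> \<le> norm q \<Longrightarrow> norm q \<le> \<rho> 1 \<Longrightarrow> norm (P q / q) \<le> M2"
    unfolding bounded_iff by blast
  have near: "\<exists>y. y \<in> UHP \<and> eqv y z \<and> norm (qpar 1 y) < \<delta>"
    if z: "z \<in> UHP" "norm (J z) > max M1 M2" for z
  proof -
    obtain r y where y: "r \<in> bottom_rows N" "1 / 2 \<le> Im y" "eqv (moebius_action (rep N r) y) z"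
      using rep_cover[OF z(1)] by metis
    have yH: "y \<in> UHP" using y(2) by (simp add: in_H_iff)
    have rH: "moebius_action (rep N r) y \<in> UHP" by (rule moebius_in_H[OF rep(1)[OF y(1)] yH])
    have Jz: "J z = J (moebius_action (rep N r) y)" using J_eqv[OF rH y(3)] .
    have G: "rep N r \<in> Gamma0 N"
      using M1[OF y(1) _ y(2)] z(2) Jz by (cases "rep N r \<in> Gamma0 N") auto
    have "J z = P (qpar 1 y) / qpar 1 y" using Jz J_moebius[OF G yH] J_q[OF yH] by simp
    then have "norm (qpar 1 y) < \<delta>" using M2[of "qpar 1 y"] norm_q[OF y(2), of 1] z(2) by fastforce
    moreover have "eqv y z" using eqv_trans[OF yH _ y(3)] G unfolding eqv_def by blast
    ultimately show ?thesis using yH by blast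
  qed
  have "norm w \<le> max (max M1 M2) 0" if w: "w \<in> doubles" for w
  proof (rule ccontr)
    assume large: "\<not> norm w \<le> max (max M1 M2) 0"
    obtain z z' where z: "z \<in> UHP" "z' \<in> UHP" "\<not> eqv z z'" "J z = w" "J z' = w"
      using w unfolding doubles_def by blast
    have "norm (J z) > max M1 M2" "norm (J z') > max M1 M2" using z large by auto
    with near[OF z(1)] near[OF z(2)]
    obtain y y' where y: "y \<in> UHP" "eqv y z" "norm (qpar 1 y) < \<delta>" "y' \<in> UHP" "eqv y' z'" "norm (qpar 1 y') < \<delta>"
      by blast
    have "J y = w" "J y' = w" using J_eqv y z by metis+
    then have "P (qpar 1 y) / qpar 1 y = P (qpar 1 y') / qpar 1 y'" using J_q y by metis
    then have "inverse (P (qpar 1 y) / qpar 1 y) = inverse (P (qpar 1 y') / qpar 1 y')" by simp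
    then have "qpar 1 y = qpar 1 y'"
      using \<delta>(3) y unfolding inj_on_def by (simp add: inverse_eq_divide)
    then have "qpar 1 y' = qpar 1 y" by simp
    then obtain n where "y' = y + of_int n" unfolding qpar_1_eq_iff ..
    then have "eqv y y'" using eqv_add_int by blast
    then have "eqv z z'" using y z eqv_sym eqv_trans by meson
    then show False using z by blast
  qed
  then show ?thesis using that by blast
qed

lemma doubles_empty: "doubles = {}"
proof -
  have conn: "connected (- exceptional)"
    using path_connected_complement_countable[OF _ countable_exceptional] by (simp add: path_connected_imp_connected)
  \<comment> \<open>The exterior of \<open>doubles\<close>; the two open sets together cover the
    connected complement of the exceptional values.\<close>
  define V where "V = \<Union> {U. open U \<and> U \<inter> doubles = {}}"
  have "open V" unfolding V_def by auto
  have "- exceptional \<subseteq> doubles \<union> V"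
  proof
    fix w assume "w \<in> - exceptional"
    then show "w \<in> doubles \<union> V"
    proof (cases "w \<in> doubles")
      case False
      then obtain e where "e > 0" "ball w e \<inter> doubles = {}"
        using doubles_closed_off_exceptional[of w] \<open>w \<in> - exceptional\<close> by blast
      then have "w \<in> V" unfolding V_def by (intro UnionI[of "ball w e"]) auto
      then show ?thesis by blast
    qed auto
  qed
  moreover have "doubles \<inter> V \<inter> - exceptional = {}" unfolding V_def by blast
  ultimately have "doubles \<inter> - exceptional = {} \<or> V \<inter> - exceptional = {}"
    using connectedD[OF conn open_doubles \<open>open V\<close>] by blast
  moreover have "V \<inter> - exceptional \<noteq> {}"
  proof
    assume "V \<inter> - exceptional = {}"
    obtain M where M: "\<And>w. w \<in> doubles \<Longrightarrow> norm w \<le> M" using doubles_bounded by metis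
    \<comment> \<open>Beyond the bound \<open>M\<close> lies a whole disc without double values; it
      is uncountable, so not all of it is exceptional.\<close>
    have "ball (of_real (\<bar>M\<bar> + 1)) 1 \<inter> doubles = {}"
    proof -
      have "norm w > M" if "w \<in> ball (of_real (\<bar>M\<bar> + 1)) 1" for w :: complex
      proof -
        have "norm (of_real (\<bar>M\<bar> + 1) - w) < 1" using that by (simp add: dist_norm)
        then have "norm (of_real (\<bar>M\<bar> + 1) :: complex) - norm w < 1"
          using norm_triangle_ineq2[of "of_real (\<bar>M\<bar> + 1)" w] by linarith
        then show ?thesis by (simp only: norm_of_real)
      qed
      then show ?thesis using M by fastforce
    qed
    then have "ball (of_real (\<bar>M\<bar> + 1)) 1 \<subseteq> V" unfolding V_def by blast
    then have "ball (of_real (\<bar>M\<bar> + 1)) 1 \<subseteq> exceptional" using \<open>V \<inter> - exceptional = {}\<close> by blast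
    then show False using countable_exceptional uncountable_ball[of 1 "of_real (\<bar>M\<bar> + 1) :: complex"]
      by (auto dest: countable_subset)
  qed
  \<comment> \<open>All double values are now exceptional, and a countable open set is
    empty.\<close>
  ultimately have "countable doubles" using countable_exceptional by (auto intro: countable_subset)
  then show ?thesis using open_doubles
    by (metis countable_subset equals0I openE uncountable_ball)
qed

section \<open>Injectivity on points and cusps\<close>

lemma J_inj: "z \<in> UHP \<Longrightarrow> z' \<in> UHP \<Longrightarrow> J z = J z' \<Longrightarrow> eqv z z'"
  using doubles_empty unfolding doubles_def by blast

text \<open>By the open mapping theorem a point high up near the cusp would share its value with a
  point \<open>v\<close> of a strip around \<open>\<tau>\<close>, so that the two would lie in one
  orbit of \<open>SL2Z\<close>; but the heights in the orbit of \<open>v\<close> are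
  bounded.\<close>

lemma cusp_value_neq:
  assumes A: "A \<in> SL2Z" "A \<notin> Gamma0 N" and \<tau>: "\<tau> \<in> UHP"
  shows "J_cusp A 0 \<noteq> J \<tau>"
proof
  assume eq: "J_cusp A 0 = J \<tau>"
  define U where "U = {z. Im \<tau> / 2 < Im z \<and> Im z < 2 * Im \<tau>}"
  have "open U" unfolding U_def by (intro open_Collect_conj open_Collect_less continuous_intros)
  have UH: "U \<subseteq> UHP" using \<tau> by (auto simp: U_def in_H_iff)
  have "open (J ` U)" by (rule open_image_J[OF \<open>open U\<close> UH])
  moreover have "J_cusp A 0 \<in> J ` U" unfolding eq using \<tau> by (intro imageI) (auto simp: U_def in_H_iff)
  moreover have "isCont (J_cusp A) 0" using holo_J_cusp[OF A]
    by (meson centre_in_ball continuous_on_eq_continuous_at holomorphic_on_imp_continuous_on open_ball zero_less_one)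
  ultimately have "\<forall>\<^sub>F q in nhds 0. J_cusp A q \<in> J ` U"
    by (simp add: continuous_within eventually_nhds_conv_at topological_tendstoD)
  then obtain \<delta> where \<delta>: "\<delta> > 0" "\<And>q. norm q < \<delta> \<Longrightarrow> J_cusp A q \<in> J ` U"
    unfolding eventually_nhds_metric by (auto simp: dist_norm)
  \<comment> \<open>Above \<open>Im v\<close> and \<open>1 / Im v\<close> for all \<open>v\<close>
    in the strip, and high enough for the parameter to have norm below
    \<open>\<delta>\<close>.\<close>
  define t where "t = 1 + max (max (2 * Im \<tau>) (2 / Im \<tau>)) (- real N * ln \<delta> / (2 * pi))"
  define y where "y = Complex 0 t"
  have t: "t > 2 * Im \<tau>" "t > 2 / Im \<tau>" "t > - real N * ln \<delta> / (2 * pi)" by (auto simp: t_def)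
  have y: "y \<in> UHP" using t(1) \<tau> by (simp add: y_def in_H_iff)
  have "norm (qpar N y) < \<delta>" using norm_qpar_less[OF \<delta>(1) N, of y] t(3) by (simp add: y_def)
  then obtain v where v: "v \<in> U" "J (moebius_action A y) = J v" using \<delta>(2) J_moebius_cusp[OF A y] by force
  have vH: "v \<in> UHP" using v UH by blast
  obtain B where B: "B \<in> Gamma0 N" "moebius_action A y = moebius_action B v"
    using J_inj[OF vH moebius_in_H[OF A(1) y]] v unfolding eqv_def by auto
  have BS: "B \<in> SL2Z" using B(1) by (rule Gamma0_SL2Z)
  have "y = moebius_action (inv2 A) (moebius_action B v)" using moebius_inv2_left[OF A(1) y] B(2) by simp
  also have "\<dots> = moebius_action (inv2 A ** B) v" using A BS vH by (simp add: moebius_mult SL2Z_inv2)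
  finally have "Im y \<le> max (Im v) (1 / Im v)"
    using Im_moebius_le_max[OF SL2Z_mult[OF SL2Z_inv2[OF A(1)] BS] vH] by simp
  moreover have "Im v < t" using v t(1) by (simp add: U_def)
  moreover have "1 / Im v < t"
  proof -
    have "1 / Im v < 1 / (Im \<tau> / 2)" using v \<tau> by (intro divide_strict_left_mono) (auto simp: U_def in_H_iff intro!: mult_pos_pos)
    then show ?thesis using t(2) by simp
  qed
  ultimately show False by (simp add: y_def)
qed

text \<open>Near the two cusps there are points above height 1 with a common value. They are
  equivalent, and a modular matrix that takes one point above height 1 to another has lower left
  entry 0. The conclusion says that the cusps are equivalent.\<close>

lemma cusp_value_eq:
  assumes A: "A \<in> SL2Z" "A \<notin> Gamma0 N" and B: "B \<in> SL2Z" "B \<notin> Gamma0 N" and eq: "J_cusp A 0 = J_cusp B 0"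
  obtains C T where "C \<in> Gamma0 N" "T \<in> SL2Z" "T $ 2 $ 1 = 0" "C ** A = B ** T"
proof -
  \<comment> \<open>The norm of the parameter at height 1.\<close>
  define \<delta> where "\<delta> = exp (- (2 * pi / real N))"
  have \<delta>: "0 < \<delta>" "\<delta> < 1" using N by (auto simp: \<delta>_def)
  have Im1: "Im y > 1" if "norm (qpar N y) < \<delta>" for y
  proof -
    have "2 * pi / real N < 2 * pi * Im y / real N" using that by (simp add: norm_qpar \<delta>_def)
    then show ?thesis using N by (simp add: divide_less_cancel)
  qed
  have "open (J_cusp A ` ball 0 \<delta>)"
    by (rule open_mapping_thm[OF holo_J_cusp[OF A] _ _ _ _ J_cusp_nonconst[OF A]]) (use \<delta> in auto)
  moreover have "J_cusp B 0 \<in> J_cusp A ` ball 0 \<delta>" unfolding eq[symmetric] using \<delta> by (intro imageI) auto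
  moreover have "isCont (J_cusp B) 0" using holo_J_cusp[OF B]
    by (meson centre_in_ball continuous_on_eq_continuous_at holomorphic_on_imp_continuous_on open_ball zero_less_one)
  ultimately have ev1: "\<forall>\<^sub>F q in at 0. J_cusp B q \<in> J_cusp A ` ball 0 \<delta>"
    by (simp add: continuous_within topological_tendstoD)
  have ev2: "\<forall>\<^sub>F q in at 0. J_cusp B q \<noteq> J_cusp B 0"
  proof -
    have "\<not> (\<forall>q\<in>ball 0 1. J_cusp B q = J_cusp B 0)" using J_cusp_nonconst[OF B] by (auto simp: constant_on_def)
    then obtain \<beta> where \<beta>: "\<beta> \<in> ball 0 1" "J_cusp B \<beta> - J_cusp B 0 \<noteq> 0" by auto
    have "(\<lambda>q. J_cusp B q - J_cusp B 0) holomorphic_on ball 0 1"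
      by (intro holomorphic_intros holo_J_cusp B)
    from isolated_zeros[OF this open_ball connected_ball _ _ \<beta>, of 0]
    obtain r where r: "0 < r" "\<And>z. z \<in> ball 0 r - {0} \<Longrightarrow> J_cusp B z - J_cusp B 0 \<noteq> 0"
      by (metis (no_types, lifting) centre_in_ball diff_self zero_less_one)
    have "J_cusp B z \<noteq> J_cusp B 0" if "z \<noteq> 0" "norm z < r" for z using r(2)[of z] that by auto
    with r(1) show ?thesis unfolding eventually_at by (intro exI[of _ r]) (simp add: dist_norm)
  qed
  have ev3: "\<forall>\<^sub>F q in at (0::complex). norm q < \<delta> \<and> q \<noteq> 0"
    unfolding eventually_at using \<delta> by (intro exI[of _ \<delta>]) (auto simp: dist_norm)
  \<comment> \<open>Since the value at \<open>q'\<close> differs from the common value at 0, the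
    point \<open>q\<close> found with the same value is nonzero too.\<close>
  obtain q' where q': "J_cusp B q' \<in> J_cusp A ` ball 0 \<delta>" "J_cusp B q' \<noteq> J_cusp B 0" "norm q' < \<delta>" "q' \<noteq> 0"
    using eventually_happens[OF eventually_conj[OF ev1 eventually_conj[OF ev2 ev3]]] by auto
  then obtain q where q: "norm q < \<delta>" "J_cusp A q = J_cusp B q'" by auto
  have "q \<noteq> 0" using q q' eq by auto
  obtain y where y: "y \<in> UHP" "qpar N y = q" using qpar_surj[OF N _ \<open>q \<noteq> 0\<close>] q \<delta> by auto
  obtain y' where y': "y' \<in> UHP" "qpar N y' = q'" using qpar_surj[OF N _ q'(4)] q' \<delta> by auto
  have "J (moebius_action A y) = J (moebius_action B y')"
    using J_moebius_cusp[OF A y(1)] J_moebius_cusp[OF B y'(1)] y y' q by simp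
  then obtain C where C: "C \<in> Gamma0 N" "moebius_action B y' = moebius_action C (moebius_action A y)"
    using J_inj[OF moebius_in_H[OF A(1) y(1)] moebius_in_H[OF B(1) y'(1)]] unfolding eqv_def by blast
  have CS: "C \<in> SL2Z" using C(1) by (rule Gamma0_SL2Z)
  define T where "T = inv2 B ** (C ** A)"
  have T: "T \<in> SL2Z" unfolding T_def by (intro SL2Z_mult SL2Z_inv2 A B CS)
  have "moebius_action T y = moebius_action (inv2 B) (moebius_action B y')"
    unfolding T_def C(2) using A B CS y by (simp add: moebius_mult SL2Z_mult SL2Z_inv2)
  also have "\<dots> = y'" using B y' by (simp add: moebius_inv2_left)
  finally have Ty: "moebius_action T y = y'" .
  have "T $ 2 $ 1 = 0"
  proof (rule ccontr)
    assume "T $ 2 $ 1 \<noteq> 0"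
    then have "Im y' \<le> 1 / Im y" using Im_moebius_le[OF T y(1)] Ty by simp
    moreover have "Im y > 1" "Im y' > 1" using Im1 y y' q q' by auto
    moreover from this have "1 / Im y < 1" by simp
    ultimately show False by linarith
  qed
  moreover have "C ** A = B ** T"
    unfolding T_def using inv2_right[OF B(1)] by (simp add: matrix_mul_assoc)
  ultimately show ?thesis using that C(1) T by blast
qed

end

subsection \<open>The complementary form\<close>

lemma dvd_at_cong: "dvd_at g f z \<Longrightarrow> \<forall>\<^sub>F w in nhds z. f w = f' w \<Longrightarrow> dvd_at g f' z"
  unfolding dvd_at_def
proof (elim exE conjE, intro exI conjI)
  fix q assume "\<forall>\<^sub>F w in nhds z. f w = f' w" "\<forall>\<^sub>F w in nhds z. f w = q w * g w"
  then show "\<forall>\<^sub>F w in nhds z. f' w = q w * g w" by eventually_elim simp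
qed

lemma eventually_nonzero_at:
  assumes "f holomorphic_on S" "open S" "connected S" "b \<in> S" "f b \<noteq> 0" "z \<in> S"
  shows "\<forall>\<^sub>F w in at z. f w \<noteq> 0"
  using non_zero_neighbour_alt[OF assms(1,2,3,6,4,5)] by eventually_elim simp

lemma local_factor:
  assumes f: "f holomorphic_on S" "open S" "connected S" "b \<in> S" "f b \<noteq> 0" "z \<in> S"
  obtains n h where "h analytic_on {z}" "h z \<noteq> 0" "\<forall>\<^sub>F w in nhds z. f w = (w - z) ^ n * h w"
proof (cases "f z = 0")
  case True
  have "\<not> f constant_on S" unfolding constant_on_def using True f(4-6) by metis
  then obtain h r n where h: "0 < r" "h holomorphic_on ball z r" "\<And>w. w \<in> ball z r \<Longrightarrow> f w = (w - z) ^ n * h w"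
    "\<And>w. w \<in> ball z r \<Longrightarrow> h w \<noteq> 0"
    using holomorphic_factor_zero_nonconstant[OF f(1-3,6) True] by metis
  have "\<forall>\<^sub>F w in nhds z. f w = (w - z) ^ n * h w"
    unfolding eventually_nhds by (intro exI[of _ "ball z r"]) (use h in auto)
  moreover have "h analytic_on {z}" using h by (auto simp: analytic_at_ball)
  ultimately show ?thesis using that h(1,4) by auto
next
  case False
  then show ?thesis using that[of f 0] f holomorphic_on_imp_analytic_at by auto
qed

text \<open>If the order of \<open>f\<close> at \<open>z\<close> is less than that of \<open>g\<close>, it is at most that of \<open>deriv g\<close>.\<close>

lemma not_dvd_at_imp_dvd_at_deriv:
  assumes f: "f holomorphic_on S" "a \<in> S" "f a \<noteq> 0" and g: "g holomorphic_on S" "b \<in> S" "g b \<noteq> 0"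
    and S: "open S" "connected S" "z \<in> S" and nd: "\<not> dvd_at g f z"
  shows "dvd_at f (deriv g) z"
proof -
  obtain u \<alpha> where \<alpha>: "\<alpha> analytic_on {z}" "\<alpha> z \<noteq> 0" "\<forall>\<^sub>F w in nhds z. f w = (w - z) ^ u * \<alpha> w"
    using local_factor[OF f(1) S(1,2) f(2,3) S(3)] .
  obtain v \<beta> where \<beta>: "\<beta> analytic_on {z}" "\<beta> z \<noteq> 0" "\<forall>\<^sub>F w in nhds z. g w = (w - z) ^ v * \<beta> w"
    using local_factor[OF g(1) S(1,2) g(2,3) S(3)] .
  have nz: "\<forall>\<^sub>F w in nhds z. h w \<noteq> 0" if "h analytic_on {z}" "h z \<noteq> 0" for h :: "complex \<Rightarrow> complex"
    using analytic_at_imp_isCont[OF that(1)] that(2) unfolding eventually_nhds_conv_at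
    by (simp add: continuous_within tendsto_imp_eventually_ne)
  \<comment> \<open>Otherwise the surplus \<open>u - v\<close> of exponents yields an analytic
    quotient of \<open>f\<close> by \<open>g\<close>.\<close>
  have "u < v"
  proof (rule ccontr)
    assume "\<not> u < v"
    have "\<forall>\<^sub>F w in nhds z. f w = ((w - z) ^ (u - v) * \<alpha> w / \<beta> w) * g w"
      using \<alpha>(3) \<beta>(3) nz[OF \<beta>(1,2)]
    proof eventually_elim
      case (elim w)
      have "(w - z) ^ u = (w - z) ^ (u - v) * (w - z) ^ v"
        using \<open>\<not> u < v\<close> by (simp flip: power_add)
      with elim show ?case by simp
    qed
    moreover have "(\<lambda>w. (w - z) ^ (u - v) * \<alpha> w / \<beta> w) analytic_on {z}"
      by (intro analytic_intros \<alpha> \<beta>) (use \<beta> in auto)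
    ultimately show False using nd unfolding dvd_at_def by blast
  qed
  have ana: "\<forall>\<^sub>F w in nhds z. \<beta> analytic_on {w}"
  proof -
    obtain e where "e > 0" "\<beta> holomorphic_on ball z e" using \<beta>(1) analytic_at_ball by blast
    then show ?thesis unfolding eventually_nhds
      by (intro exI[of _ "ball z e"]) (auto intro: holomorphic_on_imp_analytic_at)
  qed
  have "\<forall>\<^sub>F w in nhds z. \<forall>\<^sub>F x in nhds w. g x = (x - z) ^ v * \<beta> x"
    using \<beta>(3) by (simp add: eventually_eventually)
  with ana have dg: "\<forall>\<^sub>F w in nhds z. deriv g w = (w - z) ^ (v - 1) * (of_nat v * \<beta> w + (w - z) * deriv \<beta> w)"
  proof eventually_elim
    case (elim w)
    have "(\<beta> has_field_derivative deriv \<beta> w) (at w)"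
      using elim(1) analytic_on_imp_differentiable_at[of \<beta> "{w}" w] by (simp add: DERIV_deriv_iff_field_differentiable)
    then have "((\<lambda>x. (x - z) ^ v * \<beta> x) has_field_derivative
        (w - z) ^ v * deriv \<beta> w + of_nat v * (w - z) ^ (v - 1) * \<beta> w) (at w)"
      by (auto intro!: derivative_eq_intros simp: algebra_simps)
    then have "deriv (\<lambda>x. (x - z) ^ v * \<beta> x) w = (w - z) ^ v * deriv \<beta> w + of_nat v * (w - z) ^ (v - 1) * \<beta> w"
      by (rule DERIV_imp_deriv)
    moreover have "deriv g w = deriv (\<lambda>x. (x - z) ^ v * \<beta> x) w" by (rule deriv_cong_ev[OF elim(2) refl])
    moreover have "(w - z) ^ v = (w - z) ^ (v - 1) * (w - z)" using \<open>u < v\<close> by (cases v) auto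
    ultimately show ?case by (simp add: algebra_simps)
  qed
  \<comment> \<open>By \<open>u < v\<close> the subtraction \<open>v - 1 - u\<close> of natural
    numbers is not cut off at 0.\<close>
  have "\<forall>\<^sub>F w in nhds z. deriv g w = ((w - z) ^ (v - 1 - u) * (of_nat v * \<beta> w + (w - z) * deriv \<beta> w) / \<alpha> w) * f w"
    using dg \<alpha>(3) nz[OF \<alpha>(1,2)]
  proof eventually_elim
    case (elim w)
    have "(w - z) ^ (v - 1) = (w - z) ^ (v - 1 - u) * (w - z) ^ u"
      using \<open>u < v\<close> by (simp flip: power_add)
    with elim show ?case by simp
  qed
  moreover have "(\<lambda>w. (w - z) ^ (v - 1 - u) * (of_nat v * \<beta> w + (w - z) * deriv \<beta> w) / \<alpha> w) analytic_on {z}"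
    by (intro analytic_intros analytic_deriv \<alpha> \<beta>) (use \<alpha> in auto)
  ultimately show ?thesis unfolding dvd_at_def by blast
qed

lemma qlaurent_unshift:
  assumes "qlaurent h 0 (\<lambda>z. F z * qpar h z powi (- m)) Q"
  shows "qlaurent h m F Q"
  unfolding qlaurent_def
proof (intro conjI ballI)
  fix z assume "z \<in> UHP"
  then have "F z * qpar h z powi (- m) = Q (qpar h z)" using assms by (simp add: qlaurent_def)
  then have "qpar h z powi m * Q (qpar h z) = F z * (qpar h z powi (- m) * qpar h z powi m)" by (simp add: mult_ac)
  then show "F z = qpar h z powi m * Q (qpar h z)" by (simp add: power_int_minus)
qed (use assms in \<open>simp add: qlaurent_def\<close>)

text \<open>\<open>F\<close> is a quotient of two functions of the parameter. Away from 0 its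
  analyticity in the parameter comes from local sections, at 0 from divisibility; the last
  conclusion gives the value at the cusp.\<close>

lemma qlaurent_quotient:
  assumes h: "h > 0" and F: "F holomorphic_on UHP" and G: "G holomorphic_on ball 0 1"
    and b: "b \<in> ball 0 1" "G b \<noteq> 0"
    and eq: "\<And>z. z \<in> UHP \<Longrightarrow> P (qpar h z) = F z * G (qpar h z)" and dv: "dvd_at G P 0"
  obtains Q where "qlaurent h 0 F Q" "\<And>q. q \<in> ball 0 1 \<Longrightarrow> P q = Q q * G q"
    "\<And>R. isCont R 0 \<Longrightarrow> \<forall>\<^sub>F q in at 0. P q = R q * G q \<Longrightarrow> Q 0 = R 0"
proof -
  have loc: "\<exists>R. R analytic_on {qpar h z} \<and> R (qpar h z) = F z \<and> (\<forall>\<^sub>F q in nhds (qpar h z). P q = R q * G q)"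
    if z: "z \<in> UHP" for z
  proof -
    obtain r l where l: "r > 0" "l holomorphic_on ball (qpar h z) r" "l (qpar h z) = z"
      "\<And>q. q \<in> ball (qpar h z) r \<Longrightarrow> l q \<in> UHP \<and> qpar h (l q) = q"
      by (rule qpar_local_section[OF h z]) (rule that, assumption+)
    have "(F \<circ> l) holomorphic_on ball (qpar h z) r"
      by (rule holomorphic_on_compose_gen[OF l(2) F]) (use l in auto)
    then have "(F \<circ> l) analytic_on {qpar h z}" using l(1) by (auto simp: analytic_at_ball)
    moreover have "\<forall>\<^sub>F q in nhds (qpar h z). P q = (F \<circ> l) q * G q"
      unfolding eventually_nhds
      by (intro exI[of _ "ball (qpar h z) r"]) (use l eq in \<open>auto, metis mem_ball\<close>)
    ultimately show ?thesis using l(3) by (intro exI[of _ "F \<circ> l"]) auto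
  qed
  have "dvd_at G P q" if q: "q \<in> ball 0 1" for q
  proof (cases "q = 0")
    case False
    then obtain z where "z \<in> UHP" "qpar h z = q" using qpar_surj[OF h q] by blast
    then show ?thesis using loc[of z] unfolding dvd_at_def by blast
  qed (use dv in simp)
  then obtain Q where Q: "Q holomorphic_on ball 0 1" "\<And>q. q \<in> ball 0 1 \<Longrightarrow> P q = Q q * G q"
    "\<And>q R. q \<in> ball 0 1 \<Longrightarrow> isCont R q \<Longrightarrow> \<forall>\<^sub>F w in at q. P w = R w * G w \<Longrightarrow> Q q = R q"
    using holomorphic_quotient[of "ball 0 1" G P] eventually_nonzero_at[OF G open_ball connected_ball b] by blast
  have "qlaurent h 0 F Q" unfolding qlaurent_def
  proof (intro conjI ballI Q(1))
    fix z assume z: "z \<in> UHP"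
    obtain R where R: "R analytic_on {qpar h z}" "R (qpar h z) = F z" "\<forall>\<^sub>F q in nhds (qpar h z). P q = R q * G q"
      using loc[OF z] by blast
    have "Q (qpar h z) = R (qpar h z)"
      by (rule Q(3)) (use R qpar_in_ball[OF h z] in \<open>auto simp: eventually_nhds_conv_at intro: analytic_at_imp_isCont\<close>)
    then show "F z = qpar h z powi 0 * Q (qpar h z)" using R by simp
  qed
  then show ?thesis using that[of Q] Q(2) Q(3)[of 0] by simp
qed

section \<open>The form of maximal order and its zeros\<close>

context hauptmodul
begin

lemma holo_J_diff: "(\<lambda>z. J z - w) holomorphic_on UHP"
  by (intro holomorphic_intros holo_J)

lemma J_diff_nonzero: obtains b where "b \<in> UHP" "J b - w \<noteq> 0"
  using J_nonconst by (auto simp: constant_on_def)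

lemma J_cusp_diff_nonzero:
  assumes "A \<in> SL2Z" "A \<notin> Gamma0 N"
  obtains b where "b \<in> ball 0 1" "J_cusp A b - w \<noteq> 0"
  using J_cusp_nonconst[OF assms] unfolding constant_on_def by (metis right_minus_eq)

lemma J_diff_eventually: "z \<in> UHP \<Longrightarrow> \<forall>\<^sub>F u in at z. J u - w \<noteq> 0"
  using eventually_nonzero_at[OF holo_J_diff open_H connected_H] J_diff_nonzero by metis

end

text \<open>\<open>f\<close> attains the maximal order \<open>n0\<close>, and maximality prevents
  its zeros from containing a full fibre of \<open>J\<close>.\<close>

locale top_form = hauptmodul +
  fixes k n0 :: int and f U :: "complex \<Rightarrow> complex"
  assumes f: "f \<in> M_sharp N k" and max: "max_order (M_sharp N k) n0" and qf: "qlaurent 1 n0 f U" and U0: "U 0 \<noteq> 0"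
begin

lemma holo_f: "f holomorphic_on UHP"
  using f by (simp add: M_sharp_iff[OF N])

lemma f_inv: "A \<in> Gamma0 N \<Longrightarrow> z \<in> UHP \<Longrightarrow> slash k A f z = f z"
  using f by (simp add: M_sharp_iff[OF N])

lemma f_cusp: assumes "A \<in> SL2Z" "A \<notin> Gamma0 N" obtains Q where "qlaurent N 0 (slash k A f) Q"
  using f assms unfolding M_sharp_iff[OF N] by blast

lemma f_nonzero: obtains b where "b \<in> UHP" "f b \<noteq> 0"
proof (rule ccontr)
  assume no: "\<not> thesis"
  then have z: "f z = 0" if "z \<in> UHP" for z using that \<open>\<And>b. b \<in> UHP \<Longrightarrow> f b \<noteq> 0 \<Longrightarrow> thesis\<close> by blast
  have "qlaurent 1 n0 f (\<lambda>_. 0)" using z by (simp add: qlaurent_def)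
  from qlaurent_unique[OF _ qf this, of 0] show False using U0 by simp
qed

lemma f_cusp_nonzero:
  assumes A: "A \<in> SL2Z" "A \<notin> Gamma0 N" and Q: "qlaurent N 0 (slash k A f) Q"
  obtains b where "b \<in> ball 0 1" "Q b \<noteq> 0"
proof -
  obtain b where b: "b \<in> UHP" "f b \<noteq> 0" using f_nonzero .
  define y where "y = moebius_action (inv2 A) b"
  have y: "y \<in> UHP" unfolding y_def using A b by (intro moebius_in_H SL2Z_inv2)
  have "slash k A f y \<noteq> 0" using aut_nz[OF A(1) y] A b
    by (simp add: slash_eq y_def moebius_inv2_right)
  then have "Q (qpar N y) \<noteq> 0" using Q y by (simp add: qlaurent_def)
  then show ?thesis using that qpar_in_ball[OF N y] by blast
qed

text \<open>If \<open>J - w\<close> divided \<open>f\<close> everywhere but at \<open>\<infinity>\<close>, the quotient would have order \<open>n0 + 1\<close> there.\<close>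

lemma no_common_divisor:
  assumes dH: "\<And>z. z \<in> UHP \<Longrightarrow> dvd_at (\<lambda>z. J z - w) f z"
    and dC: "\<And>A Q. A \<in> SL2Z \<Longrightarrow> A \<notin> Gamma0 N \<Longrightarrow> qlaurent N 0 (slash k A f) Q \<Longrightarrow> dvd_at (\<lambda>q. J_cusp A q - w) Q 0"
  shows False
proof -
  obtain L where L: "L holomorphic_on UHP" "\<And>z. z \<in> UHP \<Longrightarrow> f z = L z * (J z - w)"
    "\<And>z q. z \<in> UHP \<Longrightarrow> isCont q z \<Longrightarrow> \<forall>\<^sub>F u in at z. f u = q u * (J u - w) \<Longrightarrow> L z = q z"
    using holomorphic_quotient[OF open_H dH J_diff_eventually] by blast
  have f_slash: "slash k A f z = slash k A L z * (J (moebius_action A z) - w)" if "A \<in> SL2Z" "z \<in> UHP" for A z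
    using L(2)[OF moebius_in_H[OF that]] by (simp add: slash_eq)
  \<comment> \<open>As \<open>f\<close> and \<open>J - w\<close> are invariant in weights
    \<open>k\<close> and 0, \<open>slash k A L\<close> is again a quotient of the two, and the
    quotient is unique.\<close>
  have inv: "slash k A L z = L z" if A: "A \<in> Gamma0 N" and z: "z \<in> UHP" for A z
  proof (rule L(3)[OF z, symmetric])
    note AS = Gamma0_SL2Z[OF A]
    show "isCont (slash k A L) z"
      using holomorphic_slash[OF AS L(1)] z open_H
      by (meson continuous_on_eq_continuous_at holomorphic_on_imp_continuous_on)
    have "\<forall>\<^sub>F u in at z. u \<in> UHP" using z open_H by (simp add: eventually_at_in_open')
    then show "\<forall>\<^sub>F u in at z. f u = slash k A L u * (J u - w)"
    proof eventually_elim
      case (elim u)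
      then show ?case using f_slash[OF AS elim] f_inv[OF A elim] J_moebius[OF A elim] by simp
    qed
  qed
  have cusp: "\<exists>Q. qlaurent N 0 (slash k A L) Q" if A: "A \<in> SL2Z" "A \<notin> Gamma0 N" for A
  proof -
    obtain Qf where Qf: "qlaurent N 0 (slash k A f) Qf" using f_cusp[OF A] .
    obtain b where b: "b \<in> ball 0 1" "J_cusp A b - w \<noteq> 0" using J_cusp_diff_nonzero[OF A] .
    have "(\<lambda>q. J_cusp A q - w) holomorphic_on ball 0 1" by (intro holomorphic_intros holo_J_cusp A)
    moreover have "Qf (qpar N z) = slash k A L z * (J_cusp A (qpar N z) - w)" if "z \<in> UHP" for z
      using Qf f_slash[OF A(1) that] J_moebius_cusp[OF A that] that by (simp add: qlaurent_def)
    ultimately show ?thesis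
      using qlaurent_quotient[OF N holomorphic_slash[OF A(1) L(1)] _ b _ dC[OF A Qf]] by metis
  qed
  \<comment> \<open>Division by \<open>J - w\<close>, which is \<open>(P q - w * q) / q\<close> in
    the parameter, raises the order at \<open>\<infinity>\<close> by one, because
    \<open>P q - w * q\<close> does not vanish at 0.\<close>
  define F where "F = (\<lambda>z. L z * qpar 1 z powi (- (n0 + 1)))"
  have hF: "F holomorphic_on UHP" unfolding F_def by (intro holomorphic_intros L) auto
  have hG: "(\<lambda>q. P q - w * q) holomorphic_on ball 0 1" by (intro holomorphic_intros holo_P)
  have eq: "U (qpar 1 z) = F z * (P (qpar 1 z) - w * qpar 1 z)" if z: "z \<in> UHP" for z
  proof -
    have "qpar 1 z powi n0 * U (qpar 1 z) = L z * ((P (qpar 1 z) - w * qpar 1 z) / qpar 1 z)"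
      using qf L(2)[OF z] J_q[OF z] z by (simp add: qlaurent_def diff_divide_distrib)
    then show ?thesis by (simp add: F_def power_int_add power_int_minus power_int_diff field_simps)
  qed
  have dv: "dvd_at (\<lambda>q. P q - w * q) U 0"
    by (rule dvd_at_nonzero) (use P0 hG qf in \<open>auto simp: qlaurent_def analytic_at_ball intro!: exI[of _ 1]\<close>)
  have b: "(0::complex) \<in> ball 0 1" "P 0 - w * 0 \<noteq> 0" using P0 by auto
  obtain Q where Q: "qlaurent 1 0 F Q" "\<And>q. q \<in> ball 0 1 \<Longrightarrow> U q = Q q * (P q - w * q)"
    by (rule qlaurent_quotient[OF zero_less_one hF hG b eq dv]) (assumption | rule that)+
  have qL: "qlaurent 1 (n0 + 1) L Q"
    using Q(1) unfolding F_def by (rule qlaurent_unshift)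
  have "Q 0 \<noteq> 0" using Q(2)[of 0] U0 by auto
  then have "order_at_infinity L (n0 + 1)" using qL order_at_infinity_iff by blast
  moreover have "L \<in> M_sharp N k" by (rule M_sharpI[OF N L(1) inv qL cusp])
  ultimately show False using max unfolding max_order_def by fastforce
qed

text \<open>The local quotient is carried along: at the image point it is \<open>q\<close> composed
  with the inverse map, times the automorphy factor of \<open>f\<close>.\<close>

lemma dvd_at_transport:
  assumes A: "A \<in> Gamma0 N" and z: "z \<in> UHP" and dv: "dvd_at (\<lambda>z. J z - w) f z"
  shows "dvd_at (\<lambda>z. J z - w) f (moebius_action A z)"
proof -
  obtain q where q: "q analytic_on {z}" "\<forall>\<^sub>F u in nhds z. f u = q u * (J u - w)"
    using dv unfolding dvd_at_def by blast
  note AS = Gamma0_SL2Z[OF A]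
  have Az: "moebius_action A z \<in> UHP" by (rule moebius_in_H[OF AS z])
  note BS = SL2Z_inv2[OF AS] and B = Gamma0_inv2[OF A]
  let ?B = "moebius_action (inv2 A)"
  define q' where "q' = (\<lambda>u. aut (inv2 A) u powi (-k) * q (?B u))"
  have BAz: "?B (moebius_action A z) = z" by (rule moebius_inv2_left[OF AS z])
  have anB: "?B analytic_on {moebius_action A z}" "aut (inv2 A) analytic_on {moebius_action A z}"
    using holomorphic_on_imp_analytic_at[OF holomorphic_moebius[OF BS] open_H Az]
      holomorphic_on_imp_analytic_at[OF holomorphic_aut open_H Az] by auto
  have "(q \<circ> ?B) analytic_on {moebius_action A z}"
    by (rule analytic_on_compose[OF anB(1)]) (simp add: BAz q)
  then have "q' analytic_on {moebius_action A z}"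
    unfolding q'_def o_def by (intro analytic_intros anB) (use aut_nz[OF BS Az] in auto)
  moreover have "\<forall>\<^sub>F u in nhds (moebius_action A z). f u = q' u * (J u - w)"
  proof -
    have "filterlim ?B (nhds (?B (moebius_action A z))) (nhds (moebius_action A z))"
      using analytic_at_imp_isCont[OF anB(1)] unfolding isCont_def tendsto_at_iff_tendsto_nhds .
    then have "filterlim ?B (nhds z) (nhds (moebius_action A z))" by (simp only: BAz)
    then have "\<forall>\<^sub>F u in nhds (moebius_action A z). f (?B u) = q (?B u) * (J (?B u) - w)"
      using q(2) by (rule eventually_compose_filterlim[rotated])
    moreover have "\<forall>\<^sub>F u in nhds (moebius_action A z). u \<in> UHP" using Az open_H by (rule eventually_nhds_in_open[rotated])
    ultimately show ?thesis
    proof eventually_elim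
      case (elim u)
      have "f u = aut (inv2 A) u powi (-k) * f (?B u)" using f_inv[OF B elim(2)] by (simp add: slash_eq)
      then show ?case using elim J_moebius[OF B elim(2)] by (simp add: q'_def)
    qed
  qed
  ultimately show ?thesis unfolding dvd_at_def by blast
qed

text \<open>By injectivity the fibre through \<open>z0\<close> is a single orbit, and no cusp other
  than \<open>\<infinity>\<close> has the value \<open>J z0\<close>. If \<open>J - J z0\<close>
  divided \<open>f\<close> at \<open>z0\<close>, it would divide \<open>f\<close> everywhere off
  \<open>\<infinity>\<close>, against \<open>no_common_divisor\<close>; hence the order of
  \<open>f\<close> is smaller, and at most that of the derivative.\<close>

lemma dvd_at_deriv_J:
  assumes z0: "z0 \<in> UHP" shows "dvd_at f (deriv J) z0"
proof -
  have "\<not> dvd_at (\<lambda>z. J z - J z0) f z0"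
  proof
    assume dv: "dvd_at (\<lambda>z. J z - J z0) f z0"
    show False
    proof (rule no_common_divisor[of "J z0"])
      fix z assume z: "z \<in> UHP"
      show "dvd_at (\<lambda>z. J z - J z0) f z"
      proof (cases "J z = J z0")
        case True
        then obtain A where "A \<in> Gamma0 N" "z = moebius_action A z0"
          using J_inj[OF z0 z] unfolding eqv_def by auto
        then show ?thesis using dvd_at_transport[OF _ z0 dv] by blast
      next
        case False
        then show ?thesis
          by (intro dvd_at_nonzero holomorphic_on_imp_analytic_at[OF _ open_H z] holo_f holo_J_diff) auto
      qed
    next
      fix A Q assume A: "A \<in> SL2Z" "A \<notin> Gamma0 N" "qlaurent N 0 (slash k A f) Q"
      have "(\<lambda>q. J_cusp A q - J z0) holomorphic_on ball 0 1" by (intro holomorphic_intros holo_J_cusp A)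
      then show "dvd_at (\<lambda>q. J_cusp A q - J z0) Q 0"
        using A cusp_value_neq[OF A(1,2) z0]
        by (intro dvd_at_nonzero) (auto simp: qlaurent_def intro: holomorphic_on_imp_analytic_at[of _ "ball 0 1"])
    qed
  qed
  moreover obtain a b where "a \<in> UHP" "f a \<noteq> 0" "b \<in> UHP" "J b - J z0 \<noteq> 0"
    using f_nonzero J_diff_nonzero by metis
  ultimately have "dvd_at f (deriv (\<lambda>z. J z - J z0)) z0"
    using not_dvd_at_imp_dvd_at_deriv[OF holo_f _ _ holo_J_diff _ _ open_H connected_H z0] by blast
  moreover have "\<forall>\<^sub>F z in nhds z0. deriv (\<lambda>z. J z - J z0) z = deriv J z"
    using eventually_nhds_in_open[OF open_H z0]
  proof eventually_elim
    case (elim z)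
    have "(J has_field_derivative deriv J z) (at z)" by (rule holomorphic_derivI[OF holo_J open_H elim])
    then have "((\<lambda>z. J z - J z0) has_field_derivative deriv J z) (at z)" by (auto intro!: derivative_eq_intros)
    then show ?case by (rule DERIV_imp_deriv)
  qed
  ultimately show ?thesis by (rule dvd_at_cong)
qed

text \<open>The same argument at a cusp: its value \<open>c\<close> is not taken in the half-plane,
  and among the cusps other than \<open>\<infinity>\<close> only at equivalent ones. Between these
  the expansions differ by a rotation of the parameter and a constant factor.\<close>

lemma cusp_dvd_at_deriv:
  assumes A: "A \<in> SL2Z" "A \<notin> Gamma0 N" and QA: "qlaurent N 0 (slash k A f) QA"
  shows "dvd_at QA (deriv (J_cusp A)) 0"
proof -
  define c where "c = J_cusp A 0"
  have hP: "(\<lambda>q. J_cusp A q - c) holomorphic_on ball 0 1" by (intro holomorphic_intros holo_J_cusp A)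
  have hQA: "QA holomorphic_on ball 0 1" using QA by (simp add: qlaurent_def)
  have "\<not> dvd_at (\<lambda>q. J_cusp A q - c) QA 0"
  proof
    assume dv: "dvd_at (\<lambda>q. J_cusp A q - c) QA 0"
    show False
    proof (rule no_common_divisor[of c])
      fix z assume z: "z \<in> UHP"
      show "dvd_at (\<lambda>z. J z - c) f z"
        using cusp_value_neq[OF A z] z
        by (intro dvd_at_nonzero holomorphic_on_imp_analytic_at[OF _ open_H z] holo_f holo_J_diff) (auto simp: c_def)
    next
      fix B QB assume B: "B \<in> SL2Z" "B \<notin> Gamma0 N" and QB: "qlaurent N 0 (slash k B f) QB"
      have hPB: "(\<lambda>q. J_cusp B q - c) holomorphic_on ball 0 1" by (intro holomorphic_intros holo_J_cusp B)
      have hQB: "QB holomorphic_on ball 0 1" using QB by (simp add: qlaurent_def)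
      show "dvd_at (\<lambda>q. J_cusp B q - c) QB 0"
      proof (cases "J_cusp B 0 = c")
        case False
        then show ?thesis
          by (intro dvd_at_nonzero holomorphic_on_imp_analytic_at[OF hPB open_ball]
              holomorphic_on_imp_analytic_at[OF hQB open_ball]) auto
      next
        case True
        then obtain C T where C: "C \<in> Gamma0 N" and T: "T \<in> SL2Z" "T $ 2 $ 1 = 0" and CA: "C ** A = B ** T"
          using cusp_value_eq[OF A B] by (auto simp: c_def)
        note CS = Gamma0_SL2Z[OF C]
        \<comment> \<open>The lower left entry of \<open>T\<close> is 0, so its automorphy factor is
          constant.\<close>
        define d where "d = of_int (T $ 2 $ 2) powi (-k) * (1 :: complex)"
        have "T $ 1 $ 1 * T $ 2 $ 2 = 1" using T by (simp add: SL2Z_iff)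
        then have T22: "T $ 2 $ 2 \<noteq> 0" by auto
        then have d: "d \<noteq> 0" by (simp add: d_def)
        define x where "x = of_int (T $ 1 $ 2) / (of_int (T $ 2 $ 2) :: complex)"
        have Tz: "moebius_action T z = z + x" for z
        proof -
          have "of_int (T $ 1 $ 1) * of_int (T $ 2 $ 2) = (1 :: complex)"
            using SL2Z_of_int[OF T(1), where ?'a = complex] T(2) by simp
          moreover have "T $ 1 $ 1 = T $ 2 $ 2"
            using \<open>T $ 1 $ 1 * T $ 2 $ 2 = 1\<close> by (auto simp: zmult_eq_1_iff)
          ultimately show ?thesis using T T22 by (simp add: moebius_action_def x_def field_simps)
        qed
        have x: "Im x = 0" by (simp add: x_def)
        \<comment> \<open>Translation by the real number \<open>x\<close> multiplies the parameter
          by \<open>\<zeta>\<close>, of norm 1, so the unit disc is preserved.\<close>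
        define \<zeta> where "\<zeta> = qpar N x"
        have \<zeta>: "norm \<zeta> = 1" "\<zeta> \<noteq> 0" by (simp_all add: \<zeta>_def norm_qpar x)
        have q_add: "qpar N (z + x) = \<zeta> * qpar N z" for z
          using N by (simp add: \<zeta>_def qpar_def ring_distribs add_divide_distrib exp_add)
        have slash_A: "slash k A f z = d * slash k B f (z + x)" if z: "z \<in> UHP" for z
        proof -
          have "slash k (C ** A) f z = slash k A (slash k C f) z" using A CS z by (simp add: slash_mult)
          also have "\<dots> = slash k A f z" by (rule slash_cong) (use A z f_inv C in auto)
          finally have "slash k A f z = slash k (B ** T) f z" unfolding CA by simp
          also have "\<dots> = slash k T (slash k B f) z" using B T z by (simp add: slash_mult)
          finally show ?thesis by (simp add: slash_eq[of k T] aut_def T d_def Tz)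
        qed
        have zx: "z + x \<in> UHP" if "z \<in> UHP" for z using that x by (simp add: in_H_iff)
        have J_A: "J (moebius_action A z) = J (moebius_action B (z + x))" if z: "z \<in> UHP" for z
        proof -
          have "J (moebius_action (C ** A) z) = J (moebius_action A z)"
            using A CS C z by (simp add: moebius_mult J_moebius moebius_in_H)
          then show ?thesis unfolding CA using B T z by (simp add: moebius_mult Tz)
        qed
        have rot: "(\<lambda>q. g (\<zeta> * q)) holomorphic_on ball 0 1" if "g holomorphic_on ball 0 1" for g
        proof -
          have "(g \<circ> (\<lambda>q. \<zeta> * q)) holomorphic_on ball 0 1"
            by (rule holomorphic_on_compose_gen[OF _ that]) (use \<zeta> in \<open>auto simp: norm_mult intro!: holomorphic_intros\<close>)
          then show ?thesis by (simp add: o_def)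
        qed
        have "qlaurent N 0 (slash k A f) (\<lambda>q. d * QB (\<zeta> * q))"
          unfolding qlaurent_def using rot[OF hQB] slash_A QB zx
          by (auto simp: qlaurent_def q_add intro!: holomorphic_intros)
        from qlaurent_unique[OF N QA this] have QA_QB: "\<And>q. q \<in> ball 0 1 \<Longrightarrow> QA q = d * QB (\<zeta> * q)" .
        have "qlaurent N 0 (slash 0 A J) (\<lambda>q. J_cusp B (\<zeta> * q))"
          unfolding qlaurent_def using rot[OF holo_J_cusp[OF B]] J_A J_moebius_cusp[OF B zx] by (auto simp: slash_0 q_add)
        from qlaurent_unique[OF N J_cusp[OF A] this] have PA_PB: "\<And>q. q \<in> ball 0 1 \<Longrightarrow> J_cusp A q = J_cusp B (\<zeta> * q)" .
        obtain R where R: "R analytic_on {0}" "\<forall>\<^sub>F q in nhds 0. QA q = R q * (J_cusp A q - c)"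
          using dv unfolding dvd_at_def by blast
        \<comment> \<open>The quotient at the cusp of \<open>A\<close>, rotated back and freed of
          the factor \<open>d\<close>, is a quotient at the cusp of \<open>B\<close>.\<close>
        define S where "S = (\<lambda>q. R (q / \<zeta>) / d)"
        have "(R \<circ> (\<lambda>q. q / \<zeta>)) analytic_on {0}"
          by (rule analytic_on_compose) (use R \<zeta> in \<open>auto intro!: analytic_intros\<close>)
        then have "S analytic_on {0}" unfolding S_def o_def by (intro analytic_intros) (use d in auto)
        moreover have "\<forall>\<^sub>F q in nhds 0. QB q = S q * (J_cusp B q - c)"
        proof -
          have "filterlim (\<lambda>q. q / \<zeta>) (nhds 0) (nhds 0)"
          proof -
            have "isCont (\<lambda>q. q / \<zeta>) 0" using \<zeta> by (intro continuous_intros) auto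
            then show ?thesis using tendsto_at_iff_tendsto_nhds[of "\<lambda>q. q / \<zeta>" 0] by (simp add: isCont_def)
          qed
          then have "\<forall>\<^sub>F q in nhds 0. QA (q / \<zeta>) = R (q / \<zeta>) * (J_cusp A (q / \<zeta>) - c)"
            using R(2) by (rule eventually_compose_filterlim[rotated])
          moreover have "\<forall>\<^sub>F q in nhds 0. q \<in> ball (0::complex) 1" by (rule eventually_nhds_in_open) auto
          ultimately show ?thesis
          proof eventually_elim
            case (elim q)
            have "q / \<zeta> \<in> ball 0 1" using elim \<zeta> by (simp add: norm_divide)
            then have "d * QB q = R (q / \<zeta>) * (J_cusp B q - c)" using elim QA_QB PA_PB \<zeta> by simp
            then show ?case using d by (simp add: S_def field_simps)
          qed
        qed
        ultimately show ?thesis unfolding dvd_at_def by blast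
      qed
    qed
  qed
  moreover obtain a b where "a \<in> ball 0 1" "QA a \<noteq> 0" "b \<in> ball 0 1" "J_cusp A b - c \<noteq> 0"
    using f_cusp_nonzero[OF A QA] J_cusp_diff_nonzero[OF A] by metis
  ultimately have "dvd_at QA (deriv (\<lambda>q. J_cusp A q - c)) 0"
    using not_dvd_at_imp_dvd_at_deriv[OF hQA _ _ hP _ _ open_ball connected_ball] by auto
  moreover have "\<forall>\<^sub>F q in nhds 0. deriv (\<lambda>q. J_cusp A q - c) q = deriv (J_cusp A) q"
  proof (rule eventually_mono[OF eventually_nhds_in_open[OF open_ball]])
    fix q assume q: "q \<in> ball (0::complex) 1"
    have "(J_cusp A has_field_derivative deriv (J_cusp A) q) (at q)" by (rule holomorphic_derivI[OF holo_J_cusp[OF A] open_ball q])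
    then have "((\<lambda>q. J_cusp A q - c) has_field_derivative deriv (J_cusp A) q) (at q)" by (auto intro!: derivative_eq_intros)
    then show "deriv (\<lambda>q. J_cusp A q - c) q = deriv (J_cusp A) q" by (rule DERIV_imp_deriv)
  qed simp
  ultimately show ?thesis by (rule dvd_at_cong)
qed

text \<open>The form is \<open>deriv J / f\<close>. Its order at \<open>\<infinity>\<close> is that
  of \<open>deriv J\<close>, which is -1, minus \<open>n0\<close>; at the other cusps
  differentiation in \<open>z\<close> brings in a factor \<open>q\<close>, so it vanishes
  there.\<close>

lemma complementary_form:
  obtains E where "E \<in> S_sharp N (2 - k)" "order_at_infinity E (- n0 - 1)"
proof -
  obtain a where a: "a \<in> UHP" "f a \<noteq> 0" using f_nonzero .
  note f_ev = eventually_nonzero_at[OF holo_f open_H connected_H a]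
  obtain E where E: "E holomorphic_on UHP" "\<And>z. z \<in> UHP \<Longrightarrow> deriv J z = E z * f z"
    "\<And>z q. z \<in> UHP \<Longrightarrow> isCont q z \<Longrightarrow> \<forall>\<^sub>F u in at z. deriv J u = q u * f u \<Longrightarrow> E z = q z"
    using holomorphic_quotient[OF open_H dvd_at_deriv_J f_ev] by blast
  have dJ_slash: "deriv (\<lambda>z. J (moebius_action A z)) z = slash (2 - k) A E z * slash k A f z"
    if A: "A \<in> SL2Z" and z: "z \<in> UHP" for A z
  proof -
    have "slash 2 A (deriv J) z = slash (2 - k + k) A (\<lambda>z. E z * f z) z"
      using E(2) A z by (simp add: slash_cong[of A "deriv J"])
    then show ?thesis unfolding slash_times[OF A z] slash_deriv[OF A holo_J z] .
  qed
  have inv: "slash (2 - k) A E z = E z" if A: "A \<in> Gamma0 N" and z: "z \<in> UHP" for A z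
  proof (rule E(3)[OF z, symmetric])
    note AS = Gamma0_SL2Z[OF A]
    show "isCont (slash (2 - k) A E) z"
      using holomorphic_slash[OF AS E(1)] z open_H
      by (meson continuous_on_eq_continuous_at holomorphic_on_imp_continuous_on)
    have "\<forall>\<^sub>F u in at z. u \<in> UHP" using z open_H by (simp add: eventually_at_in_open')
    then show "\<forall>\<^sub>F u in at z. deriv J u = slash (2 - k) A E u * f u"
    proof eventually_elim
      case (elim u)
      have "deriv (\<lambda>z. J (moebius_action A z)) u = deriv J u"
        by (rule deriv_cong_ev) (use J_moebius[OF A] eventually_nhds_in_open[OF open_H elim] in
          \<open>auto elim: eventually_mono\<close>)
      then show ?case using dJ_slash[OF AS elim] f_inv[OF A elim] by simp
    qed
  qed
  have cusp: "\<exists>Q. qlaurent N 0 (slash (2 - k) A E) Q \<and> Q 0 = 0" if A: "A \<in> SL2Z" "A \<notin> Gamma0 N" for A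
  proof -
    obtain QA where QA: "qlaurent N 0 (slash k A f) QA" using f_cusp[OF A] .
    obtain b where b: "b \<in> ball 0 1" "QA b \<noteq> 0" using f_cusp_nonzero[OF A QA] .
    have hQA: "QA holomorphic_on ball 0 1" using QA by (simp add: qlaurent_def)
    \<comment> \<open>The derivative in \<open>z\<close> at the cusp, written in the parameter; the
      factor \<open>q\<close> comes from the chain rule.\<close>
    define D where "D = (\<lambda>q. 2 * of_real pi * \<i> / of_nat N * q * deriv (J_cusp A) q)"
    have eq: "D (qpar N z) = slash (2 - k) A E z * QA (qpar N z)" if z: "z \<in> UHP" for z
    proof -
      have "(J_cusp A has_field_derivative deriv (J_cusp A) (qpar N z)) (at (qpar N z))"
        by (rule holomorphic_derivI[OF holo_J_cusp[OF A] open_ball qpar_in_ball[OF N z]])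
      from DERIV_chain2[OF this qpar_has_deriv[of N z UNIV]]
      have "deriv (\<lambda>z. J_cusp A (qpar N z)) z = D (qpar N z)"
        by (auto simp: D_def dest!: DERIV_imp_deriv)
      moreover have "deriv (\<lambda>z. J (moebius_action A z)) z = deriv (\<lambda>z. J_cusp A (qpar N z)) z"
        by (rule deriv_cong_ev) (use J_moebius_cusp[OF A] eventually_nhds_in_open[OF open_H z] in
          \<open>auto elim: eventually_mono\<close>)
      moreover have "slash k A f z = QA (qpar N z)" using QA z by (simp add: qlaurent_def)
      ultimately show ?thesis using dJ_slash[OF A(1) z] by simp
    qed
    obtain R where R: "R analytic_on {0}" "\<forall>\<^sub>F q in nhds 0. deriv (J_cusp A) q = R q * QA q"
      using cusp_dvd_at_deriv[OF A QA] unfolding dvd_at_def by blast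
    define R' where "R' = (\<lambda>q. 2 * of_real pi * \<i> / of_nat N * q * R q)"
    have R': "R' analytic_on {0}" unfolding R'_def by (intro analytic_intros R) (use N in auto)
    have ev: "\<forall>\<^sub>F q in nhds 0. D q = R' q * QA q"
      using R(2) by eventually_elim (simp add: D_def R'_def)
    then have dvA: "dvd_at QA D 0" using R' unfolding dvd_at_def by blast
    obtain Q where Q: "qlaurent N 0 (slash (2 - k) A E) Q"
      "\<And>R. isCont R 0 \<Longrightarrow> \<forall>\<^sub>F q in at 0. D q = R q * QA q \<Longrightarrow> Q 0 = R 0"
      by (rule qlaurent_quotient[OF N holomorphic_slash[OF A(1) E(1)] hQA b eq dvA]) (assumption | rule that)+
    from Q(2)[OF analytic_at_imp_isCont[OF R']] ev have "Q 0 = R' 0"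
      by (simp add: eventually_nhds_conv_at)
    with Q(1) show ?thesis by (auto simp: R'_def)
  qed
  define F where "F = (\<lambda>z. E z * qpar 1 z powi (n0 + 1))"
  \<comment> \<open>\<open>D q / q\<close> is the derivative of \<open>P q / q\<close> in
    \<open>z\<close>, and \<open>D 0\<close> is a nonzero multiple of \<open>P 0\<close>.\<close>
  define D where "D = (\<lambda>q. 2 * of_real pi * \<i> * (q * deriv P q - P q))"
  have hU: "U holomorphic_on ball 0 1" using qf by (simp add: qlaurent_def)
  have hD: "D holomorphic_on ball 0 1" unfolding D_def by (intro holomorphic_intros holo_P) auto
  have hF: "F holomorphic_on UHP" unfolding F_def by (intro holomorphic_intros E) auto
  have eq: "D (qpar 1 z) = F z * U (qpar 1 z)" if z: "z \<in> UHP" for z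
  proof -
    have q': "(qpar 1 has_field_derivative 2 * of_real pi * \<i> * qpar 1 z) (at z)"
      using qpar_has_deriv[of 1 z UNIV] by simp
    have "(P has_field_derivative deriv P (qpar 1 z)) (at (qpar 1 z))"
      by (rule holomorphic_derivI[OF holo_P open_ball qpar_in_ball[OF _ z]]) simp
    from DERIV_chain2[OF this q']
    have dP: "((\<lambda>z. P (qpar 1 z)) has_field_derivative deriv P (qpar 1 z) * (2 * of_real pi * \<i> * qpar 1 z)) (at z)" .
    have "((\<lambda>z. P (qpar 1 z) / qpar 1 z) has_field_derivative D (qpar 1 z) / qpar 1 z) (at z)"
      by (rule DERIV_cong[OF DERIV_divide[OF dP q' qpar_nz]]) (simp add: D_def field_simps del: One_nat_def)
    moreover have "deriv J z = deriv (\<lambda>z. P (qpar 1 z) / qpar 1 z) z"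
      by (rule deriv_cong_ev) (use J_q eventually_nhds_in_open[OF open_H z] in \<open>auto elim: eventually_mono\<close>)
    ultimately have "D (qpar 1 z) / qpar 1 z = E z * (qpar 1 z powi n0 * U (qpar 1 z))"
      using E(2)[OF z] qf z by (simp add: qlaurent_def DERIV_imp_deriv del: One_nat_def)
    then show ?thesis by (simp add: F_def power_int_add field_simps del: One_nat_def)
  qed
  have dv: "dvd_at U D 0"
    by (intro dvd_at_nonzero holomorphic_on_imp_analytic_at[OF hU open_ball]
        holomorphic_on_imp_analytic_at[OF hD open_ball] U0) auto
  obtain Q where Q: "qlaurent 1 0 F Q" "\<And>q. q \<in> ball 0 1 \<Longrightarrow> D q = Q q * U q"
    by (rule qlaurent_quotient[OF zero_less_one hF hU _ U0 eq dv]) (simp, (assumption | rule that)+)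
  have qE: "qlaurent 1 (- n0 - 1) E Q"
    using qlaurent_unshift[of 1 E "- n0 - 1" Q] Q(1) by (simp add: F_def add.commute)
  have "Q 0 \<noteq> 0" using Q(2)[of 0] P0 by (auto simp: D_def)
  then have "order_at_infinity E (- n0 - 1)" using qE order_at_infinity_iff by blast
  moreover have "E \<in> S_sharp N (2 - k)"
    unfolding S_sharp_iff[OF N]
  proof (intro conjI ballI)
    show "E \<in> M_sharp N (2 - k)" by (rule M_sharpI[OF N E(1) inv qE]) (use cusp in blast)+
    show "\<exists>Q. qlaurent N 0 (slash (2 - k) A E) Q \<and> Q 0 = 0" if "A \<in> SL2Z - Gamma0 N" for A
      using cusp that by blast
  qed
  ultimately show ?thesis using that by blast
qed

end

subsection \<open>The generating function\<close>

text \<open>The maximal order inside \<open>reduced_form\<close> is unique, so it is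
  \<open>n\<close>; below \<open>- m\<close> the coefficients vanish because
  \<open>- m \<le> n\<close>.\<close>

lemma reduced_form_qlaurent:
  assumes "reduced_form V m F" "max_order V n"
  obtains W where "qlaurent 1 (- m) F W" "\<And>i. int i \<le> n + m \<Longrightarrow> tcoeff W i = (if i = 0 then 1 else 0)"
proof -
  obtain n' a where a: "max_order V n'" "m \<ge> - n'" "q_expansion 1 F a" "\<And>l. l \<le> n' \<Longrightarrow> a l = (if l = - m then 1 else 0)"
    using assms(1) unfolding reduced_form_def by blast
  have [simp]: "n' = n" using max_order_unique a(1) assms(2) by blast
  have z: "a l = 0" if "l < - m" for l using a(2) a(4)[of l] that by simp
  obtain W where W: "qlaurent 1 (- m) F W" "\<And>i. tcoeff W i = a (- m + int i)"
    by (rule q_expansion_imp_qlaurent[OF zero_less_one a(3) z]) (assumption | rule that)+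
  have "tcoeff W i = (if i = 0 then 1 else 0)" if "int i \<le> n + m" for i
    using W(2)[of i] a(4)[of "- m + int i"] that by auto
  with W(1) show ?thesis using that by blast
qed

context hauptmodul
begin

text \<open>\<open>F j\<close> stands for the basis form of index \<open>j - n0\<close>. Up to
  exponent \<open>n0\<close> the coefficients of \<open>J * F j\<close> come from \<open>J\<close>
  times the leading power, and at \<open>n0\<close> also from the pole of \<open>J\<close> times
  coefficient \<open>n0 + 1\<close> of \<open>F j\<close>. The right-hand side has the same ones, so
  maximality of \<open>n0\<close> makes the difference zero.\<close>

lemma basis_recursion:
  assumes P1: "P 0 = 1" and max: "max_order (M_sharp N k) n0"
    and F: "\<And>j. F j \<in> M_sharp N k" and V: "\<And>j. qlaurent 1 (n0 - int j) (F j) (V j)"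
    and V0: "\<And>i j. i \<le> j \<Longrightarrow> tcoeff (V j) i = (if i = 0 then 1 else 0)" and z: "z \<in> UHP"
  shows "J z * F j z = (\<Sum>i\<le>Suc j. tcoeff P i * F (Suc j - i) z) + tcoeff (V j) (Suc j) * F 0 z"
proof -
  define u where "u = tcoeff (V j) (Suc j)"
  define D where "D = (\<lambda>z. J z * F j z + - 1 * ((\<Sum>i\<le>Suc j. tcoeff P i * F (Suc j - i) z) + u * F 0 z))"
  \<comment> \<open>The difference \<open>D\<close> with the common power \<open>n0 - Suc j\<close>
    of the parameter taken out.\<close>
  define R where "R = (\<lambda>q. P q * V j q - ((\<Sum>i\<le>Suc j. tcoeff P i * (q ^ i * V (Suc j - i) q)) + u * (q ^ Suc j * V 0 q)))"
  have hV: "V i holomorphic_on ball 0 1" for i using V[of i] by (simp add: qlaurent_def)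
  have "D \<in> M_sharp N k" unfolding D_def
    using M_sharp_mult[OF N J F] by (intro M_sharp_add M_sharp_cmult M_sharp_sum N F) auto
  moreover have "qlaurent 1 (n0 - int (Suc j)) D R" unfolding qlaurent_def
  proof (intro conjI ballI)
    show "R holomorphic_on ball 0 1" unfolding R_def by (intro holomorphic_intros holo_P hV)
    fix z assume z: "z \<in> UHP"
    define q where "q = qpar 1 z"
    have q: "q \<noteq> 0" by (simp add: q_def del: One_nat_def)
    have Fz: "F i z = q powi (n0 - int i) * V i q" for i using V[of i] z by (simp add: qlaurent_def q_def)
    have J': "J z * F j z = q powi (n0 - int (Suc j)) * (P q * V j q)"
    proof -
      have "q powi (n0 - int j) = q powi (n0 - int (Suc j)) * q"
        using q by (subst power_int_add_1[symmetric]) auto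
      then show ?thesis using J_q[OF z] q by (simp add: Fz flip: q_def del: One_nat_def)
    qed
    have F': "F (Suc j - i) z = q powi (n0 - int (Suc j)) * (q ^ i * V (Suc j - i) q)" if "i \<le> Suc j" for i
    proof -
      have "q powi (n0 - int (Suc j - i)) = q powi (n0 - int (Suc j) + int i)"
        using that by (simp add: of_nat_diff algebra_simps)
      also have "\<dots> = q powi (n0 - int (Suc j)) * q ^ i" using q by (simp add: power_int_add)
      finally show ?thesis by (simp add: Fz)
    qed
    have "(\<Sum>i\<le>Suc j. tcoeff P i * F (Suc j - i) z) =
        q powi (n0 - int (Suc j)) * (\<Sum>i\<le>Suc j. tcoeff P i * (q ^ i * V (Suc j - i) q))"
      unfolding sum_distrib_left by (rule sum.cong) (use F' in \<open>auto simp: mult_ac\<close>)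
    moreover have "F 0 z = q powi (n0 - int (Suc j)) * (q ^ Suc j * V 0 q)"
      using F'[of "Suc j"] by simp
    ultimately show "D z = qpar 1 z powi (n0 - int (Suc j)) * R (qpar 1 z)"
      unfolding D_def R_def J' q_def[symmetric] by (simp add: algebra_simps)
  qed
  moreover have "tcoeff R l = 0" if l: "l \<le> Suc j" for l
  proof -
    define p v where "p = fps_expansion P 0" and "v = (\<lambda>i. fps_expansion (V i) 0)"
    have "R has_fps_expansion p * v j -
        ((\<Sum>i\<le>Suc j. fps_const (tcoeff P i) * (fps_X ^ i * v (Suc j - i))) + fps_const u * (fps_X ^ Suc j * v 0))"
      unfolding R_def p_def v_def
      by (intro fps_expansion_intros holomorphic_ball_has_fps_expansion holo_P hV)
    then have R: "fps_expansion R 0 = p * v j -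
        ((\<Sum>i\<le>Suc j. fps_const (tcoeff P i) * (fps_X ^ i * v (Suc j - i))) + fps_const u * (fps_X ^ Suc j * v 0))"
      by (rule fps_expansion_eqI)
    have v: "fps_nth (v i) n = (if n = 0 then 1 else 0)" if "n \<le> i" for i n using V0[OF that] by (simp add: v_def)
    have p0: "fps_nth p 0 = 1" using P1 by (simp add: p_def fps_expansion_def)
    have "fps_nth (p * v j) l = (\<Sum>i=0..l. fps_nth p i * fps_nth (v j) (l - i))" by (simp add: fps_mult_nth)
    \<comment> \<open>By the gap in \<open>V j\<close> only \<open>i = l\<close> survives, except
      that for \<open>l = Suc j\<close> the index \<open>i = 0\<close> reaches the first coefficient
      after the gap.\<close>
    also have "\<dots> = (\<Sum>i=0..l. (if i = l then fps_nth p l else 0) + (if i = 0 \<and> l = Suc j then u else 0))"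
    proof (rule sum.cong[OF refl])
      fix i assume i: "i \<in> {0..l}"
      show "fps_nth p i * fps_nth (v j) (l - i) = (if i = l then fps_nth p l else 0) + (if i = 0 \<and> l = Suc j then u else 0)"
      proof (cases "i = 0 \<and> l = Suc j")
        case True
        then show ?thesis using p0 by (simp add: v_def u_def)
      next
        case False
        then have "l - i \<le> j" using l i by auto
        then show ?thesis using False i by (auto simp: v)
      qed
    qed
    also have "\<dots> = fps_nth p l + (if l = Suc j then u else 0)"
      by (cases "l = Suc j") (simp_all add: sum.distrib)
    finally have 1: "fps_nth (p * v j) l = fps_nth p l + (if l = Suc j then u else 0)" .
    have 2: "fps_nth (\<Sum>i\<le>Suc j. fps_const (tcoeff P i) * (fps_X ^ i * v (Suc j - i))) l = fps_nth p l"
    proof -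
      have "fps_nth (\<Sum>i\<le>Suc j. fps_const (tcoeff P i) * (fps_X ^ i * v (Suc j - i))) l =
        (\<Sum>i\<le>Suc j. if i = l then fps_nth p l else 0)"
        unfolding fps_sum_nth
      proof (rule sum.cong[OF refl])
        fix i assume "i \<in> {..Suc j}"
        then show "fps_nth (fps_const (tcoeff P i) * (fps_X ^ i * v (Suc j - i))) l = (if i = l then fps_nth p l else 0)"
          using l v[of "l - i" "Suc j - i"] by (auto simp: fps_X_power_mult_nth p_def)
      qed
      also have "\<dots> = fps_nth p l" using l by simp
      finally show ?thesis .
    qed
    have 3: "fps_nth (fps_const u * (fps_X ^ Suc j * v 0)) l = (if l = Suc j then u else 0)"
      using l v[of 0 0] by (auto simp: fps_X_power_mult_nth simp del: power_Suc)
    show ?thesis unfolding R fps_sub_nth fps_add_nth 1 2 3 by simp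
  qed
  ultimately have "D z = 0" by (intro max_order_imp_zero[OF max _ _ _ z]) auto
  then show ?thesis by (simp add: D_def u_def algebra_simps)
qed

end

text \<open>The product is a form of weight two that vanishes at the other cusps, so its constant
  term is zero; because of the gap in \<open>V\<close> this term has only the summands with
  \<open>i = 0\<close> and \<open>i = Suc j\<close>.\<close>

lemma basis_duality:
  assumes N: "N > 0" and F: "F \<in> M_sharp N k" and G: "G \<in> S_sharp N (2 - k)"
    and V: "qlaurent 1 (n0 - int j) F V" and W: "qlaurent 1 (- n0 - 1) G W"
    and V0: "\<And>i. i \<le> j \<Longrightarrow> tcoeff V i = (if i = 0 then 1 else 0)" and W0: "W 0 = 1"
  shows "tcoeff W (Suc j) = - tcoeff V (Suc j)"
proof -
  have "(\<lambda>z. F z * G z) \<in> S_sharp N 2" using S_sharp_mult[OF N F G] by simp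
  moreover have "qlaurent 1 (- int (Suc j)) (\<lambda>z. F z * G z) (\<lambda>q. V q * W q)"
  proof -
    have "n0 - int j + (- n0 - 1) = - int (Suc j)" by simp
    then show ?thesis using qlaurent_mult[OF V W] by (simp only:)
  qed
  ultimately have "tcoeff (\<lambda>q. V q * W q) (Suc j) = 0" by (rule weight_two_constant_term[OF N])
  moreover have "fps_expansion (\<lambda>q. V q * W q) 0 = fps_expansion V 0 * fps_expansion W 0"
    by (intro fps_expansion_eqI fps_expansion_intros holomorphic_ball_has_fps_expansion)
      (use V W in \<open>auto simp: qlaurent_def\<close>)
  moreover have "fps_nth (fps_expansion V 0 * fps_expansion W 0) (Suc j) = tcoeff W (Suc j) + tcoeff V (Suc j)"
  proof -
    have "fps_nth (fps_expansion V 0 * fps_expansion W 0) (Suc j) =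
        (\<Sum>i=0..Suc j. tcoeff V i * tcoeff W (Suc j - i))" by (simp only: fps_mult_nth)
    also have "\<dots> = (\<Sum>i=0..j. if i = 0 then tcoeff W (Suc j) else 0) + tcoeff V (Suc j)"
    proof -
      have "tcoeff W 0 = 1" using W0 by (simp add: fps_expansion_def)
      moreover have "(\<Sum>i=0..j. tcoeff V i * tcoeff W (Suc j - i)) = (\<Sum>i=0..j. if i = 0 then tcoeff W (Suc j) else 0)"
        by (rule sum.cong) (use V0 in auto)
      ultimately show ?thesis by (subst sum.atLeast0_atMost_Suc) simp
    qed
    finally show ?thesis by simp
  qed
  ultimately show ?thesis by (simp add: eq_neg_iff_add_eq_0)
qed

text \<open>The recursion says that the formal series with coefficients \<open>x j\<close>, times
  \<open>P q - t * q\<close>, is \<open>x 0 * W q\<close>. The denominator has no zero on the closed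
  disc of radius \<open>norm q\<close>, hence none on a slightly larger one, so the Taylor series of
  the quotient converges at \<open>q\<close>.\<close>

lemma power_series_of_recursion:
  assumes P: "P holomorphic_on ball 0 1" "P 0 = 1" and W: "W holomorphic_on ball 0 1" "W 0 = 1"
    and rec: "\<And>j. t * x j = (\<Sum>i\<le>Suc j. tcoeff P i * x (Suc j - i)) - tcoeff W (Suc j) * x 0"
    and q: "norm q < 1" and nz: "\<And>w. norm w \<le> norm q \<Longrightarrow> P w - t * w \<noteq> 0"
  shows "((\<lambda>j. x j * q ^ j) has_sum x 0 * W q / (P q - t * q)) UNIV"
proof -
  define D where "D = (\<lambda>q. P q - t * q)"
  have hD: "D holomorphic_on ball 0 1" unfolding D_def by (intro holomorphic_intros P)
  let ?S = "{w \<in> ball 0 1. D w \<in> - {0}}"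
  have "open (ball 0 1 \<inter> D -` (- {0}))"
    by (rule continuous_open_preimage) (use hD in \<open>auto intro: holomorphic_on_imp_continuous_on\<close>)
  then have "open ?S" by (simp add: vimage_def Int_def)
  moreover have "cball 0 (norm q) \<subseteq> ?S" using q nz by (auto simp: D_def)
  ultimately obtain e where e: "e > 0" "(\<Union>w\<in>cball 0 (norm q). ball w e) \<subseteq> ?S"
    using compact_subset_open_imp_ball_epsilon_subset[OF compact_cball] by metis
  define r where "r = norm q + e"
  have "ball 0 r \<subseteq> ?S"
  proof
    fix w :: complex assume w: "w \<in> ball 0 r"
    have "w \<in> (\<Union>w\<in>cball 0 (norm q). ball w e)"
    proof (cases "norm w \<le> norm q")
      case True
      then show ?thesis using e(1) by (intro UN_I[of w]) auto
    next
      case False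
      \<comment> \<open>The radial projection to the circle of radius \<open>norm q\<close>; it
        moves \<open>w\<close> by less than \<open>e\<close>.\<close>
      define w' where "w' = of_real (norm q / norm w) * w"
      have "norm w > 0" using False norm_ge_zero[of q] by linarith
      then have "norm w' = norm q" by (simp add: w'_def norm_mult norm_divide)
      moreover have "dist w' w = norm w - norm q"
      proof -
        have "w' - w = of_real (norm q / norm w - 1) * w" by (simp add: w'_def algebra_simps)
        then have "dist w' w = \<bar>norm q / norm w - 1\<bar> * norm w" by (simp only: dist_norm norm_mult norm_of_real)
        also have "\<dots> = \<bar>(norm q / norm w - 1) * norm w\<bar>" by (simp add: abs_mult)
        also have "(norm q / norm w - 1) * norm w = norm q - norm w" using \<open>norm w > 0\<close> by (simp add: field_simps)
        finally show ?thesis using False by simp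
      qed
      ultimately show ?thesis using w by (intro UN_I[of w']) (auto simp: r_def)
    qed
    then show "w \<in> ?S" using e(2) by blast
  qed
  then have r1: "ball 0 r \<subseteq> ball (0::complex) 1" and Dnz: "\<And>w. w \<in> ball 0 r \<Longrightarrow> D w \<noteq> 0"
    by blast+
  have r: "norm q < r" using e by (simp add: r_def)
  then have r0: "0 < r" using norm_ge_zero order_le_less_trans by blast
  define X where "X = (\<lambda>q. x 0 * W q / D q)"
  have hX: "X holomorphic_on ball 0 r"
    unfolding X_def by (intro holomorphic_intros holomorphic_on_subset[OF W(1)] holomorphic_on_subset[OF hD] r1 Dnz)
  define p w y where "p = fps_expansion P 0" and "w = fps_expansion W 0" and "y = fps_expansion X 0"
  have Xfps: "X has_fps_expansion y"
    unfolding y_def by (rule has_fps_expansion_fps_expansion[of "ball 0 r"]) (use hX r0 in auto)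
  have "(\<lambda>q. X q * (P q - t * q)) has_fps_expansion y * (p - fps_const t * fps_X)"
    unfolding p_def by (intro fps_expansion_intros Xfps holomorphic_ball_has_fps_expansion P)
  moreover have "\<forall>\<^sub>F q in nhds 0. X q * (P q - t * q) = x 0 * W q"
    unfolding eventually_nhds
    by (intro exI[of _ "ball 0 r"]) (use Dnz r0 in \<open>auto simp: X_def D_def\<close>)
  ultimately have "(\<lambda>q. x 0 * W q) has_fps_expansion y * (p - fps_const t * fps_X)"
    by (simp add: has_fps_expansion_cong)
  moreover have "(\<lambda>q. x 0 * W q) has_fps_expansion fps_const (x 0) * w"
    unfolding w_def by (intro fps_expansion_intros holomorphic_ball_has_fps_expansion W)
  ultimately have eq: "y * (p - fps_const t * fps_X) = fps_const (x 0) * w"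
    by (rule fps_expansion_unique_complex)
  have p0: "fps_nth p 0 = 1" and w0: "fps_nth w 0 = 1" using P W by (simp_all add: p_def w_def fps_expansion_def)
  have y0: "fps_nth y 0 = x 0" using arg_cong[OF eq, of "\<lambda>s. fps_nth s 0"] p0 w0 by simp
  have ySuc: "(\<Sum>i\<le>Suc j. fps_nth p i * fps_nth y (Suc j - i)) - t * fps_nth y j = x 0 * fps_nth w (Suc j)" for j
  proof -
    have "p * y - fps_const t * (fps_X * y) = fps_const (x 0) * w" using eq by (simp add: algebra_simps)
    from arg_cong[OF this, of "\<lambda>s. fps_nth s (Suc j)"] show ?thesis
      by (simp add: fps_mult_nth[of p y] atMost_atLeast0 del: sum.atMost_Suc sum.atLeast0_atMost_Suc sum.cl_ivl_Suc)
  qed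
  \<comment> \<open>The constant coefficient of \<open>P\<close> is 1, so the recursion determines
    each coefficient from the earlier ones.\<close>
  have "fps_nth y j = x j" for j
  proof (induction j rule: less_induct)
    case (less j)
    show ?case
    proof (cases j)
      case (Suc l)
      have split: "(\<Sum>i\<le>Suc l. fps_nth p i * g (Suc l - i)) = g (Suc l) + (\<Sum>i\<le>l. fps_nth p (Suc i) * g (l - i))"
        for g :: "nat \<Rightarrow> complex" using p0 by (subst sum.atMost_Suc_shift) simp
      have "fps_nth y (Suc l) = t * fps_nth y l + x 0 * fps_nth w (Suc l) - (\<Sum>i\<le>l. fps_nth p (Suc i) * fps_nth y (l - i))"
        using ySuc[of l] unfolding split by (simp add: algebra_simps)
      also have "\<dots> = t * x l + x 0 * fps_nth w (Suc l) - (\<Sum>i\<le>l. fps_nth p (Suc i) * x (l - i))"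
        using less Suc by (simp cong: sum.cong)
      also have "\<dots> = x (Suc l)"
        using rec[of l] unfolding p_def[symmetric] w_def[symmetric] split by (simp add: algebra_simps)
      finally show ?thesis using Suc by simp
    qed (use y0 in simp)
  qed
  moreover have "((\<lambda>j. fps_nth y j * q ^ j) has_sum X q) UNIV"
    unfolding y_def by (rule holomorphic_ball_has_sum[OF hX]) (use r in simp)
  ultimately show ?thesis by (simp add: X_def D_def)
qed

text \<open>The last assumption places \<open>z\<close> in the region of convergence: it lies higher
  than the whole orbit of \<open>\<tau>\<close>, so by injectivity the value
  \<open>f01 \<tau>\<close> is not taken at height \<open>Im z\<close> or above.\<close>

theorem theorem1p2:
  fixes N :: nat and k n0 n1 :: int
    and f g :: "int \<Rightarrow> complex \<Rightarrow> complex" and f01 :: "complex \<Rightarrow> complex"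
    and \<tau> z :: complex
  assumes "N \<in> {1, 2, 3, 4, 5, 6, 7, 8, 9, 10, 12, 13, 16, 18, 25}"
    and "even k"
    and "max_order (M_sharp N k) n0"
    and "max_order (S_sharp N (2 - k)) n1"
    and "\<And>m. m \<ge> -n0 \<Longrightarrow> reduced_form (M_sharp N k) m (f m)"
    and "\<And>m. m \<ge> -n1 \<Longrightarrow> reduced_form (S_sharp N (2 - k)) m (g m)"
    and "reduced_form (M_sharp N 0) 1 f01"
    and "\<tau> \<in> upper_half_plane" and "z \<in> upper_half_plane"
    and "\<And>A. A \<in> Gamma0 N \<Longrightarrow> Im (moebius_action A \<tau>) < Im z"
  shows "f01 z \<noteq> f01 \<tau> \<and>
    ((\<lambda>m. f m \<tau> * exp (2 * of_real pi * \<i> * z) powi m) has_sum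
       (f (-n0) \<tau> * g (n0 + 1) z / (f01 z - f01 \<tau>))) {-n0..}"
proof -
  have N: "N > 0" using assms(1) by auto
  note max = assms(3) and \<tau> = assms(8) and z = assms(9)
  obtain n where n: "max_order (M_sharp N 0) n" "n \<ge> - 1"
    using assms(7) unfolding reduced_form_def by auto
  obtain P where P: "qlaurent 1 (- 1) f01 P" "\<And>i. int i \<le> n + 1 \<Longrightarrow> tcoeff P i = (if i = 0 then 1 else 0)"
    using reduced_form_qlaurent[OF assms(7) n(1)] by metis
  have P1: "P 0 = 1" using P(2)[of 0] n(2) by (simp add: fps_expansion_def)
  have f01: "f01 \<in> M_sharp N 0" using assms(7) by (simp add: reduced_form_def)
  interpret hauptmodul N f01 P by unfold_locales (use N f01 P P1 in auto)
  \<comment> \<open>Indices are shifted to start at 0, so \<open>F 0\<close> is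
    \<open>f (-n0)\<close>.\<close>
  define F where "F = (\<lambda>j. f (int j - n0))"
  have F: "F j \<in> M_sharp N k" "reduced_form (M_sharp N k) (int j - n0) (F j)" for j
    using assms(5)[of "int j - n0"] by (auto simp: F_def reduced_form_def)
  have "\<exists>V. qlaurent 1 (n0 - int j) (F j) V \<and> (\<forall>i\<le>j. tcoeff V i = (if i = 0 then 1 else 0))" for j
  proof -
    obtain V where "qlaurent 1 (- (int j - n0)) (F j) V" "\<And>i. int i \<le> n0 + (int j - n0) \<Longrightarrow> tcoeff V i = (if i = 0 then 1 else 0)"
      using reduced_form_qlaurent[OF F(2) max] by metis
    then show ?thesis by auto
  qed
  then obtain V where V: "\<And>j. qlaurent 1 (n0 - int j) (F j) (V j)"
    "\<And>i j. i \<le> j \<Longrightarrow> tcoeff (V j) i = (if i = 0 then 1 else 0)" by metis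
  have V00: "V 0 0 = 1" using V(2)[of 0 0] by (simp add: fps_expansion_def)
  interpret top_form N f01 P k n0 "F 0" "V 0"
    by unfold_locales (use F(1)[of 0] max V(1)[of 0] V00 in auto)
  \<comment> \<open>This makes \<open>n0 + 1\<close> an admissible index for
    \<open>g\<close>.\<close>
  have n1: "n1 \<ge> - n0 - 1"
    using complementary_form assms(4) unfolding max_order_def by metis
  define G where "G = g (n0 + 1)"
  have "reduced_form (S_sharp N (2 - k)) (n0 + 1) G" unfolding G_def using assms(6) n1 by simp
  note G' = this
  then have G: "G \<in> S_sharp N (2 - k)" by (simp add: reduced_form_def)
  obtain W where W': "qlaurent 1 (- (n0 + 1)) G W" "\<And>i. int i \<le> n1 + (n0 + 1) \<Longrightarrow> tcoeff W i = (if i = 0 then 1 else 0)"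
    using reduced_form_qlaurent[OF G' assms(4)] by metis
  have W: "qlaurent 1 (- n0 - 1) G W" "tcoeff W 0 = 1" using W' n1 by auto
  have W0: "W 0 = 1" using W(2) by (simp add: fps_expansion_def)
  have dual: "tcoeff W (Suc j) = - tcoeff (V j) (Suc j)" for j
    by (rule basis_duality[OF N F(1) G V(1) W(1) V(2) W0])
  define q where "q = qpar 1 z"
  have q: "q \<noteq> 0" "norm q < 1" using qpar_in_ball[OF _ z, of 1] by (auto simp: q_def)
  have neq: "f01 w \<noteq> f01 \<tau>" if w: "w \<in> UHP" "Im w \<ge> Im z" for w
    using J_inj[OF \<tau> w(1)] assms(10) w(2) unfolding eqv_def by fastforce
  \<comment> \<open>The centre of the disc is \<open>\<infinity>\<close>, where \<open>P\<close> is
    1; the other points come from height at least \<open>Im z\<close>.\<close>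
  have nz: "P w - f01 \<tau> * w \<noteq> 0" if w: "norm w \<le> norm q" for w
  proof (cases "w = 0")
    case False
    obtain v where v: "v \<in> UHP" "qpar 1 v = w" using qpar_surj[of 1 w] False w q by auto
    have "Im v \<ge> Im z" using w unfolding v(2)[symmetric] q_def norm_qpar by simp
    then have "f01 v \<noteq> f01 \<tau>" using neq v(1) by blast
    then show ?thesis using J_q[OF v(1)] False unfolding v(2) by (auto simp: field_simps)
  qed (use P1 in simp)
  have rec: "f01 \<tau> * F j \<tau> = (\<Sum>i\<le>Suc j. tcoeff P i * F (Suc j - i) \<tau>) - tcoeff W (Suc j) * F 0 \<tau>" for j
    using basis_recursion[OF P1 max F(1) V \<tau>, of j] dual[of j] by simp
  have "((\<lambda>j. F j \<tau> * q ^ j) has_sum F 0 \<tau> * W q / (P q - f01 \<tau> * q)) UNIV"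
    using W(1) by (intro power_series_of_recursion holo_P P1 W0 rec q nz) (auto simp: qlaurent_def)
  \<comment> \<open>The power \<open>q powi (- n0)\<close> undoes the shift of indices.\<close>
  from has_sum_cmult_right[OF this, of "q powi (- n0)"]
  have "((\<lambda>j. f (int j - n0) \<tau> * q powi (int j - n0)) has_sum q powi (- n0) * (F 0 \<tau> * W q / (P q - f01 \<tau> * q))) UNIV"
    using q by (simp add: F_def power_int_diff power_int_minus field_simps)
  then have "((\<lambda>m. f m \<tau> * q powi m) has_sum q powi (- n0) * (F 0 \<tau> * W q / (P q - f01 \<tau> * q))) {-n0..}"
    by (subst (asm) has_sum_reindex_bij_witness[where T = "{-n0..}" and j = "\<lambda>j. int j - n0" and i = "\<lambda>m. nat (m + n0)"
         and h = "\<lambda>m. f m \<tau> * q powi m"]) auto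
  \<comment> \<open>\<open>G z\<close> and the difference of the Hauptmodul values each carry a
    factor \<open>1 / q\<close>, and these cancel.\<close>
  moreover have "q powi (- n0) * (F 0 \<tau> * W q / (P q - f01 \<tau> * q)) = F 0 \<tau> * G z / (f01 z - f01 \<tau>)"
  proof -
    have Gz: "G z = q powi (- n0) * W q / q"
      using W(1) z by (simp add: qlaurent_def q_def power_int_diff)
    have Jz: "f01 z - f01 \<tau> = (P q - f01 \<tau> * q) / q"
      using J_q[OF z] q by (simp add: q_def diff_divide_distrib)
    show ?thesis unfolding Gz Jz using q(1) by simp
  qed
  moreover have "exp (2 * of_real pi * \<i> * z) = q" by (simp add: q_def qpar_def)
  ultimately show ?thesis using neq[OF z order_refl] by (simp add: F_def G_def)
qed

end
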